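(* Let $G$ be a strong digraph of order at least two which has a collection of pairwise arc-disjoint cycles covering all its vertices, and let $k\ge 2$ be an integer. Then the arc set of $G^{\square k}$ can be partitioned into two sets $A_1,A_2$ such that both spanning subdigraphs $(V(G^{\square k}),A_1)$ and $(V(G^{\square k}),A_2)$ are strong. Moreover, for every fixed $k$, such a partition can be found in polynomial time.
   Context: All digraphs are finite, without loops or parallel arcs; cycles are directed. A digraph is strong if for every ordered pair of distinct vertices $x,y$ there is a directed path from $x$ to $y$. The Cartesian product $G\square H$ has vertex set $V(G)\times V(H)$ and an arc $(x,x')(y,y')$ whenever either $xy\in A(G)$ and $x'=y'$, or $x=y$ and $x'y'\in A(H)$. It is associative, and $G^{\square k}=G\square G\square\cdots\square G$ ($k$ factors). *)

theory Defs
  imports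
    "Graph_Theory.Graph_Theory"
    "HOL-Computational_Algebra.Polynomial"
begin

section \<open>Digraphs and Cartesian products\<close>

text \<open>
  Finite digraphs without loops and parallel arcs are the instances of the locale
  \<^locale>\<open>pair_digraph\<close>, whose arcs are ordered pairs of vertices.
  A cycle is represented by its list of arcs. As cycles are non-empty, two members of the
  collection that are rotations of each other share an arc, so the collection cannot
  contain them both.
  The vertices of a cycle are exactly the tails of its arcs.
\<close>

definition arc_disjoint_cycle_cover :: "'a pair_pre_digraph \<Rightarrow> ('a \<times> 'a) awalk set \<Rightarrow> bool" where
  "arc_disjoint_cycle_cover G C \<longleftrightarrow>
     (\<forall>p\<in>C. pre_digraph.cycle (with_proj G) p) \<and>
     (\<forall>p\<in>C. \<forall>q\<in>C. p \<noteq> q \<longrightarrow> set p \<inter> set q = {}) \<and>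
     (\<Union>p\<in>C. fst ` set p) = pverts G"

definition cart_prod :: "'a pair_pre_digraph \<Rightarrow> 'b pair_pre_digraph \<Rightarrow> ('a \<times> 'b) pair_pre_digraph" where
  "cart_prod G H =
     \<lparr>pverts = pverts G \<times> pverts H,
      parcs = {((x, x'), (y, y')) | x x' y y'.
                 ((x, y) \<in> parcs G \<and> x' = y' \<and> x' \<in> pverts H) \<or>
                 (x = y \<and> x \<in> pverts G \<and> (x', y') \<in> parcs H)}\<rparr>"

definition relabel :: "('a \<Rightarrow> 'b) \<Rightarrow> 'a pair_pre_digraph \<Rightarrow> 'b pair_pre_digraph" where
  "relabel f G = \<lparr>pverts = f ` pverts G, parcs = map_prod f f ` parcs G\<rparr>"

text \<open>
  To give all powers the same type, nested pairs are flattened: the vertices of the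
  \<open>k\<close>-th power are lists of length \<open>k\<close>. The recursion starts from the one-vertex
  digraph, which is neutral for the product up to isomorphism.
\<close>

primrec cart_power :: "'a pair_pre_digraph \<Rightarrow> nat \<Rightarrow> 'a list pair_pre_digraph" where
  "cart_power G 0 = \<lparr>pverts = {[]}, parcs = {}\<rparr>"
| "cart_power G (Suc k) = relabel (\<lambda>(x, xs). x # xs) (cart_prod G (cart_power G k))"

lemma pverts_cart_power:
  "pverts (cart_power G k) = {xs. length xs = k \<and> set xs \<subseteq> pverts G}"
proof (induction k)
  case (Suc k)
  show ?case
  proof (intro set_eqI iffI)
    fix xs assume "xs \<in> pverts (cart_power G (Suc k))"
    then show "xs \<in> {xs. length xs = Suc k \<and> set xs \<subseteq> pverts G}"
      using Suc by (auto simp: relabel_def cart_prod_def)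
  next
    fix xs assume "xs \<in> {xs. length xs = Suc k \<and> set xs \<subseteq> pverts G}"
    then show "xs \<in> pverts (cart_power G (Suc k))"
      using Suc by (cases xs) (auto simp: relabel_def cart_prod_def image_iff)
  qed
qed auto

lemma Cons_arc_cart_power_iff:
  "(x # xs, y # ys) \<in> parcs (cart_power G (Suc k)) \<longleftrightarrow>
     ((x, y) \<in> parcs G \<and> xs = ys \<and> xs \<in> pverts (cart_power G k)) \<or>
     (x = y \<and> x \<in> pverts G \<and> (xs, ys) \<in> parcs (cart_power G k))"
  by (force simp: relabel_def cart_prod_def image_iff)

definition strong_arc_partition :: "'a pair_pre_digraph \<Rightarrow> 'a rel \<Rightarrow> 'a rel \<Rightarrow> bool" where
  "strong_arc_partition D A1 A2 \<longleftrightarrow>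
     A1 \<union> A2 = parcs D \<and> A1 \<inter> A2 = {} \<and>
     strongly_connected (with_proj \<lparr>pverts = pverts D, parcs = A1\<rparr>) \<and>
     strongly_connected (with_proj \<lparr>pverts = pverts D, parcs = A2\<rparr>)"

section \<open>Polynomial time\<close>

text \<open>
  Time is measured on a unit-cost random access machine over the natural numbers, programmed
  with while loops. A program has finitely many arrays; a memory cell is addressed
  by the (constant) number of an array and a list of computed indices, whose length is fixed by the
  program text. The list \<open>[]\<close> gives scalar variables. The only arithmetic operations are
  addition and truncated subtraction: multiplication is deliberately absent, so numbers
  computed in \<open>t\<close> steps have \<open>O(t)\<close> more bits than the constants and the input, and
  polynomial time on this machine is polynomial time on Turing machines.
\<close>

type_synonym store = "nat \<Rightarrow> nat list \<Rightarrow> nat"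

datatype expr =
    Const nat
  | Cell nat "expr list"
  | Plus expr expr
  | Minus expr expr

primrec eval_expr :: "expr \<Rightarrow> store \<Rightarrow> nat" where
  "eval_expr (Const m) s = m"
| "eval_expr (Cell a es) s = s a (map (\<lambda>e. eval_expr e s) es)"
| "eval_expr (Plus e f) s = eval_expr e s + eval_expr f s"
| "eval_expr (Minus e f) s = eval_expr e s - eval_expr f s"

primrec expr_cost :: "expr \<Rightarrow> nat" where
  "expr_cost (Const m) = 1"
| "expr_cost (Cell a es) = 1 + sum_list (map expr_cost es)"
| "expr_cost (Plus e f) = 1 + expr_cost e + expr_cost f"
| "expr_cost (Minus e f) = 1 + expr_cost e + expr_cost f"

datatype prog =
    Skip
  | Assign nat "expr list" expr
  | Seq prog prog
  | IfElse expr prog prog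
  | While expr prog

definition update :: "store \<Rightarrow> nat \<Rightarrow> nat list \<Rightarrow> nat \<Rightarrow> store" where
  "update s a is v = s(a := (s a)(is := v))"

text \<open>
  \<open>exec c s t s'\<close>: started in \<open>s\<close>, the program \<open>c\<close> halts in \<open>s'\<close> after exactly \<open>t\<close> steps.
  A guard counts as true iff its value is non-zero.
\<close>

inductive exec :: "prog \<Rightarrow> store \<Rightarrow> nat \<Rightarrow> store \<Rightarrow> bool" where
  Skip: "exec Skip s 1 s"
| Assign: "exec (Assign a es e) s (1 + sum_list (map expr_cost es) + expr_cost e)
     (update s a (map (\<lambda>e. eval_expr e s) es) (eval_expr e s))"
| Seq: "exec c s t s' \<Longrightarrow> exec d s' t' s'' \<Longrightarrow> exec (Seq c d) s (t + t') s''"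
| IfTrue: "eval_expr e s \<noteq> 0 \<Longrightarrow> exec c s t s' \<Longrightarrow> exec (IfElse e c d) s (1 + expr_cost e + t) s'"
| IfFalse: "eval_expr e s = 0 \<Longrightarrow> exec d s t s' \<Longrightarrow> exec (IfElse e c d) s (1 + expr_cost e + t) s'"
| WhileFalse: "eval_expr e s = 0 \<Longrightarrow> exec (While e c) s (1 + expr_cost e) s"
| WhileTrue: "eval_expr e s \<noteq> 0 \<Longrightarrow> exec c s t s' \<Longrightarrow> exec (While e c) s' t' s'' \<Longrightarrow>
     exec (While e c) s (1 + expr_cost e + t + t') s''"

inductive_cases exec_cases:
  "exec Skip s t s'" "exec (Assign a es e) s t s'" "exec (Seq c d) s t s'"
  "exec (IfElse e c d) s t s'" "exec (While e c) s t s'"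

lemma exec_deterministic:
  "exec c s t s' \<Longrightarrow> exec c s u s'' \<Longrightarrow> t = u \<and> s' = s''"
proof (induction arbitrary: u s'' rule: exec.induct)
  case (Skip s)
  then show ?case by (auto elim: exec_cases(1))
next
  case (Assign a es e s)
  then show ?case by (auto elim: exec_cases(2))
next
  case (Seq c s t s' d t' s2)
  from Seq.prems show ?case
  proof (rule exec_cases(3))
    fix v r v'
    assume *: "u = v + v'" "exec c s v r" "exec d r v' s''"
    have "t = v" "s' = r" using Seq.IH(1)[OF *(2)] by auto
    with Seq.IH(2) * show ?thesis by simp
  qed
next
  case (IfTrue e s c t s' d)
  from IfTrue.prems show ?case
    by (rule exec_cases(4)) (use IfTrue.hyps(1) IfTrue.IH in auto)
next
  case (IfFalse e s d t s' c)
  from IfFalse.prems show ?case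
    by (rule exec_cases(4)) (use IfFalse.hyps(1) IfFalse.IH in auto)
next
  case (WhileFalse e s c)
  from WhileFalse.prems show ?case
    by (rule exec_cases(5)) (use WhileFalse.hyps in auto)
next
  case (WhileTrue e s c t s' t' s2)
  from WhileTrue.prems show ?case
  proof (rule exec_cases(5))
    fix v r v'
    assume *: "u = Suc (expr_cost e + v + v')" "exec c s v r" "exec (While e c) r v' s''"
    have "t = v" "s' = r" using WhileTrue.IH(1)[OF *(2)] by auto
    with WhileTrue.IH(2) * show ?thesis by simp
  qed (use WhileTrue.hyps(1) in simp)
qed

text \<open>
  Input: a digraph with vertex set \<open>{..<n}\<close>, given by its order in the scalar \<open>0\<close> and its
  adjacency matrix in array \<open>1\<close>; every other cell is \<open>0\<close>.
  Output: array \<open>2\<close>, indexed by the concatenation of two vertices of the power, holds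
  the number (1 or 2) of the part to which the arc between them belongs, and any other
  number if there is no such arc.
\<close>

definition encode_digraph :: "nat pair_pre_digraph \<Rightarrow> store" where
  "encode_digraph G = (\<lambda>a is.
     if a = 0 \<and> is = [] then card (pverts G)
     else if a = 1 \<and> (\<exists>u v. is = [u, v] \<and> (u, v) \<in> parcs G) then 1
     else 0)"

definition decode_part :: "nat pair_pre_digraph \<Rightarrow> nat \<Rightarrow> store \<Rightarrow> nat \<Rightarrow> nat list rel" where
  "decode_part G k s j =
     {(xs, ys). xs \<in> pverts (cart_power G k) \<and> ys \<in> pverts (cart_power G k) \<and> s 2 (xs @ ys) = j}"

end

theory Submission
  imports Defs
begin

text \<open>
  In the square colour the arcs of the first factor red and those of the second blue, and exchange
  the colours along an antidiagonal of \<open>C \<box> C\<close> for every cycle \<open>C\<close> of the cover. Then both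
  colours are Hamiltonian cycles on each \<open>C \<box> C\<close>, so that every row is strong in red and every
  column in blue, and rows over the same cycle are joined. To join the others,
  let \<open>uw\<close> be an arc outside the cycles whose head is not on the chosen cycle through \<open>u\<close>, and let \<open>s\<close>
  be the successor of \<open>u\<close> on that cycle; exchange the colours of the two arcs that enter
  \<open>(s, w)\<close> from \<open>(u, w)\<close> and from \<open>(s, u)\<close>, and those of the two that enter \<open>(w, s)\<close>. Red then leads from
  every diagonal vertex \<open>(u, u)\<close> to \<open>(w, w)\<close>, while each row still leads to and is reached from the diagonal.
  In a higher power the remaining coordinates join the copies of the square, in red at a
  diagonal vertex and in blue at a vertex off the diagonal.

  A cover is found as a perfect matching between arcs and their continuations, by augmenting
  paths. The arcs that it uses form a balanced digraph, from which cycles are removed one by one.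
\<close>

section \<open>The square\<close>

text \<open>The cycles of the cover are only arc-disjoint and may share vertices; this is why one of
  them has to be chosen at every vertex. If an arc \<open>u w\<close> lies on some cycle, or
  \<open>w\<close> lies on the chosen cycle through \<open>u\<close>, a single block already joins
  \<open>(u, u)\<close> to \<open>(w, w)\<close>; exchanges are made for the other arcs alone.
  Requiring \<open>w\<close> to be off the chosen cycle is what keeps these exchanges from damaging
  any block. Their price is that red loses the arc from \<open>(u, w)\<close> to
  \<open>(s, w)\<close>, and the way around it leads through the diagonal. For the algorithm,
  arc-disjoint cycles that cover all vertices exist if and only if some balanced subdigraph has an
  arc leaving every vertex. This is a flow problem with lower bounds; the matching expresses it by a
  plain bipartite graph, in which the elements \<open>(v, v)\<close> enforce the lower bounds. All
  loops run for a number of rounds that is known in advance and idle once their goal is reached, so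
  that halting and polynomial time can be read off the program text.\<close>

lemma rtrancl_trans3:
  "(a, b) \<in> R\<^sup>* \<Longrightarrow> (b, c) \<in> R\<^sup>* \<Longrightarrow> (c, d) \<in> R\<^sup>* \<Longrightarrow> (a, d) \<in> R\<^sup>*"
  by (meson rtrancl_trans)

text \<open>Cycles are periodic sequences over the integers, so that the antidiagonal is simply
  \<open>w = P j (- t)\<close>. \<open>P_disjoint\<close> deliberately speaks of arcs: different
  cycles may share vertices.\<close>

locale cycles =
  fixes A :: "'a rel" and J :: "'j set" and m :: "'j \<Rightarrow> nat" and P :: "'j \<Rightarrow> int \<Rightarrow> 'a"
  assumes m_pos: "j \<in> J \<Longrightarrow> m j > 0"
    and P_eq_iff: "j \<in> J \<Longrightarrow> P j t = P j r \<longleftrightarrow> t mod int (m j) = r mod int (m j)"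
    and P_arc: "j \<in> J \<Longrightarrow> (P j t, P j (t + 1)) \<in> A"
    and P_disjoint: "i \<in> J \<Longrightarrow> j \<in> J \<Longrightarrow> P i t = P j r \<Longrightarrow> P i (t + 1) = P j (r + 1) \<Longrightarrow> i = j"
begin

definition cyc_arcs :: "'a rel" where
  "cyc_arcs = {(P j t, P j (t + 1)) | j t. j \<in> J}"

end

text \<open>\<open>lab u\<close> selects one of the possibly several cycles through
  \<open>u\<close>, and \<open>s u\<close> is the successor of \<open>u\<close> on that
  cycle.\<close>

locale cycle_family = cycles A J m P
  for A :: "'a rel" and J :: "'j set" and m :: "'j \<Rightarrow> nat" and P :: "'j \<Rightarrow> int \<Rightarrow> 'a" +
  fixes V :: "'a set" and lab :: "'a \<Rightarrow> 'j" and s :: "'a \<Rightarrow> 'a"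
  assumes arcs_in: "A \<subseteq> V \<times> V"
    and loopless: "(u, u) \<notin> A"
    and strong: "u \<in> V \<Longrightarrow> v \<in> V \<Longrightarrow> (u, v) \<in> A\<^sup>*"
    and lab_in: "u \<in> V \<Longrightarrow> lab u \<in> J"
    and s_succ: "u \<in> V \<Longrightarrow> \<exists>t. u = P (lab u) t \<and> s u = P (lab u) (t + 1)"
begin

text \<open>For every arc \<open>(u, w)\<close> that fails this condition, one block contains both
  \<open>(u, u)\<close> and \<open>(w, w)\<close>.\<close>

definition cross :: "'a \<Rightarrow> 'a \<Rightarrow> bool" where
  "cross u w \<longleftrightarrow> (u, w) \<in> A \<and> (u, w) \<notin> cyc_arcs \<and> w \<notin> range (P (lab u))"

text \<open>An arc \<open>(u, v)\<close> of the first factor over \<open>w\<close> is red unless \<open>swapped u v w\<close>, an arc of the second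
  factor over \<open>w\<close> only if. The first disjunct gives two Hamiltonian cycles on the square of each
  cycle; the other two exchange the arcs that enter \<open>(s u, w)\<close> from \<open>(u, w)\<close> and \<open>(s u, u)\<close>, and
  symmetrically those that enter \<open>(w, s u)\<close>. The blue digraph is the transpose of the red one, so it
  suffices to treat red.\<close>

definition swapped :: "'a \<Rightarrow> 'a \<Rightarrow> 'a \<Rightarrow> bool" where
  "swapped u v w \<longleftrightarrow> (\<exists>j\<in>J. \<exists>t. u = P j t \<and> v = P j (t + 1) \<and> w = P j (- t))
     \<or> cross u w \<and> v = s u \<or> cross u v \<and> w = s u"

end

definition square_red :: "'a set \<Rightarrow> 'a rel \<Rightarrow> ('a \<Rightarrow> 'a \<Rightarrow> 'a \<Rightarrow> bool) \<Rightarrow> ('a \<times> 'a) rel" where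
  "square_red V A Q = {((u, w), (v, w)) | u v w. (u, v) \<in> A \<and> w \<in> V \<and> \<not> Q u v w}
     \<union> {((w, u), (w, v)) | u v w. (u, v) \<in> A \<and> w \<in> V \<and> Q u v w}"

section \<open>Strong connectivity of the red digraph: blocks, rows, diagonal\<close>

context cycle_family
begin

abbreviation "Red \<equiv> square_red V A swapped"

lemma Red_H: "(u, v) \<in> A \<Longrightarrow> w \<in> V \<Longrightarrow> \<not> swapped u v w \<Longrightarrow> ((u, w), (v, w)) \<in> Red\<^sup>*"
  by (auto simp: square_red_def intro!: r_into_rtrancl)

lemma Red_V: "(u, v) \<in> A \<Longrightarrow> w \<in> V \<Longrightarrow> swapped u v w \<Longrightarrow> ((w, u), (w, v)) \<in> Red\<^sup>*"
  by (auto simp: square_red_def intro!: r_into_rtrancl)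

lemma P_in: "j \<in> J \<Longrightarrow> P j t \<in> V"
  using P_arc arcs_in by blast

lemma s_in_range: "u \<in> V \<Longrightarrow> s u \<in> range (P (lab u))" "u \<in> V \<Longrightarrow> u \<in> range (P (lab u))"
  using s_succ by blast+

lemma s_arc: "u \<in> V \<Longrightarrow> (u, s u) \<in> A"
  using s_succ[of u] lab_in[of u] P_arc by metis

lemma crossD: "cross u w \<Longrightarrow> u \<in> V \<and> w \<in> V \<and> (u, w) \<in> A \<and> w \<noteq> s u \<and> u \<noteq> w \<and> s u \<noteq> u \<and> w \<notin> range (P (lab u))"
proof -
  assume c: "cross u w"
  then have "(u, w) \<in> A" "w \<notin> range (P (lab u))" by (auto simp: cross_def)
  moreover from this have "u \<in> V" "w \<in> V" using arcs_in by auto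
  ultimately show ?thesis
    using s_in_range[of u] s_arc[of u] loopless by auto
qed

text \<open>Inside a block only the antidiagonal exchanges are visible. The second disjunct of
  \<open>swapped\<close> concerns the arc \<open>(u, s u)\<close>, which by arc-disjointness lies on
  the cycle \<open>lab u\<close> alone, over a vertex off that cycle; the third concerns an arc that
  is on no cycle.\<close>

lemma swapped_on_cycle:
  assumes j: "j \<in> J"
  shows "swapped (P j t) (P j (t + 1)) (P j r) \<longleftrightarrow> (t + r) mod int (m j) = 0"
proof
  assume "swapped (P j t) (P j (t + 1)) (P j r)"
  then consider i q where "i \<in> J" "P j t = P i q" "P j (t + 1) = P i (q + 1)" "P j r = P i (- q)"
    | "cross (P j t) (P j r)" "P j (t + 1) = s (P j t)"
    | "cross (P j t) (P j (t + 1))"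
    unfolding swapped_def by blast
  then show "(t + r) mod int (m j) = 0"
  proof cases
    case 1
    then have "i = j" using P_disjoint j by metis
    then have "t mod int (m j) = q mod int (m j)" "r mod int (m j) = (- q) mod int (m j)"
      using 1 P_eq_iff[OF j] by auto
    then have "(t + r) mod int (m j) = (q + - q) mod int (m j)"
      by (rule mod_add_cong)
    then show ?thesis by simp
  next
    case 2
    let ?u = "P j t"
    have "?u \<in> V" using P_in j by simp
    then obtain q where "?u = P (lab ?u) q" "s ?u = P (lab ?u) (q + 1)" using s_succ by blast
    then have "lab ?u = j" using P_disjoint[of j "lab ?u" t q] j 2(2) lab_in[OF \<open>?u \<in> V\<close>] by metis
    then show ?thesis using crossD[OF 2(1)] by auto
  next
    case 3
    then show ?thesis using j by (auto simp: cross_def cyc_arcs_def)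
  qed
next
  assume a: "(t + r) mod int (m j) = 0"
  have "P j r = P j (- t)"
    unfolding P_eq_iff[OF j] mod_eq_dvd_iff using a by (simp add: dvd_eq_mod_eq_0 add.commute)
  then show "swapped (P j t) (P j (t + 1)) (P j r)"
    unfolding swapped_def using j by blast
qed

text \<open>In red, row \<open>r\<close> of the block is a path from column \<open>1 - r\<close> to
  column \<open>- r\<close>, and there the exchange supplies the vertical arc to the start of the
  path of row \<open>r + 1\<close>: this is the Hamiltonian cycle. At least one change of row is
  made, since columns behind the current one cannot be reached within the row path.\<close>

lemma block_strong_aux:
  assumes j: "j \<in> J"
  shows "((P j t, P j r), (P j t', P j (r + 1 + int k))) \<in> Red\<^sup>*"
proof -
  let ?m = "int (m j)"
  have m: "?m > 0" using m_pos[OF j] by simp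
  have row: "((P j (1 - r + int i), P j r), (P j (1 - r + int (i + l)), P j r)) \<in> Red\<^sup>*"
    if "i + l < m j" for i l r
    using that
  proof (induction l)
    case (Suc l)
    let ?t = "1 - r + int (i + l)"
    have "(?t + r) mod ?m = 1 + int (i + l)"
      using Suc.prems by (subst mod_pos_pos_trivial) auto
    then have "\<not> swapped (P j ?t) (P j (?t + 1)) (P j r)"
      unfolding swapped_on_cycle[OF j] by simp
    from rtrancl_trans[OF _ Red_H[OF P_arc[OF j] P_in[OF j] this]] Suc show ?case
      by (simp add: algebra_simps)
  qed simp
  have ix: "\<exists>i < m j. P j t = P j (1 - r + int i)" for t r
  proof (intro exI conjI)
    let ?i = "nat ((t + r - 1) mod ?m)"
    show "?i < m j" using m by (simp add: nat_less_iff)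
    have "(1 - r + int ?i) mod ?m = (1 - r + (t + r - 1)) mod ?m"
      using m by (simp add: mod_simps)
    then show "P j t = P j (1 - r + int ?i)"
      unfolding P_eq_iff[OF j] by simp
  qed
  have start: "((P j (1 - r), P j r), (P j t, P j r)) \<in> Red\<^sup>*" for t r
    using ix[of t r] row[of 0 _ r] by auto
  have up: "((P j t, P j r), (P j (1 - (r + 1)), P j (r + 1))) \<in> Red\<^sup>*" for t r
  proof -
    obtain i where i: "i < m j" "P j t = P j (1 - r + int i)" using ix by blast
    have "P j (1 - r + int (i + (m j - 1 - i))) = P j (- r)"
      unfolding P_eq_iff[OF j] using i by (simp add: of_nat_diff)
    then have 1: "((P j t, P j r), (P j (- r), P j r)) \<in> Red\<^sup>*"
      using row[of i "m j - 1 - i" r] i by simp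
    have "swapped (P j r) (P j (r + 1)) (P j (- r))"
      unfolding swapped_on_cycle[OF j] by simp
    from rtrancl_trans[OF 1 Red_V[OF P_arc[OF j] P_in[OF j] this]] show ?thesis by simp
  qed
  show ?thesis
  proof (induction k arbitrary: t')
    case 0
    show ?case using rtrancl_trans[OF up[of t r] start[of "r + 1" t']] by simp
  next
    case (Suc k)
    have eq: "r + 1 + int k + 1 = r + 1 + int (Suc k)" by simp
    show ?case
      using rtrancl_trans[OF rtrancl_trans[OF Suc[of t] up[of t "r + 1 + int k"]]]
        start[of "r + 1 + int (Suc k)" t']
      unfolding eq by blast
  qed
qed

lemma block_strong:
  assumes j: "j \<in> J" and "x \<in> range (P j)" "y \<in> range (P j)" "x' \<in> range (P j)" "y' \<in> range (P j)"
  shows "((x, y), (x', y')) \<in> Red\<^sup>*"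
proof -
  obtain t r t' r' where eq: "x = P j t" "y = P j r" "x' = P j t'" "y' = P j r'"
    using assms by blast
  have m: "int (m j) > 0" using m_pos[OF j] by simp
  let ?k = "nat ((r' - r - 1) mod int (m j))"
  have "(r + 1 + int ?k) mod int (m j) = r' mod int (m j)"
    using m by (simp add: mod_simps)
  then have "P j (r + 1 + int ?k) = y'" using eq P_eq_iff[OF j] by simp
  then show ?thesis using block_strong_aux[OF j, of t r t' ?k] eq by simp
qed

text \<open>A horizontal arc that was exchanged is replaced by a red path: inside a block because
  the block is strong, and over \<open>w = s u\<close> by the detour \<open>(u, s u)\<close>,
  \<open>(u, u)\<close>, \<open>(v, u)\<close>, \<open>(v, s u)\<close>, whose last arc became red
  by the companion exchange. The arcs excluded by the third hypothesis are treated with the help of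
  the diagonal.\<close>

lemma row_arc:
  assumes "(u, v) \<in> A" "w \<in> V" "\<not> (cross u w \<and> v = s u)"
  shows "((u, w), (v, w)) \<in> Red\<^sup>*"
proof (cases "swapped u v w")
  case False
  then show ?thesis using Red_H assms by blast
next
  case True
  then consider j where "j \<in> J" "u \<in> range (P j)" "v \<in> range (P j)" "w \<in> range (P j)"
    | "cross u v" "w = s u"
    unfolding swapped_def using assms by blast
  then show ?thesis
  proof cases
    case 1
    then show ?thesis using block_strong by blast
  next
    case 2
    note c = crossD[OF 2(1)]
    have 1: "((u, w), (u, u)) \<in> Red\<^sup>*"
      using block_strong[of "lab u"] c lab_in s_in_range 2 by simp
    have "\<not> swapped u v u"
      using c 2(1) loopless unfolding swapped_def
      by (auto simp: cross_def cyc_arcs_def)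
    then have 3: "((u, u), (v, u)) \<in> Red\<^sup>*" using Red_H c by blast
    have "swapped u (s u) v" using 2 by (simp add: swapped_def)
    then have "((v, u), (v, s u)) \<in> Red\<^sup>*" using Red_V c s_arc by blast
    then show ?thesis using rtrancl_trans3[OF 1 3] 2(2) by simp
  qed
qed

text \<open>If the walk towards \<open>z\<close> in row \<open>z\<close> meets a missing arc, it is at an in-neighbour of \<open>z\<close> and
  can go to \<open>(z, z)\<close> at once.\<close>

lemma to_diagonal:
  assumes "z \<in> V" "(w, z) \<in> A\<^sup>*"
  shows "((w, z), (z, z)) \<in> Red\<^sup>*"
  using assms(2)
proof (induction rule: converse_rtrancl_induct)
  case (step w w')
  show ?case
  proof (cases "cross w z \<and> w' = s w")
    case True
    then have "cross w z" by simp
    note c = crossD[OF this]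
    have "\<not> swapped w z z"
      using c \<open>cross w z\<close> unfolding swapped_def by (auto simp: cross_def cyc_arcs_def)
    then show ?thesis using Red_H c by blast
  next
    case False
    show ?thesis using rtrancl_trans[OF row_arc[OF step(1) assms(1) False] step(3)] by simp
  qed
qed simp

text \<open>For a \<open>cross\<close> arc the exchange opens a red vertical arc at
  \<open>(s y, y)\<close>, which is in the block of \<open>(y, y)\<close>. It lands in row
  \<open>y'\<close>, where \<open>to_diagonal\<close> applies.\<close>

lemma diagonal_arc:
  assumes "(y, y') \<in> A"
  shows "((y, y), (y', y')) \<in> Red\<^sup>*"
proof -
  have V: "y \<in> V" "y' \<in> V" using assms arcs_in by auto
  consider "(y, y') \<in> cyc_arcs" | "y' \<in> range (P (lab y))" | "cross y y'"
    using assms cross_def by blast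
  then show ?thesis
  proof cases
    case 1
    then obtain j where "j \<in> J" "y \<in> range (P j)" "y' \<in> range (P j)" by (auto simp: cyc_arcs_def)
    then show ?thesis using block_strong by blast
  next
    case 2
    then show ?thesis using block_strong[of "lab y"] V lab_in s_in_range by simp
  next
    case 3
    have "((y, y), (s y, y)) \<in> Red\<^sup>*"
      using block_strong[of "lab y"] V lab_in s_in_range by simp
    moreover have "((s y, y), (s y, y')) \<in> Red\<^sup>*"
      using Red_V[OF assms, of "s y"] 3 s_arc[OF V(1)] arcs_in by (auto simp: swapped_def)
    moreover have "((s y, y'), (y', y')) \<in> Red\<^sup>*"
      using to_diagonal strong V s_arc[OF V(1)] arcs_in by blast
    ultimately show ?thesis by (rule rtrancl_trans3)
  qed
qed

lemma diagonal:
  assumes "x \<in> V" "y \<in> V"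
  shows "((x, x), (y, y)) \<in> Red\<^sup>*"
  using strong[OF assms]
  by (induction rule: rtrancl_induct) (auto dest: diagonal_arc rtrancl_trans)

text \<open>If the arc from \<open>(w, z)\<close> to \<open>(s w, z)\<close> is missing, its head is
  entered from \<open>(s w, w)\<close> instead, and that vertex is reached through
  \<open>(w, w)\<close>. This needs \<open>diagonal\<close>, which rests on
  \<open>to_diagonal\<close> only, so there is no circularity.\<close>

lemma from_diagonal:
  assumes "z \<in> V" "(z, w) \<in> A\<^sup>*"
  shows "((z, z), (w, z)) \<in> Red\<^sup>*"
  using assms(2)
proof (induction rule: rtrancl_induct)
  case (step w w')
  show ?case
  proof (cases "cross w z \<and> w' = s w")
    case True
    then have "cross w z" by simp
    note c = crossD[OF this]
    have "((z, z), (w, w)) \<in> Red\<^sup>*" using diagonal c by blast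
    moreover have "((w, w), (s w, w)) \<in> Red\<^sup>*"
      using block_strong[of "lab w"] c lab_in s_in_range by simp
    moreover have "((s w, w), (s w, z)) \<in> Red\<^sup>*"
      using Red_V[of w z "s w"] c True s_arc[of w] arcs_in by (auto simp: swapped_def)
    ultimately have "((z, z), (s w, z)) \<in> Red\<^sup>*" by (rule rtrancl_trans3)
    then show ?thesis using True by simp
  next
    case False
    then show ?thesis using rtrancl_trans[OF step(3) row_arc[OF step(2) assms(1) False]] by simp
  qed
qed simp

theorem Red_strong:
  assumes "a \<in> V" "b \<in> V" "c \<in> V" "d \<in> V"
  shows "((a, b), (c, d)) \<in> Red\<^sup>*"
proof -
  have "((a, b), (b, b)) \<in> Red\<^sup>*" "((b, b), (d, d)) \<in> Red\<^sup>*" "((d, d), (c, d)) \<in> Red\<^sup>*"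
    using to_diagonal diagonal from_diagonal strong assms by auto
  then show ?thesis by (rule rtrancl_trans3)
qed

end

section \<open>Higher powers\<close>

text \<open>Replaces the reachability of the graph library, which is confined to the vertex set, by
  plain \<open>rtrancl\<close>, in which all walks are built.\<close>

lemma strongly_connected_iff:
  assumes "A \<subseteq> V \<times> V"
  shows "strongly_connected (with_proj \<lparr>pverts = V, parcs = A\<rparr>) \<longleftrightarrow>
    V \<noteq> {} \<and> (\<forall>u\<in>V. \<forall>v\<in>V. (u, v) \<in> A\<^sup>*)"
proof -
  have "(u, v) \<in> A\<^sup>* \<longleftrightarrow> (u, v) \<in> rtrancl_on V A" if "u \<in> V" for u v
  proof
    assume "(u, v) \<in> A\<^sup>*"
    then show "(u, v) \<in> rtrancl_on V A"
      using assms that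
      by (induction rule: rtrancl_induct) (auto intro: rtrancl_on_into_rtrancl_on)
  qed (rule rtrancl_on_rtranclI)
  then show ?thesis by (auto simp: strongly_connected_def reachable_def)
qed

text \<open>The part of an arc of the power that starts in \<open>x # y # zs\<close>; the arcs in the later
  coordinates join the copies of the square at the diagonal in the first part and off it in
  the second.\<close>

fun first_part :: "('a \<Rightarrow> 'a \<Rightarrow> 'a \<Rightarrow> bool) \<Rightarrow> 'a list \<Rightarrow> 'a list \<Rightarrow> bool" where
  "first_part Q (x # y # zs) (x' # y' # zs') \<longleftrightarrow>
     (if zs \<noteq> zs' then x = y else if x \<noteq> x' then \<not> Q x x' y else Q y y' x)"
| "first_part Q _ _ \<longleftrightarrow> False"

lemma parcs_cart_power:
  "parcs G \<subseteq> pverts G \<times> pverts G \<Longrightarrow>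
    parcs (cart_power G k) \<subseteq> pverts (cart_power G k) \<times> pverts (cart_power G k)"
  by (induction k) (auto simp: relabel_def cart_prod_def)

lemma cart_power_strong:
  assumes "\<And>u v. u \<in> pverts G \<Longrightarrow> v \<in> pverts G \<Longrightarrow> (u, v) \<in> (parcs G)\<^sup>*"
    and sub: "parcs G \<subseteq> pverts G \<times> pverts G"
  shows "xs \<in> pverts (cart_power G k) \<Longrightarrow> ys \<in> pverts (cart_power G k) \<Longrightarrow>
    (xs, ys) \<in> (parcs (cart_power G k))\<^sup>*"
proof (induction k arbitrary: xs ys)
  case 0
  then show ?case by simp
next
  case (Suc k)
  let ?R = "parcs (cart_power G (Suc k))"
  obtain x xs' y ys' where eq: "xs = x # xs'" "ys = y # ys'"
    and V: "x \<in> pverts G" "y \<in> pverts G" "xs' \<in> pverts (cart_power G k)" "ys' \<in> pverts (cart_power G k)"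
    using Suc.prems unfolding pverts_cart_power
    by (cases xs; cases ys) auto
  have "(xs', ys') \<in> (parcs (cart_power G k))\<^sup>*" using Suc.IH V by blast
  then have 1: "(x # xs', x # ys') \<in> ?R\<^sup>*"
  proof (induction rule: rtrancl_induct)
    case (step zs zs')
    then have "(x # zs, x # zs') \<in> ?R" unfolding Cons_arc_cart_power_iff using V by blast
    with step(3) show ?case by (rule rtrancl_into_rtrancl)
  qed simp
  have "(x, y) \<in> (parcs G)\<^sup>*" using assms V by blast
  then have "(x # ys', y # ys') \<in> ?R\<^sup>*"
  proof (induction rule: rtrancl_induct)
    case (step z z')
    then have "(z # ys', z' # ys') \<in> ?R" unfolding Cons_arc_cart_power_iff using V by blast
    with step(3) show ?case by (rule rtrancl_into_rtrancl)
  qed simp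
  with 1 eq show ?case by (simp add: rtrancl_trans)
qed

lemma Cons_Cons_arc_iff:
  "(x # y # zs, x' # y' # zs') \<in> parcs (cart_power G (Suc (Suc k))) \<longleftrightarrow>
    (x, x') \<in> parcs G \<and> y = y' \<and> y \<in> pverts G \<and> zs = zs' \<and> zs \<in> pverts (cart_power G k) \<or>
    x = x' \<and> x \<in> pverts G \<and> (y, y') \<in> parcs G \<and> zs = zs' \<and> zs \<in> pverts (cart_power G k) \<or>
    x = x' \<and> x \<in> pverts G \<and> y = y' \<and> y \<in> pverts G \<and> (zs, zs') \<in> parcs (cart_power G k)"
proof -
  have "y # zs \<in> pverts (cart_power G (Suc k)) \<longleftrightarrow> y \<in> pverts G \<and> zs \<in> pverts (cart_power G k)"
    by (auto simp: pverts_cart_power simp del: cart_power.simps)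
  then show ?thesis
    unfolding Cons_arc_cart_power_iff by blast
qed

lemma cart_power_loopless:
  "(\<And>u. (u, u) \<notin> parcs G) \<Longrightarrow> (xs, xs) \<notin> parcs (cart_power G k)"
  by (induction k arbitrary: xs) (auto simp: relabel_def cart_prod_def)

text \<open>A single vertex \<open>(a, b)\<close> of the square suffices for passing between copies
  because every copy is strong: go to \<open>(a, b)\<close>, change the later coordinates there, and
  move on within the new copy.\<close>

lemma lift_strong:
  assumes G: "parcs G \<subseteq> pverts G \<times> pverts G"
    "\<And>u v. u \<in> pverts G \<Longrightarrow> v \<in> pverts G \<Longrightarrow> (u, v) \<in> (parcs G)\<^sup>*"
    and R: "\<And>x y x' y'. x \<in> pverts G \<Longrightarrow> y \<in> pverts G \<Longrightarrow> x' \<in> pverts G \<Longrightarrow> y' \<in> pverts G \<Longrightarrow>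
      ((x, y), (x', y')) \<in> R\<^sup>*"
    and fib: "\<And>x y x' y' zs. ((x, y), (x', y')) \<in> R \<Longrightarrow> zs \<in> pverts (cart_power G k) \<Longrightarrow>
      (x # y # zs, x' # y' # zs) \<in> B"
    and join: "\<And>zs zs'. (zs, zs') \<in> parcs (cart_power G k) \<Longrightarrow> (a # b # zs, a # b # zs') \<in> B"
    and ab: "a \<in> pverts G" "b \<in> pverts G"
    and xs: "xs \<in> pverts (cart_power G (Suc (Suc k)))" "ys \<in> pverts (cart_power G (Suc (Suc k)))"
  shows "(xs, ys) \<in> B\<^sup>*"
proof -
  obtain x y zs where x: "xs = x # y # zs" "x \<in> pverts G" "y \<in> pverts G" "zs \<in> pverts (cart_power G k)"
    using xs(1) unfolding pverts_cart_power by (auto simp: length_Suc_conv)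
  obtain x' y' zs' where y: "ys = x' # y' # zs'" "x' \<in> pverts G" "y' \<in> pverts G" "zs' \<in> pverts (cart_power G k)"
    using xs(2) unfolding pverts_cart_power by (auto simp: length_Suc_conv)
  have fibre: "(x # y # zs, x' # y' # zs) \<in> B\<^sup>*"
    if "x \<in> pverts G" "y \<in> pverts G" "x' \<in> pverts G" "y' \<in> pverts G" "zs \<in> pverts (cart_power G k)"
    for x y x' y' zs
  proof -
    have "((x, y), (x', y')) \<in> R\<^sup>*" using R that by blast
    then have "(fst (x, y) # snd (x, y) # zs, fst (x', y') # snd (x', y') # zs) \<in> B\<^sup>*"
    proof (induction rule: rtrancl_induct)
      case (step p q)
      have "(fst p # snd p # zs, fst q # snd q # zs) \<in> B"
        using fib[of "fst p" "snd p" "fst q" "snd q" zs] step(2) that by simp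
      with step(3) show ?case by (rule rtrancl_into_rtrancl)
    qed simp
    then show ?thesis by simp
  qed
  have "(zs, zs') \<in> (parcs (cart_power G k))\<^sup>*"
    using cart_power_strong G x y by blast
  then have "(a # b # zs, a # b # zs') \<in> B\<^sup>*"
    by (induction rule: rtrancl_induct) (auto intro: rtrancl_into_rtrancl join)
  then show ?thesis
    using rtrancl_trans3[OF fibre[of x y a b zs] _ fibre[of a b x' y' zs']] x y ab by simp
qed

text \<open>The order of \<open>G\<close> enters here: two distinct vertices provide a vertex off
  the diagonal, at which the second part can change the later coordinates.\<close>

lemma strong_arc_partition_first_part:
  assumes G: "parcs G \<subseteq> pverts G \<times> pverts G" "\<And>u. (u, u) \<notin> parcs G"
    "\<And>u v. u \<in> pverts G \<Longrightarrow> v \<in> pverts G \<Longrightarrow> (u, v) \<in> (parcs G)\<^sup>*"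
    and ab: "a \<in> pverts G" "b \<in> pverts G" "a \<noteq> b"
    and R: "\<And>x y x' y'. x \<in> pverts G \<Longrightarrow> y \<in> pverts G \<Longrightarrow> x' \<in> pverts G \<Longrightarrow> y' \<in> pverts G \<Longrightarrow>
      ((x, y), (x', y')) \<in> (square_red (pverts G) (parcs G) Q)\<^sup>*"
    and k: "k \<ge> 2"
  shows "strong_arc_partition (cart_power G k)
    {(xs, ys) \<in> parcs (cart_power G k). first_part Q xs ys}
    {(xs, ys) \<in> parcs (cart_power G k). \<not> first_part Q xs ys}"
proof -
  obtain l where l: "k = Suc (Suc l)" using k by (metis add_2_eq_Suc le_Suc_ex)
  let ?D = "cart_power G k"
  let ?A1 = "{(xs, ys) \<in> parcs ?D. first_part Q xs ys}"
  let ?A2 = "{(xs, ys) \<in> parcs ?D. \<not> first_part Q xs ys}"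
  have ll: "(zs, zs) \<notin> parcs (cart_power G i)" for zs i using cart_power_loopless G by blast
  have sub: "parcs ?D \<subseteq> pverts ?D \<times> pverts ?D" using parcs_cart_power G by blast
  have in1: "zs \<in> pverts (cart_power G l) \<and> zs' \<in> pverts (cart_power G l)"
    if "(zs, zs') \<in> parcs (cart_power G l)" for zs zs'
    using parcs_cart_power[OF G(1)] that by blast
  let ?R = "square_red (pverts G) (parcs G) Q"
  \<comment> \<open>Within a copy of the square the second part is the transpose of the first,
    whatever \<open>Q\<close> is.\<close>
  let ?B = "{((y, x), (y', x')) | x x' y y'. ((x, y), (x', y')) \<in> ?R}"
  have inV: "u \<in> pverts G \<and> v \<in> pverts G \<and> u \<noteq> v" if "(u, v) \<in> parcs G" for u v using G that by blast
  have "(xs, ys) \<in> ?A1\<^sup>*" if "xs \<in> pverts ?D" "ys \<in> pverts ?D" for xs ys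
  proof (rule lift_strong[where R = ?R and a = a and b = a and k = l])
    fix x y x' y' zs assume "((x, y), (x', y')) \<in> ?R" "zs \<in> pverts (cart_power G l)"
    then show "(x # y # zs, x' # y' # zs) \<in> ?A1"
      unfolding l by (auto simp: Cons_Cons_arc_iff square_red_def simp del: cart_power.simps dest: inV)
  next
    fix zs zs' assume "(zs, zs') \<in> parcs (cart_power G l)"
    then show "(a # a # zs, a # a # zs') \<in> ?A1"
      unfolding l using ll[of zs] ab by (auto simp: Cons_Cons_arc_iff simp del: cart_power.simps)
  qed (use G R ab that l in auto)
  moreover have "(xs, ys) \<in> ?A2\<^sup>*" if "xs \<in> pverts ?D" "ys \<in> pverts ?D" for xs ys
  proof (rule lift_strong[where R = ?B and a = a and b = b and k = l])
    fix x y x' y' assume "x \<in> pverts G" "y \<in> pverts G" "x' \<in> pverts G" "y' \<in> pverts G"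
    then have "((y, x), (y', x')) \<in> ?R\<^sup>*" using R by blast
    then have "(prod.swap (y, x), prod.swap (y', x')) \<in> ?B\<^sup>*"
    proof (induction rule: rtrancl_induct)
      case (step p q)
      have "(prod.swap p, prod.swap q) \<in> ?B" using step(2) by (cases p; cases q) auto
      with step(3) show ?case by (rule rtrancl_into_rtrancl)
    qed simp
    then show "((x, y), (x', y')) \<in> ?B\<^sup>*" by simp
  next
    fix x y x' y' zs assume "((x, y), (x', y')) \<in> ?B" "zs \<in> pverts (cart_power G l)"
    then show "(x # y # zs, x' # y' # zs) \<in> ?A2"
      unfolding l by (auto simp: Cons_Cons_arc_iff square_red_def simp del: cart_power.simps dest: inV)
  next
    fix zs zs' assume "(zs, zs') \<in> parcs (cart_power G l)"
    then show "(a # b # zs, a # b # zs') \<in> ?A2"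
      unfolding l using ll[of zs] ab by (auto simp: Cons_Cons_arc_iff simp del: cart_power.simps)
  qed (use G ab that l in auto)
  moreover have "replicate k a \<in> pverts ?D" using ab by (auto simp: pverts_cart_power)
  moreover have s1: "?A1 \<subseteq> pverts ?D \<times> pverts ?D" using sub by blast
  moreover have s2: "?A2 \<subseteq> pverts ?D \<times> pverts ?D" using sub by blast
  ultimately show ?thesis
    unfolding strong_arc_partition_def strongly_connected_iff[OF s1] strongly_connected_iff[OF s2]
    by blast
qed

section \<open>Cycle covers\<close>

lemma pcas_nth:
  "pcas u p v \<Longrightarrow> i < length p \<Longrightarrow>
    fst (p ! i) = (if i = 0 then u else snd (p ! (i - 1))) \<and> snd (last p) = v"
  by (induction u p v arbitrary: i rule: pcas.induct) (auto simp: nth_Cons split: nat.splits)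

lemma pawalk_verts_eq: "pcas u p v \<Longrightarrow> pawalk_verts u p = map fst p @ [v]"
  by (induction u p v rule: pcas.induct) auto

lemma cycles_of_cover:
  assumes G: "pair_digraph G" and C: "arc_disjoint_cycle_cover G C"
  defines "P \<equiv> \<lambda>p t. fst (p ! nat (t mod int (length p)))"
  shows "cycles (parcs G) C length P" and "pverts G = (\<Union>p\<in>C. range (P p))"
proof -
  interpret pair_digraph G by fact
  have cyc: "\<exists>u. set p \<subseteq> parcs G \<and> pcas u p u \<and> distinct (tl (map fst p @ [u])) \<and> p \<noteq> []"
    if "p \<in> C" for p
    using that C unfolding arc_disjoint_cycle_cover_def cycle_def awalk_def
    by (metis pawalk_verts_eq)
  have len: "length p > 0" if "p \<in> C" for p using cyc[OF that] by auto
  \<comment> \<open>The library asks for distinctness of the vertex list without its first entry; as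
    the walk is closed, that entry equals the last one.\<close>
  have dist: "distinct (map fst p)" if "p \<in> C" for p
  proof -
    obtain u where u: "pcas u p u" "distinct (tl (map fst p @ [u]))" "p \<noteq> []" using cyc[OF \<open>p \<in> C\<close>] by blast
    then show ?thesis using pcas_nth[of u p u 0] by (cases p) auto
  qed
  have arc: "(P p t, P p (t + 1)) = p ! nat (t mod int (length p))" if "p \<in> C" for p t
  proof -
    obtain u where u: "pcas u p u" "p \<noteq> []" using cyc[OF \<open>p \<in> C\<close>] by blast
    define i where "i = nat (t mod int (length p))"
    have i: "i < length p" "int i = t mod int (length p)" using len[OF that] by (auto simp: i_def nat_less_iff)
    have "(t + 1) mod int (length p) = (int i + 1) mod int (length p)"
      unfolding i by (simp add: mod_simps)
    also have "\<dots> = int (if Suc i < length p then Suc i else 0)"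
    proof (cases "Suc i < length p")
      case False
      then have "int i + 1 = int (length p)" using i by simp
      then show ?thesis using False by simp
    qed simp
    finally have "nat ((t + 1) mod int (length p)) = (if Suc i < length p then Suc i else 0)"
      by (simp only: nat_int)
    then have "P p (t + 1) = snd (p ! i)"
    proof (cases "Suc i < length p")
      case False
      then have "i = length p - 1" using i by simp
      then have "p ! i = last p" using u by (simp add: last_conv_nth)
      then show ?thesis using pcas_nth[OF u(1), of 0] False \<open>nat ((t + 1) mod _) = _\<close> len[OF that]
        by (simp add: P_def)
    qed (use pcas_nth[OF u(1), of "Suc i"] in \<open>simp add: P_def\<close>)
    then show ?thesis by (simp add: P_def i_def[symmetric])
  qed
  have in_set: "(P p t, P p (t + 1)) \<in> set p" if "p \<in> C" for p t
    unfolding arc[OF that] using len[OF that] by (intro nth_mem) (simp add: nat_less_iff)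
  show "cycles (parcs G) C length P"
  proof
    fix p t r assume p: "p \<in> C"
    show "length p > 0" using len p .
    let ?i = "nat (t mod int (length p))" and ?j = "nat (r mod int (length p))"
    have "?i < length p" "?j < length p" using len[OF p] by (auto simp: nat_less_iff)
    then have "P p t = P p r \<longleftrightarrow> ?i = ?j"
      using nth_eq_iff_index_eq[OF dist[OF p], of ?i ?j] by (simp add: P_def)
    also have "\<dots> \<longleftrightarrow> t mod int (length p) = r mod int (length p)"
      using len[OF p] by (simp add: nat_eq_iff)
    finally show "P p t = P p r \<longleftrightarrow> t mod int (length p) = r mod int (length p)" .
    show "(P p t, P p (t + 1)) \<in> parcs G" using in_set[OF p] cyc[OF p] by blast
  next
    fix p q t r assume "p \<in> C" "q \<in> C" "P p t = P q r" "P p (t + 1) = P q (r + 1)"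
    then show "p = q"
      using C in_set[of p t] in_set[of q r] unfolding arc_disjoint_cycle_cover_def by auto
  qed
  have "range (P p) = fst ` set p" if "p \<in> C" for p
  proof
    show "range (P p) \<subseteq> fst ` set p" using in_set[OF that] by force
    show "fst ` set p \<subseteq> range (P p)"
    proof
      fix v assume "v \<in> fst ` set p"
      then obtain i where "i < length p" "v = fst (p ! i)" by (auto simp: in_set_conv_nth)
      then have "v = P p (int i)" by (simp add: P_def)
      then show "v \<in> range (P p)" by blast
    qed
  qed
  then show "pverts G = (\<Union>p\<in>C. range (P p))"
    using C unfolding arc_disjoint_cycle_cover_def by auto
qed

section \<open>From a cycle cover to a perfect matching\<close>

context cycles
begin

definition next_arc :: "'a \<times> 'a \<Rightarrow> 'a \<times> 'a" where
  "next_arc e = (SOME f. \<exists>j\<in>J. \<exists>t. e = (P j t, P j (t + 1)) \<and> f = (P j (t + 1), P j (t + 2)))"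

lemma P_succ: "j \<in> J \<Longrightarrow> P j t = P j r \<Longrightarrow> P j (t + k) = P j (r + k)"
  using P_eq_iff by (metis mod_add_cong)

text \<open>An arc determines its cycle by \<open>P_disjoint\<close> and its position up to the
  period by \<open>P_eq_iff\<close>, so the choice in \<open>next_arc\<close> is unique.\<close>

lemma next_arc_eq:
  assumes j: "j \<in> J"
  shows "next_arc (P j t, P j (t + 1)) = (P j (t + 1), P j (t + 2))"
  unfolding next_arc_def
proof (rule some_equality)
  fix f assume "\<exists>i\<in>J. \<exists>r. (P j t, P j (t + 1)) = (P i r, P i (r + 1)) \<and> f = (P i (r + 1), P i (r + 2))"
  then obtain i r where i: "i \<in> J" "P j t = P i r" "P j (t + 1) = P i (r + 1)" "f = (P i (r + 1), P i (r + 2))"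
    by auto
  then have "i = j" using P_disjoint j by metis
  then show "f = (P j (t + 1), P j (t + 2))" using i P_succ[OF j, of t r 2] by simp
qed (use j in blast)

lemma next_arc:
  assumes "e \<in> cyc_arcs"
  shows "next_arc e \<in> cyc_arcs" "fst (next_arc e) = snd e"
proof -
  obtain j t where e: "j \<in> J" "e = (P j t, P j (t + 1))" using assms by (auto simp: cyc_arcs_def)
  have "(P j (t + 1), P j (t + 1 + 1)) \<in> cyc_arcs" using e(1) unfolding cyc_arcs_def by blast
  then show "next_arc e \<in> cyc_arcs" "fst (next_arc e) = snd e"
    using e next_arc_eq[OF e(1), of t] by (simp_all add: add.assoc)
qed

lemma inj_next_arc: "inj_on next_arc cyc_arcs"
proof (rule inj_onI)
  fix e f assume "e \<in> cyc_arcs" "f \<in> cyc_arcs" and eq: "next_arc e = next_arc f"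
  then obtain j t i r where e: "j \<in> J" "e = (P j t, P j (t + 1))" "i \<in> J" "f = (P i r, P i (r + 1))"
    by (auto simp: cyc_arcs_def)
  then have eq': "P j (t + 1) = P i (r + 1)" "P j (t + 1 + 1) = P i (r + 1 + 1)"
    using eq next_arc_eq by (simp_all add: add.assoc)
  then have "j = i" using P_disjoint e by metis
  then show "e = f" using eq'(1) P_succ[of j "t + 1" "r + 1" "-1"] e by simp
qed

end

text \<open>The bipartite graph whose perfect matchings encode the covers by arc-disjoint closed trails:
  \<open>(v, v)\<close> stands for the vertex \<open>v\<close>, an arc that is matched to itself is unused, and every
  other element is matched to one that continues it. An element \<open>(v, v)\<close> cannot be matched to itself.\<close>

definition continues :: "'a rel \<Rightarrow> 'a \<times> 'a \<Rightarrow> 'a \<times> 'a \<Rightarrow> bool" where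
  "continues A e f \<longleftrightarrow> e = f \<and> fst e \<noteq> snd e \<or>
     snd e = fst f \<and> (fst e = snd e \<or> e \<in> A) \<and> (fst f = snd f \<or> f \<in> A) \<and> \<not> (fst e = snd e \<and> e = f)"

text \<open>Every cycle of the cover permutes its arcs cyclically. For each vertex \<open>v\<close>
  one cycle arc \<open>h v\<close> that enters \<open>v\<close> is picked, and \<open>(v, v)\<close>
  is spliced in between \<open>h v\<close> and its continuation. Pairs that are neither diagonal nor
  cycle arcs are fixed.\<close>

lemma (in cycles) ex_matching:
  assumes loopless: "\<And>u. (u, u) \<notin> A" and cover: "V = (\<Union>j\<in>J. range (P j))" and A: "A \<subseteq> V \<times> V"
  shows "\<exists>\<pi>. inj_on \<pi> (V \<times> V) \<and> (\<forall>e \<in> V \<times> V. \<pi> e \<in> V \<times> V \<and> continues A e (\<pi> e))"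
proof -
  have "\<forall>v\<in>V. \<exists>e. e \<in> cyc_arcs \<and> snd e = v"
  proof
    fix v assume "v \<in> V"
    then obtain j t where "j \<in> J" "v = P j t" using cover by auto
    then have "(P j (t - 1), P j (t - 1 + 1)) \<in> cyc_arcs" "v = P j (t - 1 + 1)"
      unfolding cyc_arcs_def by (blast, simp)
    then show "\<exists>e. e \<in> cyc_arcs \<and> snd e = v" by auto
  qed
  then obtain h where h: "\<And>v. v \<in> V \<Longrightarrow> h v \<in> cyc_arcs \<and> snd (h v) = v" by metis
  have cA: "cyc_arcs \<subseteq> A" using P_arc by (auto simp: cyc_arcs_def)
  have nl: "(u, u) \<notin> cyc_arcs" for u using cA loopless by blast
  define \<pi> where "\<pi> e = (if fst e = snd e then next_arc (h (fst e))
     else if e \<in> cyc_arcs then (if e = h (snd e) then (snd e, snd e) else next_arc e) else e)" for e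
  have "inj_on \<pi> (V \<times> V)"
  proof (rule inj_onI, clarify)
    fix a b c d assume V: "a \<in> V" "b \<in> V" "c \<in> V" "d \<in> V" and eq: "\<pi> (a, b) = \<pi> (c, d)"
    have nd: "next_arc e \<noteq> (u, u)" if "e \<in> cyc_arcs" for e u using next_arc(1)[OF that] nl by metis
    have inj: "e = f" if "next_arc e = next_arc f" "e \<in> cyc_arcs" "f \<in> cyc_arcs" for e f
      using inj_onD[OF inj_next_arc] that by blast
    have nh: "next_arc (h u) \<noteq> e" if "u \<in> V" "e \<notin> cyc_arcs" for u e
      using next_arc(1) h that by metis
    have nn: "next_arc f \<noteq> e" if "f \<in> cyc_arcs" "e \<notin> cyc_arcs" for f e
      using next_arc(1) that by metis
    have hh: "snd (h u) = u" "h u \<in> cyc_arcs" if "u \<in> V" for u using h that by auto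
    \<comment> \<open>Images are diagonal pairs, cycle arcs or other pairs, and these kinds are
      disjoint. A cycle arc has just one preimage: if the arc before it is some \<open>h v\<close>,
      then \<open>(v, v)\<close> takes over its continuation, otherwise that arc keeps it.\<close>
    show "a = c \<and> b = d"
    proof (cases "a = b"; cases "c = d")
      assume "a = b" "c = d"
      then have "h a = h c" using eq V hh inj[of "h a" "h c"] by (simp add: \<pi>_def)
      then have "a = c" using hh V by metis
      then show ?thesis using \<open>a = b\<close> \<open>c = d\<close> by simp
    next
      assume ab: "a = b" "c \<noteq> d"
      then show ?thesis
        using eq V hh[of a] hh[of d] nd[of "h a" d] inj[of "h a" "(c, d)"] nh[of a "(c, d)"]
        by (auto simp: \<pi>_def split: if_splits)
    next
      assume ab: "a \<noteq> b" "c = d"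
      have "b = c" if "(a, b) = h c" using hh(1)[OF V(3)] unfolding that[symmetric] by simp
      then show ?thesis
        using ab eq V hh[of c] hh[of b] nd[of "h c" b] inj[of "(a, b)" "h c"] nh[of c "(a, b)"]
        by (auto simp: \<pi>_def split: if_splits)
    next
      assume ab: "a \<noteq> b" "c \<noteq> d"
      have p: "\<pi> (x, y) = (y, y) \<and> (x, y) = h y \<or> \<pi> (x, y) = next_arc (x, y) \<and> (x, y) \<in> cyc_arcs \<or>
          \<pi> (x, y) = (x, y) \<and> (x, y) \<notin> cyc_arcs" if "x \<noteq> y" for x y
        using that by (simp only: \<pi>_def fst_conv snd_conv if_False split: if_split) blast
      have nd': "next_arc (a, b) \<noteq> (d, d)" if "(a, b) \<in> cyc_arcs" using nd that by blast
      have nd'': "next_arc (c, d) \<noteq> (b, b)" if "(c, d) \<in> cyc_arcs" using nd that by blast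
      from p[OF ab(1)] show ?thesis
      proof (elim disjE conjE)
        assume 1: "\<pi> (a, b) = (b, b)" "(a, b) = h b"
        from p[OF ab(2)] show ?thesis
        proof (elim disjE conjE)
          assume "\<pi> (c, d) = (d, d)" "(c, d) = h d"
          then show ?thesis using 1 eq by (metis prod.inject)
        next
          assume "\<pi> (c, d) = next_arc (c, d)" "(c, d) \<in> cyc_arcs"
          then show ?thesis using 1(1) eq nd'' by metis
        next
          assume "\<pi> (c, d) = (c, d)"
          then show ?thesis using 1(1) eq ab(2) by (metis prod.inject)
        qed
      next
        assume 1: "\<pi> (a, b) = next_arc (a, b)" "(a, b) \<in> cyc_arcs"
        from p[OF ab(2)] show ?thesis
        proof (elim disjE conjE)
          assume "\<pi> (c, d) = (d, d)"
          then show ?thesis using 1(1) nd'[OF 1(2)] eq by metis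
        next
          assume "\<pi> (c, d) = next_arc (c, d)" "(c, d) \<in> cyc_arcs"
          then have "(a, b) = (c, d)" using inj[OF _ 1(2)] 1(1) eq by metis
          then show ?thesis by simp
        next
          assume "\<pi> (c, d) = (c, d)" "(c, d) \<notin> cyc_arcs"
          then show ?thesis using 1 eq nn[of "(a, b)" "(c, d)"] by metis
        qed
      next
        assume 1: "\<pi> (a, b) = (a, b)" "(a, b) \<notin> cyc_arcs"
        from p[OF ab(2)] show ?thesis
        proof (elim disjE conjE)
          assume "\<pi> (c, d) = (d, d)"
          then show ?thesis using 1(1) eq ab(1) by (metis prod.inject)
        next
          assume "\<pi> (c, d) = next_arc (c, d)" "(c, d) \<in> cyc_arcs"
          then show ?thesis using 1 eq nn[of "(c, d)" "(a, b)"] by metis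
        next
          assume "\<pi> (c, d) = (c, d)"
          then show ?thesis using 1(1) eq by (metis prod.inject)
        qed
      qed
    qed
  qed
  moreover have "\<pi> e \<in> V \<times> V \<and> continues A e (\<pi> e)" if "e \<in> V \<times> V" for e
  proof (cases "fst e = snd e")
    case True
    then have "h (fst e) \<in> cyc_arcs" "snd (h (fst e)) = fst e" "\<pi> e = next_arc (h (fst e))"
      using h that by (auto simp: \<pi>_def)
    then have "\<pi> e \<in> cyc_arcs" "fst (\<pi> e) = snd e" using next_arc[of "h (fst e)"] True by auto
    then show ?thesis using True cA A nl by (cases e; cases "\<pi> e") (auto simp: continues_def)
  next
    case ne: False
    show ?thesis
    proof (cases "e \<in> cyc_arcs \<and> e \<noteq> h (snd e)")
      case True
      then have "\<pi> e = next_arc e" using ne by (simp add: \<pi>_def)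
      then have "\<pi> e \<in> cyc_arcs" "fst (\<pi> e) = snd e" using next_arc[of e] True by auto
      then show ?thesis using True ne cA A by (auto simp: continues_def)
    next
      case False
      have "e \<in> A" if "e \<in> cyc_arcs" using cA that by blast
      moreover have "snd e \<in> V" using \<open>e \<in> V \<times> V\<close> by auto
      ultimately show ?thesis
        using ne \<open>e \<in> V \<times> V\<close> False by (simp add: \<pi>_def continues_def)
    qed
  qed
  ultimately show ?thesis by blast
qed

text \<open>The moved pairs are the arcs of \<open>F\<close> and all diagonal pairs.
  \<open>\<tau>\<close> maps the moved pairs with head \<open>a\<close> onto those with tail
  \<open>a\<close>; the pair \<open>(a, a)\<close> counts once on either side and cancels. Its own
  image is an arc of \<open>F\<close> that leaves \<open>a\<close>.\<close>

lemma balanced_of_matching: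
  assumes bij: "bij_betw \<tau> (V \<times> V) (V \<times> V)" and cont: "\<And>e. e \<in> V \<times> V \<Longrightarrow> continues A e (\<tau> e)"
    and loopless: "\<And>u. (u, u) \<notin> A" and A: "A \<subseteq> V \<times> V" and fin: "finite V"
  defines "F \<equiv> {e \<in> A. \<tau> e \<noteq> e}"
  shows "card {b. (a, b) \<in> F} = card {b. (b, a) \<in> F}" and "a \<in> V \<Longrightarrow> \<exists>b. (a, b) \<in> F"
proof -
  define M where "M = {e \<in> V \<times> V. \<tau> e \<noteq> e}"
  have \<tau>: "\<tau> e \<in> V \<times> V" if "e \<in> V \<times> V" for e using bij that by (auto simp: bij_betw_def)
  have inj: "inj_on \<tau> (V \<times> V)" using bij by (simp add: bij_betw_def)
  have M_iff: "e \<in> M \<longleftrightarrow> e \<in> F \<or> e \<in> V \<times> V \<and> fst e = snd e" for e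
  proof
    assume "e \<in> M"
    then show "e \<in> F \<or> e \<in> V \<times> V \<and> fst e = snd e"
      using cont[of e] by (auto simp: M_def F_def continues_def)
  next
    assume "e \<in> F \<or> e \<in> V \<times> V \<and> fst e = snd e"
    then show "e \<in> M" using cont[of e] A by (auto simp: M_def F_def continues_def)
  qed
  have step: "\<tau> e \<in> M \<and> fst (\<tau> e) = snd e" if "e \<in> M" for e
  proof -
    have e: "e \<in> V \<times> V" "\<tau> e \<noteq> e" using that by (auto simp: M_def)
    then have "\<tau> (\<tau> e) \<noteq> \<tau> e" using inj_onD[OF inj] \<tau> by blast
    then show ?thesis using cont[of e] e \<tau>[of e] by (auto simp: M_def continues_def)
  qed
  have eq: "card {e \<in> M. snd e = a} = card {e \<in> M. fst e = a}" for a
  proof -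
    have "\<tau> ` {e \<in> M. snd e = a} = {e \<in> M. fst e = a}"
    proof (intro set_eqI iffI)
      fix f assume f: "f \<in> {e \<in> M. fst e = a}"
      then have "f \<in> \<tau> ` (V \<times> V)" using bij by (simp add: M_def bij_betw_def)
      then obtain e where e: "e \<in> V \<times> V" "f = \<tau> e" by blast
      then have "e \<in> M" using f by (auto simp: M_def)
      then show "f \<in> \<tau> ` {e \<in> M. snd e = a}" using step[of e] f e by auto
    next
      fix f assume "f \<in> \<tau> ` {e \<in> M. snd e = a}"
      then obtain e where "e \<in> M" "snd e = a" "f = \<tau> e" by blast
      then show "f \<in> {e \<in> M. fst e = a}" using step[of e] by simp
    qed
    moreover have "inj_on \<tau> {e \<in> M. snd e = a}" using inj by (rule inj_on_subset) (auto simp: M_def)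
    ultimately show ?thesis using card_image[of \<tau> "{e \<in> M. snd e = a}"] by simp
  qed
  have FV: "F \<subseteq> V \<times> V" using A by (auto simp: F_def)
  have fF: "finite {b. (a, b) \<in> F}" "finite {b. (b, a) \<in> F}"
    using finite_subset[OF _ fin, of "{b. (a, b) \<in> F}"] finite_subset[OF _ fin, of "{b. (b, a) \<in> F}"] FV
    by blast+
  have nl: "(a, a) \<notin> F" using loopless by (auto simp: F_def)
  have split: "card {b. (a, b) \<in> F} = card {b. (b, a) \<in> F}" if "a \<in> V"
  proof -
    have "{e \<in> M. snd e = a} = insert (a, a) ((\<lambda>b. (b, a)) ` {b. (b, a) \<in> F})"
      "{e \<in> M. fst e = a} = insert (a, a) (Pair a ` {b. (a, b) \<in> F})"
      using that by (auto simp: M_iff)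
    moreover have "card ((\<lambda>b. (b, a)) ` {b. (b, a) \<in> F}) = card {b. (b, a) \<in> F}"
      "card (Pair a ` {b. (a, b) \<in> F}) = card {b. (a, b) \<in> F}"
      by (rule card_image, simp add: inj_on_def)+
    moreover have "(a, a) \<notin> (\<lambda>b. (b, a)) ` {b. (b, a) \<in> F}" "(a, a) \<notin> Pair a ` {b. (a, b) \<in> F}"
      using nl by auto
    ultimately show ?thesis using eq[of a] fF by simp
  qed
  show "card {b. (a, b) \<in> F} = card {b. (b, a) \<in> F}"
  proof (cases "a \<in> V")
    case False
    then have "{b. (a, b) \<in> F} = {}" "{b. (b, a) \<in> F} = {}" using FV by auto
    then show ?thesis by simp
  qed (rule split)
  show "\<exists>b. (a, b) \<in> F" if "a \<in> V"
  proof -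
    have "(a, a) \<in> M" using that by (simp add: M_iff)
    then have "\<tau> (a, a) \<in> M" "fst (\<tau> (a, a)) = a" "\<tau> (a, a) \<noteq> (a, a)"
      using step by (auto simp: M_def)
    then show ?thesis unfolding M_iff by (cases "\<tau> (a, a)") auto
  qed
qed

section \<open>Loop programs\<close>

datatype loop =
    LSkip
  | LSet nat "expr list" expr
  | LSeq loop loop (infixr ";;" 60)
  | LIf expr loop loop
  | LFor nat nat loop

text \<open>\<open>LFor v b c\<close> runs \<open>c\<close> with the scalar \<open>v\<close> counting from \<open>0\<close> up to the value of the scalar
  \<open>b\<close>; neither is written by \<open>c\<close>, so these programs always halt.\<close>

primrec compile :: "loop \<Rightarrow> prog" where
  "compile LSkip = Skip"
| "compile (LSet a es e) = Assign a es e"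
| "compile (c ;; d) = Seq (compile c) (compile d)"
| "compile (LIf e c d) = IfElse e (compile c) (compile d)"
| "compile (LFor v b c) = Seq (Assign v [] (Const 0))
     (While (Minus (Cell b []) (Cell v []))
       (Seq (compile c) (Assign v [] (Plus (Cell v []) (Const 1)))))"

primrec sem :: "loop \<Rightarrow> store \<Rightarrow> store" where
  "sem LSkip s = s"
| "sem (LSet a es e) s = update s a (map (\<lambda>e. eval_expr e s) es) (eval_expr e s)"
| "sem (c ;; d) s = sem d (sem c s)"
| "sem (LIf e c d) s = (if eval_expr e s \<noteq> 0 then sem c s else sem d s)"
| "sem (LFor v b c) s =
     update (fold (\<lambda>i t. sem c (update t v [] i)) [0..<s b []] s) v [] (s b [])"

primrec writes :: "loop \<Rightarrow> nat set" where
  "writes LSkip = {}"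
| "writes (LSet a es e) = {a}"
| "writes (c ;; d) = writes c \<union> writes d"
| "writes (LIf e c d) = writes c \<union> writes d"
| "writes (LFor v b c) = insert v (writes c)"

primrec bounds :: "loop \<Rightarrow> nat set" where
  "bounds LSkip = {}"
| "bounds (LSet a es e) = {}"
| "bounds (c ;; d) = bounds c \<union> bounds d"
| "bounds (LIf e c d) = bounds c \<union> bounds d"
| "bounds (LFor v b c) = insert b (bounds c)"

primrec counters_ok :: "loop \<Rightarrow> bool" where
  "counters_ok LSkip \<longleftrightarrow> True"
| "counters_ok (LSet a es e) \<longleftrightarrow> True"
| "counters_ok (c ;; d) \<longleftrightarrow> counters_ok c \<and> counters_ok d"
| "counters_ok (LIf e c d) \<longleftrightarrow> counters_ok c \<and> counters_ok d"
| "counters_ok (LFor v b c) \<longleftrightarrow> counters_ok c \<and> v \<notin> writes c"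

text \<open>The variable of the polynomial is a common bound on all loop limits. In the last
  equation, 6 is 2 for the initial assignment plus 4 for the final failing guard, and 8 is 4 for a
  successful guard plus 4 for the increment.\<close>

primrec cost :: "loop \<Rightarrow> nat poly" where
  "cost LSkip = 1"
| "cost (LSet a es e) = [:1 + sum_list (map expr_cost es) + expr_cost e:]"
| "cost (c ;; d) = cost c + cost d"
| "cost (LIf e c d) = [:1 + expr_cost e:] + cost c + cost d"
| "cost (LFor v b c) = [:6:] + [:0, 1:] * (cost c + [:8:])"

section \<open>Halting and running time of loop programs\<close>

lemma update_same [simp]: "update s a is v a = (s a)(is := v)"
  and update_other [simp]: "b \<noteq> a \<Longrightarrow> update s a is v b = s b"
  and update_update [simp]: "update (update s a is v) a is w = update s a is w"
  by (auto simp: update_def)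

lemma update_triv [simp]: "s a is = v \<Longrightarrow> update s a is v = s"
  by (auto simp: update_def)

lemma fold_sem_frame:
  assumes "\<And>t. sem c t a = t a" "a \<noteq> v"
  shows "fold (\<lambda>i t. sem c (update t v [] i)) is s a = s a"
  using assms by (induction "is" arbitrary: s) auto

lemma sem_frame: "a \<notin> writes c \<Longrightarrow> sem c s a = s a"
  by (induction c arbitrary: s) (auto simp: fold_sem_frame)

text \<open>As the program writes none of its loop limits, their bound \<open>M\<close> in the
  initial store persists throughout the run, and a structural induction goes through.\<close>

lemma exec_compile:
  assumes "counters_ok c" "bounds c \<inter> writes c = {}" "\<And>b. b \<in> bounds c \<Longrightarrow> s b [] \<le> M"
  shows "\<exists>t \<le> poly (cost c) M. exec (compile c) s t (sem c s)"
  using assms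
proof (induction c arbitrary: s)
  case LSkip
  show ?case using exec.Skip[of s] by (intro exI[of _ 1]) simp
next
  case (LSet a es e)
  then show ?case using exec.Assign[of a es e s] by auto
next
  case (LSeq c d)
  obtain t where t: "t \<le> poly (cost c) M" "exec (compile c) s t (sem c s)"
    using LSeq.IH(1)[of s] LSeq.prems by (auto simp: Int_Un_distrib Int_Un_distrib2)
  have "sem c s b [] \<le> M" if "b \<in> bounds d" for b
  proof -
    have "b \<notin> writes c" using that LSeq.prems(2) by auto
    then show ?thesis using that LSeq.prems(3) by (simp add: sem_frame)
  qed
  then obtain u where u: "u \<le> poly (cost d) M" "exec (compile d) (sem c s) u (sem d (sem c s))"
    using LSeq.IH(2)[of "sem c s"] LSeq.prems by (auto simp: Int_Un_distrib Int_Un_distrib2)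
  show ?case
    using exec.Seq[OF t(2) u(2)] t(1) u(1) by (auto intro!: exI[of _ "t + u"])
next
  case (LIf e c d)
  show ?case
  proof (cases "eval_expr e s = 0")
    case True
    obtain t where t: "t \<le> poly (cost d) M" "exec (compile d) s t (sem d s)"
      using LIf.IH(2)[of s] LIf.prems by (auto simp: Int_Un_distrib Int_Un_distrib2)
    show ?thesis
      using exec.IfFalse[OF True t(2)] t(1) True by (auto intro!: exI[of _ "1 + expr_cost e + t"])
  next
    case False
    obtain t where t: "t \<le> poly (cost c) M" "exec (compile c) s t (sem c s)"
      using LIf.IH(1)[of s] LIf.prems by (auto simp: Int_Un_distrib Int_Un_distrib2)
    show ?thesis
      using exec.IfTrue[OF False t(2)] t(1) False by (auto intro!: exI[of _ "1 + expr_cost e + t"])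
  qed
next
  case (LFor v b c)
  define n where "n = s b []"
  let ?g = "Minus (Cell b []) (Cell v [])"
  let ?body = "Seq (compile c) (Assign v [] (Plus (Cell v []) (Const 1)))"
  let ?T = "poly (cost c) M"
  let ?f = "\<lambda>i t. sem c (update t v [] i)"
  have v: "v \<notin> writes c" "b \<noteq> v" "b \<notin> writes c" "bounds c \<inter> writes c = {}" "v \<notin> bounds c"
    using LFor.prems by auto
  \<comment> \<open>Here \<open>k\<close> counts the iterations still to come, so the counter stands
    at \<open>n - k\<close>.\<close>
  have loop: "\<exists>T \<le> k * (?T + 8) + 4. exec (While ?g ?body) (update t v [] (n - k)) T
      (update (fold ?f [n - k..<n] t) v [] n)"
    if "k \<le> n" "t b [] = n" "\<And>b'. b' \<in> bounds c \<Longrightarrow> t b' [] \<le> M" for k t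
    using that
  proof (induction k arbitrary: t)
    case 0
    have "eval_expr ?g (update t v [] n) = 0" using 0 v by simp
    from exec.WhileFalse[OF this, of ?body] show ?case
      by (intro exI[of _ 4]) (simp add: eval_nat_numeral)
  next
    case (Suc k)
    let ?i = "n - Suc k"
    let ?t = "update t v [] ?i"
    have b: "?t b' [] \<le> M" if "b' \<in> bounds c" for b'
      using Suc.prems(3) v that by (cases "b' = v") auto
    obtain T where T: "T \<le> ?T" "exec (compile c) ?t T (sem c ?t)"
      using LFor.IH[of ?t] LFor.prems(1) v b by auto
    let ?t' = "sem c ?t"
    have t': "?t' v [] = ?i" "?t' b [] = n" "\<And>b'. b' \<in> bounds c \<Longrightarrow> ?t' b' [] \<le> M"
    proof -
      show "?t' v [] = ?i" "?t' b [] = n"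
        using v Suc.prems by (simp_all add: sem_frame)
      fix b' assume "b' \<in> bounds c"
      then show "?t' b' [] \<le> M" using v(4) b by (simp add: sem_frame disjoint_iff)
    qed
    have "exec (Assign v [] (Plus (Cell v []) (Const 1))) ?t' 4 (update ?t' v [] (n - k))"
      using exec.Assign[of v "[]" "Plus (Cell v []) (Const 1)" ?t'] t'(1) Suc.prems(1)
      by (simp add: eval_nat_numeral Suc_diff_Suc)
    then have body: "exec ?body ?t (T + 4) (update ?t' v [] (n - k))"
      using exec.Seq T(2) by blast
    obtain T' where T': "T' \<le> k * (?T + 8) + 4"
      "exec (While ?g ?body) (update ?t' v [] (n - k)) T' (update (fold ?f [n - k..<n] ?t') v [] n)"
      using Suc.IH[of ?t'] Suc.prems t' by auto
    have g: "eval_expr ?g ?t \<noteq> 0" using Suc.prems v by simp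
    have "[?i..<n] = ?i # [n - k..<n]"
      using Suc.prems(1) by (simp add: upt_conv_Cons Suc_diff_Suc)
    then have e: "fold ?f [?i..<n] t = fold ?f [n - k..<n] ?t'" by simp
    show ?case
      using exec.WhileTrue[OF g body T'(2)] T(1) T'(1) unfolding e
      by (intro exI[of _ "1 + expr_cost ?g + (T + 4) + T'"]) simp
  qed
  have init: "exec (Assign v [] (Const 0)) s 2 (update s v [] 0)"
    using exec.Assign[of v "[]" "Const 0" s] by (simp add: numeral_2_eq_2)
  have "\<exists>T \<le> n * (?T + 8) + 4. exec (While ?g ?body) (update s v [] (n - n)) T
      (update (fold ?f [n - n..<n] s) v [] n)"
    using LFor.prems(3) by (intro loop) (simp_all add: n_def)
  then obtain T where T: "T \<le> n * (?T + 8) + 4" "exec (While ?g ?body) (update s v [] 0) T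
      (update (fold ?f [0..<n] s) v [] n)"
    by auto
  have "exec (compile (LFor v b c)) s (2 + T) (sem (LFor v b c) s)"
    using exec.Seq[OF init T(2)] by (simp only: compile.simps sem.simps n_def)
  moreover have "n * (?T + 8) \<le> M * (?T + 8)"
    using LFor.prems(3)[of b] n_def by (intro mult_le_mono1) simp
  ultimately show ?case
    using T(1) by (intro exI[of _ "2 + T"]) (auto simp: algebra_simps)
qed

declare sem.simps(5) [simp del]

text \<open>The step receives the frame facts for free, so that invariants need only mention what
  the body changes. Insensitivity to the counter is required because it is set before every pass and
  once more on exit.\<close>

lemma sem_LFor:
  assumes "v \<notin> writes c" "s b [] = n" "I 0 s"
    and step: "\<And>i t. i < n \<Longrightarrow> I i t \<Longrightarrow> (\<And>a. a \<noteq> v \<Longrightarrow> a \<notin> writes c \<Longrightarrow> t a = s a) \<Longrightarrow> t v [] = i \<Longrightarrow>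
      I (Suc i) (sem c t)"
    and inv: "\<And>i x t. I i t \<Longrightarrow> I i (update t v [] x)"
  shows "I n (sem (LFor v b c) s)"
proof -
  let ?f = "\<lambda>i t. sem c (update t v [] i)"
  have "I k (fold ?f [0..<k] s)" if "k \<le> n" for k
    using that
  proof (induction k)
    case (Suc k)
    let ?t = "update (fold ?f [0..<k] s) v [] k"
    have "I k ?t" using Suc inv by simp
    moreover have "?t a = s a" if "a \<noteq> v" "a \<notin> writes c" for a
      using that by (simp add: fold_sem_frame sem_frame)
    ultimately have "I (Suc k) (sem c ?t)" using step[of k ?t] Suc.prems by simp
    then show ?case by simp
  qed (use assms in simp)
  then show ?thesis using inv assms(2) by (simp add: sem.simps(5))
qed

definition EOr :: "expr \<Rightarrow> expr \<Rightarrow> expr" where "EOr e f = Plus e f"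
definition ENot :: "expr \<Rightarrow> expr" where "ENot e = Minus (Const 1) e"
definition EAnd :: "expr \<Rightarrow> expr \<Rightarrow> expr" where "EAnd e f = ENot (EOr (ENot e) (ENot f))"
definition ELess :: "expr \<Rightarrow> expr \<Rightarrow> expr" where "ELess e f = Minus f e"
definition EEq :: "expr \<Rightarrow> expr \<Rightarrow> expr" where "EEq e f = ENot (EOr (ELess e f) (ELess f e))"

lemma eval_connectives [simp]:
  "eval_expr (EOr e f) s = 0 \<longleftrightarrow> eval_expr e s = 0 \<and> eval_expr f s = 0"
  "eval_expr (ENot e) s = 0 \<longleftrightarrow> eval_expr e s \<noteq> 0"
  "eval_expr (EAnd e f) s = 0 \<longleftrightarrow> eval_expr e s = 0 \<or> eval_expr f s = 0"
  "eval_expr (ELess e f) s = 0 \<longleftrightarrow> \<not> eval_expr e s < eval_expr f s"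
  "eval_expr (EEq e f) s = 0 \<longleftrightarrow> eval_expr e s \<noteq> eval_expr f s"
  by (auto simp: EOr_def ENot_def EAnd_def ELess_def EEq_def)

abbreviation Var :: "nat \<Rightarrow> expr" where "Var a \<equiv> Cell a []"

section \<open>Perfect matchings\<close>

text \<open>Arrays: \<open>3\<close> the order \<open>N\<close>, \<open>5\<close> the bipartite graph, \<open>6\<close> the matching, \<open>7\<close> the matched
  right vertices, \<open>8\<close> the level of a right vertex in the search (\<open>0\<close> if not reached), \<open>9\<close> its
  parent, \<open>11\<close> the end of the augmenting path, \<open>12\<close> whether the path has been flipped.\<close>

definition search_step :: loop where
  "search_step =
     LIf (EAnd (EEq (Cell 8 [Var 22]) (Const 0)) (EAnd (Cell 5 [Var 23, Var 22])
          (EOr (EEq (Var 23) (Var 20))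
            (EAnd (ELess (Var 23) (Var 20))
              (EAnd (Cell 8 [Cell 6 [Var 23]]) (ELess (Cell 8 [Cell 6 [Var 23]]) (Plus (Var 21) (Const 1))))))))
        (LSet 9 [Var 22] (Var 23) ;; LSet 8 [Var 22] (Plus (Var 21) (Const 1)))
        LSkip"

definition search_round :: loop where
  "search_round = LFor 22 3 (LFor 23 3 search_step)"

definition search :: loop where
  "search = LFor 22 3 (LSet 8 [Var 22] (Const 0)) ;; LFor 21 3 search_round"

definition find_free :: loop where
  "find_free = LFor 22 3 (LIf (EAnd (Cell 8 [Var 22]) (EEq (Cell 7 [Var 22]) (Const 0)))
     (LSet 11 [] (Var 22)) LSkip)"

definition flip_step :: loop where
  "flip_step = LIf (EEq (Var 12) (Const 0))
     (LSet 13 [] (Cell 9 [Var 11]) ;; LSet 14 [] (Cell 6 [Var 13]) ;;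
      LSet 6 [Var 13] (Var 11) ;; LSet 11 [] (Var 14) ;;
      LIf (EEq (Var 13) (Var 20)) (LSet 12 [] (Const 1)) LSkip)
     LSkip"

definition augment :: loop where
  "augment = LSet 7 [Var 11] (Const 1) ;; LSet 12 [] (Const 0) ;; LFor 21 3 flip_step"

definition matching :: loop where
  "matching = LFor 20 3 (search ;; find_free ;; augment)"

section \<open>Alternating search for an augmenting path\<close>

lemma writes_matching_parts [simp]:
  "writes search_step = {9, 8}" "writes search_round = {22, 23, 9, 8}" "writes search = {21, 22, 23, 9, 8}"
  "writes find_free = {22, 11}" "writes flip_step = {13, 14, 6, 11, 12}"
  "writes augment = {7, 12, 21, 13, 14, 6, 11}"
  by (auto simp: search_step_def search_round_def search_def find_free_def flip_step_def augment_def)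

text \<open>The left vertices in the alternating tree. \<open>x0\<close> is about to be matched, the
  vertices below it are matched already, and those above it do not take part yet.\<close>

definition active :: "store \<Rightarrow> nat \<Rightarrow> nat \<Rightarrow> nat \<Rightarrow> bool" where
  "active s x0 r x \<longleftrightarrow> x = x0 \<or> x < x0 \<and> s 8 [s 6 [x]] \<noteq> 0 \<and> s 8 [s 6 [x]] \<le> r"

text \<open>The search assigns level \<open>r + 1\<close> in round \<open>r\<close>.\<close>

definition levelled :: "store \<Rightarrow> nat \<Rightarrow> nat \<Rightarrow> bool" where
  "levelled s x0 r \<longleftrightarrow> (\<forall>y < s 3 []. s 8 [y] \<noteq> 0 \<longrightarrow> s 8 [y] \<le> r \<and> s 9 [y] < s 3 [] \<and>
     s 5 [s 9 [y], y] \<noteq> 0 \<and> active s x0 (s 8 [y] - 1) (s 9 [y]))"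

text \<open>The round writes level \<open>r + 1\<close> but expands only vertices whose partner has
  level at most \<open>r\<close>. Hence the order in which the pairs are visited does not matter,
  and every parent was active at a smaller level.\<close>

lemma search_round:
  assumes N: "s 3 [] = N" and x0: "s 20 [] = x0" and r: "s 21 [] = r"
    and lev: "levelled s x0 r"
  defines "t \<equiv> sem search_round s"
  shows "levelled t x0 (Suc r)"
    and "t 8 [y] \<noteq> 0 \<longleftrightarrow> s 8 [y] \<noteq> 0 \<or> y < N \<and> (\<exists>x<N. active s x0 r x \<and> s 5 [x, y] \<noteq> 0)"
proof -
  define hit where "hit y x \<longleftrightarrow> active s x0 r x \<and> s 5 [x, y] \<noteq> 0" for y x
  define upd where "upd t y \<longleftrightarrow> t 8 [y] = Suc r \<and> y < N \<and> t 9 [y] < N \<and> hit y (t 9 [y])"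
    for t :: store and y
  define same where "same t y \<longleftrightarrow> t 8 [y] = s 8 [y] \<and> t 9 [y] = s 9 [y]" for t :: store and y
  \<comment> \<open>\<open>D\<close> collects the pairs visited so far. A \<open>hit\<close> is
    judged in the initial store \<open>s\<close>, which is legitimate because levels written in this
    round fail the test.\<close>
  define J where "J D t \<longleftrightarrow> t 3 = s 3 \<and> t 5 = s 5 \<and> t 6 = s 6 \<and> t 20 = s 20 \<and> t 21 = s 21 \<and>
      (\<forall>y. if s 8 [y] = 0 \<and> (\<exists>x. (x, y) \<in> D \<and> hit y x) then upd t y else same t y)"
    for D and t :: store
  have cell: "J (insert (j, i) D) (sem search_step w)"
    if "J D w" "w 22 [] = i" "w 23 [] = j" "i < N" "j < N" for D w i j
  proof -
    have fr: "w 5 = s 5" "w 6 = s 6" "w 20 [] = x0" "w 21 [] = r" using that x0 r by (auto simp: J_def)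
    have W: "if s 8 [y] = 0 \<and> (\<exists>x. (x, y) \<in> D \<and> hit y x) then upd w y else same w y" for y
      using that(1) unfolding J_def by blast
    have R: "w 8 [y] = s 8 [y] \<or> w 8 [y] = Suc r \<and> s 8 [y] = 0" for y
      using W[of y] by (auto simp: upd_def same_def split: if_splits)
    have act: "j = x0 \<or> j < x0 \<and> w 8 [s 6 [j]] \<noteq> 0 \<and> w 8 [s 6 [j]] < Suc r \<longleftrightarrow> active s x0 r j"
      using R[of "s 6 [j]"] unfolding active_def by auto
    let ?c = "w 8 [i] = 0 \<and> hit i j"
    have sem: "sem search_step w = (if ?c then update (update w 9 [i] j) 8 [i] (Suc r) else w)"
      using act that fr by (auto simp: search_step_def hit_def)
    have "if s 8 [y] = 0 \<and> (\<exists>x. (x, y) \<in> insert (j, i) D \<and> hit y x)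
      then upd (sem search_step w) y else same (sem search_step w) y" for y
    proof (cases "y = i")
      case True
      then show ?thesis
        using W[of i] R[of i] that(4,5) unfolding sem by (auto simp: upd_def same_def split: if_splits)
    next
      case False
      then have "sem search_step w 8 [y] = w 8 [y]" "sem search_step w 9 [y] = w 9 [y]"
        unfolding sem by auto
      then show ?thesis using W[of y] False by (auto simp: upd_def same_def split: if_splits)
    qed
    then show ?thesis using that(1) unfolding J_def by (simp add: sem_frame)
  qed
  have J_upd: "J D (update w v [] x)" if "J D w" "v \<in> {22, 23}" for D w v x
  proof -
    have "upd (update w v [] x) = upd w" "same (update w v [] x) = same w"
      using that(2) by (auto simp: upd_def same_def fun_eq_iff)
    then show ?thesis using that by (auto simp: J_def)
  qed
  have "J ({..<N} \<times> {..<N}) t"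
    unfolding t_def search_round_def
  proof (rule sem_LFor[where I = "\<lambda>i. J ({..<N} \<times> {..<i})"], goal_cases)
    case 3
    show ?case by (simp add: J_def same_def)
  next
    case (4 i u)
    have "J ({..<N} \<times> {..<i} \<union> {..<N} \<times> {i}) (sem (LFor 23 3 search_step) u)"
    proof (rule sem_LFor[where I = "\<lambda>j. J ({..<N} \<times> {..<i} \<union> {..<j} \<times> {i})"], goal_cases)
      case (4 j w)
      have "w 22 [] = i" using 4(3)[of 22] \<open>u 22 [] = i\<close> by simp
      from cell[OF 4(2) this 4(4) \<open>i < N\<close> 4(1)] show ?case
        by (simp add: lessThan_Suc insert_Times_insert)
    qed (use 4(2) 4(3)[of 3] N J_upd in simp_all)
    moreover have "{..<N} \<times> {..<i} \<union> {..<N} \<times> {i} = {..<N} \<times> {..<Suc i}" by auto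
    ultimately show ?case by simp
  qed (use N J_upd in auto)
  then have J: "t 3 = s 3" "t 5 = s 5" "t 6 = s 6"
    "\<And>y. if s 8 [y] = 0 \<and> y < N \<and> (\<exists>x<N. hit y x) then upd t y else same t y"
  proof -
    have "(\<exists>x. (x, y) \<in> {..<N} \<times> {..<N} \<and> hit y x) \<longleftrightarrow> y < N \<and> (\<exists>x<N. hit y x)" for y by auto
    then show "t 3 = s 3" "t 5 = s 5" "t 6 = s 6"
      "\<And>y. if s 8 [y] = 0 \<and> y < N \<and> (\<exists>x<N. hit y x) then upd t y else same t y"
      using \<open>J ({..<N} \<times> {..<N}) t\<close> unfolding J_def by simp_all
  qed
  show "t 8 [y] \<noteq> 0 \<longleftrightarrow> s 8 [y] \<noteq> 0 \<or> y < N \<and> (\<exists>x<N. active s x0 r x \<and> s 5 [x, y] \<noteq> 0)"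
    using J(4)[of y] by (auto simp: upd_def same_def hit_def split: if_splits)
  have act: "active t x0 q x" if "active s x0 q x" "q \<le> r" for q x
    using that J(4)[of "s 6 [x]"] unfolding active_def J(3)
    by (auto simp: same_def split: if_splits)
  show "levelled t x0 (Suc r)"
    unfolding levelled_def
  proof (intro allI impI)
    fix y assume yN: "y < t 3 []" and y: "t 8 [y] \<noteq> 0"
    show "t 8 [y] \<le> Suc r \<and> t 9 [y] < t 3 [] \<and> t 5 [t 9 [y], y] \<noteq> 0 \<and>
        active t x0 (t 8 [y] - 1) (t 9 [y])"
    proof (cases "s 8 [y] = 0")
      case True
      then have "upd t y" using J(4)[of y] y by (auto simp: same_def split: if_splits)
      then show ?thesis using J N act[of r "t 9 [y]"] by (auto simp: upd_def hit_def)
    next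
      case False
      then have eq: "t 8 [y] = s 8 [y]" "t 9 [y] = s 9 [y]" using J(4)[of y] by (auto simp: same_def)
      have "s 8 [y] \<le> r \<and> s 9 [y] < s 3 [] \<and>
          s 5 [s 9 [y], y] \<noteq> 0 \<and> active s x0 (s 8 [y] - 1) (s 9 [y])"
        using lev False yN J(1) unfolding levelled_def by simp
      then show ?thesis using eq J(1-3) act[of "s 8 [y] - 1" "s 9 [y]"] by auto
    qed
  qed
qed

text \<open>\<open>N\<close> rounds suffice: while the reached set is not closed, every round adds a
  vertex to it. If \<open>N\<close> vertices have been reached, these are all, and closedness is
  trivial.\<close>

lemma search:
  assumes N: "s 3 [] = N" and x0: "s 20 [] = x0" and \<sigma>: "\<And>x. x < x0 \<Longrightarrow> s 6 [x] < N"
  defines "t \<equiv> sem search s"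
  shows "levelled t x0 N"
    and "x < N \<Longrightarrow> y < N \<Longrightarrow> active t x0 N x \<Longrightarrow> s 5 [x, y] \<noteq> 0 \<Longrightarrow> t 8 [y] \<noteq> 0"
proof -
  define c where "c = LFor 22 3 (LSet 8 [Var 22] (Const 0))"
  define closed where "closed t r \<longleftrightarrow>
      (\<forall>x<N. \<forall>y<N. active t x0 r x \<longrightarrow> s 5 [x, y] \<noteq> 0 \<longrightarrow> t 8 [y] \<noteq> 0)" for t r
  define reached where "reached t = {y. y < N \<and> t 8 [y] \<noteq> 0}" for t :: store
  have fin: "finite (reached t)" for t by (simp add: reached_def)
  have c: "\<forall>y<N. sem c s 8 [y] = 0"
    unfolding c_def
  proof (rule sem_LFor[where I = "\<lambda>i t. \<forall>y<i. t 8 [y] = 0"], goal_cases)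
    case (4 i t)
    then show ?case by (auto simp: less_Suc_eq)
  qed (use N in auto)
  have "levelled t x0 N \<and> (closed t N \<or> N \<le> card (reached t))"
    unfolding t_def search_def c_def[symmetric] sem.simps(3)
  proof (rule sem_LFor[where I = "\<lambda>r t. levelled t x0 r \<and> (closed t r \<or> r \<le> card (reached t))"], goal_cases)
    case 2
    show ?case using N by (simp add: c_def sem_frame)
  next
    case 3
    show ?case using c N by (simp add: levelled_def sem_frame c_def)
  next
    case (4 r u)
    have fr: "u 3 [] = N" "u 20 [] = x0" "u 5 = s 5" "u 6 = s 6"
      using 4(3)[of 3] 4(3)[of 20] 4(3)[of 5] 4(3)[of 6] N x0 by (auto simp: c_def sem_frame)
    let ?u = "sem search_round u"
    note round = search_round[OF fr(1,2) 4(4) conjunct1[OF 4(2)]]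
    have lev: "s 8 [y] \<le> q" if "levelled s x0 q" "y < s 3 []" for s y q
      using that by (cases "s 8 [y] = 0") (auto simp: levelled_def)
    show ?case
    proof (intro conjI)
      show "levelled ?u x0 (Suc r)" by (rule round(1))
      show "closed ?u (Suc r) \<or> Suc r \<le> card (reached ?u)"
      proof (cases "closed u r")
        case True
        then have same: "?u 8 [y] \<noteq> 0 \<longleftrightarrow> u 8 [y] \<noteq> 0" for y
          unfolding round(2) closed_def fr(3) by blast
        have "active u x0 r x" if "active ?u x0 (Suc r) x" for x
          using that same[of "s 6 [x]"] lev[OF conjunct1[OF 4(2)], of "s 6 [x]"] \<sigma> fr
          by (auto simp: active_def sem_frame)
        then have "closed ?u (Suc r)" using True unfolding closed_def same by blast
        then show ?thesis ..
      next
        case False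
        then obtain x y where xy: "x < N" "y < N" "active u x0 r x" "s 5 [x, y] \<noteq> 0" "u 8 [y] = 0"
          by (auto simp: closed_def)
        have "y \<in> reached ?u" "y \<notin> reached u"
          using round(2)[of y] xy fr by (auto simp: reached_def)
        moreover have "reached u \<subseteq> reached ?u"
          using round(2) by (auto simp: reached_def)
        ultimately have "card (reached u) < card (reached ?u)"
          by (intro psubset_card_mono fin) auto
        then show ?thesis using 4(2) False by simp
      qed
    qed
  next
    case (5 r x u)
    have "active (update u 21 [] x) x0 r = active u x0 r" for r x u
      by (simp add: active_def fun_eq_iff)
    then show ?case using 5 by (simp add: levelled_def closed_def reached_def)
  qed simp
  moreover have "closed t N" if "N \<le> card (reached t)"
  proof -
    have "reached t = {..<N}"
      using that by (intro card_seteq) (auto simp: reached_def)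
    then show ?thesis by (auto simp: closed_def reached_def)
  qed
  ultimately show "levelled t x0 N"
    and "x < N \<Longrightarrow> y < N \<Longrightarrow> active t x0 N x \<Longrightarrow> s 5 [x, y] \<noteq> 0 \<Longrightarrow> t 8 [y] \<noteq> 0"
    by (auto simp: closed_def)
qed

text \<open>Otherwise the vertices that lead into \<open>Y\<close> violate Hall's condition.\<close>

lemma unmatched_reached:
  fixes \<sigma> \<pi> :: "nat \<Rightarrow> nat"
  assumes "x0 < N" "inj_on \<sigma> {..<x0}" "inj_on \<pi> {..<N}"
    and closed: "\<And>x. x < N \<Longrightarrow> x = x0 \<or> x < x0 \<and> \<sigma> x \<in> Y \<Longrightarrow> \<pi> x \<in> Y" and fin: "finite Y"
  shows "\<not> Y \<subseteq> \<sigma> ` {..<x0}"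
proof
  assume Y: "Y \<subseteq> \<sigma> ` {..<x0}"
  define X where "X = {x. x < x0 \<and> \<sigma> x \<in> Y}"
  have "\<sigma> ` X = Y" using Y by (auto simp: X_def)
  moreover have "inj_on \<sigma> X" using assms(2) by (rule inj_on_subset) (auto simp: X_def)
  ultimately have "card X = card Y" using card_image by metis
  moreover have "finite X" "x0 \<notin> X" by (auto simp: X_def)
  ultimately have "card (insert x0 X) = Suc (card Y)" by simp
  moreover have "inj_on \<pi> (insert x0 X)"
    using assms(3) by (rule inj_on_subset) (use assms(1) in \<open>auto simp: X_def\<close>)
  moreover have "\<pi> ` insert x0 X \<subseteq> Y" using closed assms(1) by (auto simp: X_def)
  ultimately show False using card_inj_on_le[of \<pi> "insert x0 X" Y] fin by simp
qed

lemma find_free: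
  assumes "s 3 [] = N" and "y < N" "s 8 [y] \<noteq> 0" "s 7 [y] = 0"
  defines "t \<equiv> sem find_free s"
  shows "t 11 [] < N \<and> s 8 [t 11 []] \<noteq> 0 \<and> s 7 [t 11 []] = 0"
proof -
  let ?P = "\<lambda>y. y < N \<and> s 8 [y] \<noteq> 0 \<and> s 7 [y] = 0"
  have "(\<exists>y<N. ?P y) \<longrightarrow> ?P (t 11 [])"
    unfolding t_def find_free_def
  proof (rule sem_LFor[where I = "\<lambda>i t. (\<exists>y<i. ?P y) \<longrightarrow> ?P (t 11 [])"], goal_cases)
    case (4 i u)
    then show ?case using 4(3)[of 8] 4(3)[of 7] by (auto simp: less_Suc_eq)
  qed (use assms in auto)
  then show ?thesis using assms by blast
qed

section \<open>Flipping the augmenting path\<close>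

definition partial_matching :: "store \<Rightarrow> nat set \<Rightarrow> nat set \<Rightarrow> bool" where
  "partial_matching s X Y \<longleftrightarrow> bij_betw (\<lambda>x. s 6 [x]) X Y \<and> (\<forall>x\<in>X. s 6 [x] < s 3 [] \<and> s 5 [x, s 6 [x]] \<noteq> 0)"

text \<open>The path is flipped from its free end back to \<open>x0\<close>. The level of the
  current right vertex strictly decreases, so \<open>N\<close> passes are enough; after
  \<open>x0\<close> has been matched, scalar 12 makes the remaining passes idle.\<close>

lemma augment:
  assumes N: "s 3 [] = N" and x0: "s 20 [] = x0" and lev: "levelled s x0 N"
    and M: "partial_matching s {..<x0} Y" and free: "s 11 [] \<notin> Y" "s 11 [] < N" "s 8 [s 11 []] \<noteq> 0"
  defines "t \<equiv> sem augment s"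
  shows "partial_matching t {..x0} (insert (s 11 []) Y)"
proof -
  define c where "c = LSet 7 [Var 11] (Const 1) ;; LSet 12 [] (Const 0)"
  define Y' where "Y' = insert (s 11 []) Y"
  \<comment> \<open>Until the flag is set, the vertex in scalar 11 is the only one in
    \<open>Y'\<close> without a partner. Parents are guaranteed only up to its level, because the
    matching has changed beyond it.\<close>
  define I where "I i t \<longleftrightarrow> (if t 12 [] = 0 then partial_matching t {..<x0} (Y' - {t 11 []}) \<and>
      t 11 [] \<in> Y' \<and> t 11 [] < N \<and> t 8 [t 11 []] \<noteq> 0 \<and> t 8 [t 11 []] + i \<le> N \<and>
      (\<forall>y<N. t 8 [y] \<noteq> 0 \<longrightarrow> t 8 [y] \<le> t 8 [t 11 []] \<longrightarrow>
         t 9 [y] < N \<and> t 5 [t 9 [y], y] \<noteq> 0 \<and> active t x0 (t 8 [y] - 1) (t 9 [y]))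
     else partial_matching t {..x0} Y')" for i and t :: store
  have "I N t"
    unfolding t_def augment_def
  proof (simp only: sem.simps(3), rule sem_LFor[where I = I], goal_cases)
    case 2
    show ?case using N by simp
  next
    case 3
    have "Y' - {s 11 []} = Y" using free by (auto simp: Y'_def)
    moreover have "s 8 [s 11 []] \<le> N" using lev free N by (auto simp: levelled_def)
    ultimately show ?case
      using assms by (auto simp: I_def Y'_def partial_matching_def levelled_def active_def)
  next
    case (4 i u)
    have fr: "u 3 [] = N" "u 20 [] = x0"
      using 4(3)[of 3] 4(3)[of 20] N x0 by auto
    show ?case
    proof (cases "u 12 [] = 0")
      case False
      then have "sem flip_step u = u" by (simp add: flip_step_def)
      then show ?thesis using 4(2) False by (simp add: I_def)
    next
      case True
      define y where "y = u 11 []"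
      define x where "x = u 9 [y]"
      have M: "partial_matching u {..<x0} (Y' - {y})" and y: "y \<in> Y'" "y < N" "u 8 [y] \<noteq> 0"
        "u 8 [y] + i \<le> N"
        and par: "\<And>z. z < N \<Longrightarrow> u 8 [z] \<noteq> 0 \<Longrightarrow> u 8 [z] \<le> u 8 [y] \<Longrightarrow>
          u 9 [z] < N \<and> u 5 [u 9 [z], z] \<noteq> 0 \<and> active u x0 (u 8 [z] - 1) (u 9 [z])"
        using 4(2) True by (auto simp: I_def y_def)
      have x: "x < N" "u 5 [x, y] \<noteq> 0" "active u x0 (u 8 [y] - 1) x"
        using par[of y] y by (auto simp: x_def)
      have inj: "inj_on (\<lambda>x. u 6 [x]) {..<x0}" and img: "(\<lambda>x. u 6 [x]) ` {..<x0} = Y' - {y}"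
        and ok: "\<And>x. x < x0 \<Longrightarrow> u 6 [x] < N \<and> u 5 [x, u 6 [x]] \<noteq> 0"
        using M fr by (auto simp: partial_matching_def bij_betw_def)
      let ?u = "sem flip_step u"
      have sem: "?u 6 = (u 6)([x] := y)" "?u 11 [] = u 6 [x]" "?u 12 [] = (if x = x0 then 1 else 0)"
        "?u 8 = u 8" "?u 9 = u 9" "?u 5 = u 5" "?u 3 = u 3"
        using True fr by (simp_all add: flip_step_def x_def y_def fun_upd_def)
      have upd: "(\<lambda>z. ?u 6 [z]) = (\<lambda>z. u 6 [z])(x := y)" unfolding sem by auto
      show ?thesis
      proof (cases "x = x0")
        case eq: True
        have "bij_betw ((\<lambda>z. u 6 [z])(x := y)) {..x0} Y'"
        proof -
          have "inj_on ((\<lambda>z. u 6 [z])(x := y)) {..x0}"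
            using inj img unfolding eq by (auto simp: inj_on_def)
          moreover have "((\<lambda>z. u 6 [z])(x := y)) ` {..x0} = Y'"
            using img y unfolding eq lessThan_Suc_atMost[symmetric] lessThan_Suc by auto
          ultimately show ?thesis by (simp add: bij_betw_def)
        qed
        then have "partial_matching ?u {..x0} Y'"
          using ok x y fr eq unfolding partial_matching_def upd by (auto simp: sem)
        then show ?thesis using sem eq by (simp add: I_def)
      next
        case neq: False
        then have a: "x < x0" "u 8 [u 6 [x]] \<noteq> 0" "u 8 [u 6 [x]] < u 8 [y]"
          using x(3) y by (auto simp: active_def)
        let ?y = "u 6 [x]"
        have y': "?y \<in> Y'" "?y \<noteq> y" "?y < N" using img a ok by blast+
        have "inj_on ((\<lambda>z. u 6 [z])(x := y)) {..<x0}"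
          using inj img by (auto simp: inj_on_def)
        moreover have "((\<lambda>z. u 6 [z])(x := y)) ` {..<x0} = Y' - {?y}"
        proof -
          have "{..<x0} = insert x ({..<x0} - {x})" using a by auto
          then have "((\<lambda>z. u 6 [z])(x := y)) ` {..<x0} = insert y ((\<lambda>z. u 6 [z]) ` ({..<x0} - {x}))"
            by (metis (no_types, lifting) fun_upd_image fun_upd_same image_cong image_insert insertI1)
          also have "(\<lambda>z. u 6 [z]) ` ({..<x0} - {x}) = Y' - {y} - {?y}"
            using inj_on_image_set_diff[OF inj, of "{..<x0}" "{x}"] img a by simp
          finally show ?thesis using y y' by auto
        qed
        ultimately have "partial_matching ?u {..<x0} (Y' - {?y})"
          using ok x y fr unfolding partial_matching_def upd bij_betw_def by (auto simp: sem)
        \<comment> \<open>Only the partner of \<open>x\<close> has changed. The parent of such a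
          \<open>z\<close> is not \<open>x\<close>, since otherwise the old partner
          \<open>?y\<close> of \<open>x\<close> would have a smaller level than
          \<open>z\<close>.\<close>
        moreover have "active ?u x0 (u 8 [z] - 1) (u 9 [z])"
          if "z < N" "u 8 [z] \<noteq> 0" "u 8 [z] \<le> u 8 [?y]" for z
        proof -
          have "active u x0 (u 8 [z] - 1) (u 9 [z])" using par[of z] that a by simp
          moreover from this have "u 9 [z] \<noteq> x" using that a by (auto simp: active_def)
          ultimately show ?thesis by (simp add: active_def sem)
        qed
        ultimately show ?thesis
          using y y' a par neq sem by (simp add: I_def)
      qed
    qed
  next
    case (5 i x u)
    have "active (update u 21 [] x) = active u"
      by (simp add: active_def fun_eq_iff)
    moreover have "partial_matching (update u 21 [] x) = partial_matching u"
      by (simp add: partial_matching_def fun_eq_iff)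
    ultimately show ?case using 5 unfolding I_def by (simp split: if_splits)
  qed simp
  \<comment> \<open>An unset flag would give a positive level whose sum with \<open>N\<close> is at
    most \<open>N\<close>.\<close>
  then show ?thesis by (auto simp: I_def Y'_def split: if_splits)
qed

text \<open>\<open>\<pi>\<close> certifies Hall's condition, so every search reaches a free right
  vertex. Once all \<open>N\<close> left vertices are matched, the matching is onto by
  counting.\<close>

lemma matching:
  assumes N: "s 3 [] = N" and U: "\<And>y. y < N \<Longrightarrow> s 7 [y] = 0"
    and \<pi>: "inj_on \<pi> {..<N}" "\<And>x. x < N \<Longrightarrow> \<pi> x < N \<and> s 5 [x, \<pi> x] \<noteq> 0"
  defines "t \<equiv> sem matching s"
  shows "bij_betw (\<lambda>x. t 6 [x]) {..<N} {..<N}" and "x < N \<Longrightarrow> s 5 [x, t 6 [x]] \<noteq> 0"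
proof -
  let ?I = "\<lambda>x0 t. partial_matching t {..<x0} {y. y < N \<and> t 7 [y] \<noteq> 0} \<and> t 3 = s 3"
  have I: "?I N t"
    unfolding t_def matching_def
  proof (rule sem_LFor[where I = ?I], goal_cases)
    case 3
    show ?case using U by (auto simp: partial_matching_def bij_betw_def)
  next
    case (4 x0 u)
    let ?Y = "{y. y < N \<and> u 7 [y] \<noteq> 0}"
    have fr: "u 3 [] = N" "u 5 = s 5" using 4(2) 4(3)[of 5] N by auto
    define u1 where "u1 = sem search u"
    define u2 where "u2 = sem find_free u1"
    have fr1: "u1 a = u a" if "a \<notin> {21, 22, 23, 9, 8}" for a
      using that by (simp add: u1_def sem_frame)
    have fr2: "u2 a = u1 a" if "a \<notin> {22, 11}" for a
      using that by (simp add: u2_def sem_frame)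
    have M: "bij_betw (\<lambda>x. u 6 [x]) {..<x0} ?Y" "\<And>x. x < x0 \<Longrightarrow> u 6 [x] < N"
      by (use conjunct1[OF 4(2)] fr(1) in \<open>auto simp: partial_matching_def\<close>)
    note sr = search[OF fr(1) 4(4) M(2), folded u1_def]
    have "\<not> {y. y < N \<and> u1 8 [y] \<noteq> 0} \<subseteq> (\<lambda>x. u 6 [x]) ` {..<x0}"
    proof (rule unmatched_reached[OF 4(1) _ \<pi>(1)])
      show "inj_on (\<lambda>x. u 6 [x]) {..<x0}" using M by (simp add: bij_betw_def)
      fix x assume x: "x < N" "x = x0 \<or> x < x0 \<and> u 6 [x] \<in> {y. y < N \<and> u1 8 [y] \<noteq> 0}"
      have "u1 8 [y] \<le> N" if "y < N" for y
        using sr(1) that fr fr1[of 3] by (cases "u1 8 [y] = 0") (auto simp: levelled_def)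
      then have "active u1 x0 N x" using x fr1[of 6] by (auto simp: active_def)
      then show "\<pi> x \<in> {y. y < N \<and> u1 8 [y] \<noteq> 0}" using sr(2)[of x "\<pi> x"] \<pi>(2)[of x] x fr by simp
    qed simp
    then obtain y where "y < N" "u1 8 [y] \<noteq> 0" "u 7 [y] = 0"
      using M by (auto simp: bij_betw_def)
    then have ff: "u2 11 [] < N \<and> u1 8 [u2 11 []] \<noteq> 0 \<and> u1 7 [u2 11 []] = 0"
      using find_free[of u1 N y] fr fr1[of 3] fr1[of 7] by (simp add: u2_def)
    have "partial_matching (sem augment u2) {..x0} (insert (u2 11 []) ?Y)"
    proof (rule augment[where N = N])
      show "levelled u2 x0 N" using sr(1) by (simp add: levelled_def active_def fr2)
      show "partial_matching u2 {..<x0} ?Y" using conjunct1[OF 4(2)] by (simp add: partial_matching_def fr1 fr2)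
    qed (use ff fr 4(4) in \<open>simp_all add: fr1 fr2\<close>)
    moreover have "sem augment u2 7 = (u 7)([u2 11 []] := 1)"
    proof -
      have "sem augment u2 7 = sem (LFor 21 3 flip_step) (sem (LSet 7 [Var 11] (Const 1) ;; LSet 12 [] (Const 0)) u2) 7"
        by (simp add: augment_def)
      also have "\<dots> = sem (LSet 7 [Var 11] (Const 1) ;; LSet 12 [] (Const 0)) u2 7"
        by (rule sem_frame) simp
      finally show ?thesis by (simp add: fr1 fr2 fun_upd_def)
    qed
    moreover from this have "insert (u2 11 []) ?Y = {y. y < N \<and> sem augment u2 7 [y] \<noteq> 0}"
      using ff by auto
    moreover have "sem augment u2 3 = s 3" using 4(2) by (simp add: sem_frame fr1 fr2)
    ultimately show ?case by (simp add: u1_def u2_def lessThan_Suc_atMost)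
  next
    case (5 i x u)
    have "partial_matching (update u 20 [] x) = partial_matching u"
      by (simp add: partial_matching_def fun_eq_iff)
    then show ?case using 5 by simp
  qed (use N in auto)
  have t5: "t 5 = s 5" by (simp add: t_def matching_def sem_frame)
  have M: "bij_betw (\<lambda>x. t 6 [x]) {..<N} {y. y < N \<and> t 7 [y] \<noteq> 0}"
    using I by (simp add: partial_matching_def)
  have "{y. y < N \<and> t 7 [y] \<noteq> 0} = {..<N}"
    using bij_betw_same_card[OF M] by (intro card_seteq) auto
  with M show "bij_betw (\<lambda>x. t 6 [x]) {..<N} {..<N}" by simp
  show "x < N \<Longrightarrow> s 5 [x, t 6 [x]] \<noteq> 0"
    using I N t5 by (simp add: partial_matching_def)
qed

section \<open>Nested loops\<close>

primrec nest :: "nat list \<Rightarrow> loop \<Rightarrow> loop" where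
  "nest [] c = c"
| "nest (v # vs) c = LFor v 0 (nest vs c)"

lemma writes_nest [simp]: "writes (nest vs c) = set vs \<union> writes c"
  by (induction vs) auto

lemma bounds_nest: "bounds (nest vs c) \<subseteq> insert 0 (bounds c)"
  by (induction vs) auto

lemma counters_ok_nest [simp]:
  "counters_ok (nest vs c) \<longleftrightarrow> counters_ok c \<and> distinct vs \<and> set vs \<inter> writes c = {}"
  by (induction vs) auto

abbreviation tuples :: "nat \<Rightarrow> nat \<Rightarrow> nat list set" where
  "tuples k n \<equiv> {xs. length xs = k \<and> set xs \<subseteq> {..<n}}"

text \<open>Indexing the invariant by the set of visited tuples avoids any reasoning about their
  lexicographic order.\<close>

lemma sem_nest:
  assumes "distinct vs" "set vs \<inter> writes c = {}" "0 \<notin> set vs" "0 \<notin> writes c" "s 0 [] = n" "I {} s"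
    and "\<And>D xs t. xs \<in> tuples (length vs) n \<Longrightarrow> I D t \<Longrightarrow>
      (\<And>a. a \<notin> set vs \<Longrightarrow> a \<notin> writes c \<Longrightarrow> t a = s a) \<Longrightarrow> map (\<lambda>v. t v []) vs = xs \<Longrightarrow>
      I (insert xs D) (sem c t)"
    and "\<And>D t v x. v \<in> set vs \<Longrightarrow> I D t \<Longrightarrow> I D (update t v [] x)"
  shows "I (tuples (length vs) n) (sem (nest vs c) s)"
  using assms
proof (induction vs arbitrary: I s)
  case Nil
  have "tuples 0 n = {[]}" by auto
  then show ?case using Nil.prems(6) Nil.prems(7)[of "[]" "{}" s] by simp
next
  case (Cons v vs)
  let ?L = "tuples (length vs) n"
  define K where "K i = {x # xs | x xs. x < i \<and> xs \<in> ?L}" for i :: nat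
  have "I (K n) (sem (LFor v 0 (nest vs c)) s)"
  proof (rule sem_LFor[where I = "\<lambda>i. I (K i)"], goal_cases)
    case 1
    show ?case using Cons.prems by auto
  next
    case 2
    show ?case using Cons.prems by simp
  next
    case 3
    show ?case using Cons.prems(6) by (simp add: K_def)
  next
    case (4 i t)
    have "I (K i \<union> Cons i ` ?L) (sem (nest vs c) t)"
    proof (rule Cons.IH[where I = "\<lambda>D. I (K i \<union> Cons i ` D)"], goal_cases)
      case 5
      show ?case using 4(3)[of 0] Cons.prems by simp
    next
      case 6
      show ?case using 4(2) by simp
    next
      case (7 xs D u)
      have "u v [] = i" using 7(3)[of v] 4(4) Cons.prems by simp
      then have "I (insert (i # xs) (K i \<union> Cons i ` D)) (sem c u)"
        using 7 4 by (intro Cons.prems(7)) auto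
      then show ?case by simp
    qed (use Cons.prems in auto)
    moreover have "K i \<union> Cons i ` ?L = K (Suc i)" by (auto simp: K_def less_Suc_eq)
    ultimately show ?case by simp
  next
    case (5 i x t)
    then show ?case using Cons.prems(8) by simp
  qed
  moreover have "K n = tuples (length (v # vs)) n"
    by (auto simp: K_def length_Suc_conv)
  ultimately show ?case by simp
qed

definition mark :: "nat list \<Rightarrow> expr \<Rightarrow> nat \<Rightarrow> expr list \<Rightarrow> loop" where
  "mark vs g a es = nest vs (LIf g (LSet a es (Const 1)) LSkip)"

lemma writes_mark [simp]: "writes (mark vs g a es) = insert a (set vs)"
  by (auto simp: mark_def)

lemma sem_mark:
  assumes "distinct vs" "a \<notin> set vs" "0 \<notin> set vs" "a \<noteq> 0" "s 0 [] = n"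
    and G: "\<And>xs t. xs \<in> tuples (length vs) n \<Longrightarrow> (\<And>b. b \<notin> set vs \<Longrightarrow> b \<noteq> a \<Longrightarrow> t b = s b) \<Longrightarrow>
      map (\<lambda>v. t v []) vs = xs \<Longrightarrow> (eval_expr g t \<noteq> 0 \<longleftrightarrow> G xs) \<and> map (\<lambda>e. eval_expr e t) es = h xs"
  shows "sem (mark vs g a es) s a is \<noteq> 0 \<longleftrightarrow> s a is \<noteq> 0 \<or> (\<exists>xs \<in> tuples (length vs) n. G xs \<and> h xs = is)"
  unfolding mark_def
proof (rule sem_nest[where I = "\<lambda>D t. t a is \<noteq> 0 \<longleftrightarrow> s a is \<noteq> 0 \<or> (\<exists>xs \<in> D. G xs \<and> h xs = is)"], goal_cases)
  case (7 D xs t)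
  then show ?case using G[of xs t] by auto
next
  case (8 D t v x)
  then have "a \<noteq> v" using assms(2) by blast
  then show ?case using 8 by simp
qed (use assms in simp_all)

section \<open>Extraction of cycles\<close>

text \<open>Arrays: \<open>30\<close> the arcs that are left, \<open>31\<close> a successor of each vertex, \<open>32\<close> the current
  vertex, \<open>33\<close> whether there are arcs left, \<open>34\<close> and \<open>35\<close> the cycle and its length, \<open>36\<close> the
  exchanges inside the blocks, \<open>37\<close> a cycle through each vertex, \<open>38\<close> the successor on it, \<open>39\<close> the
  vertices of each cycle, \<open>40\<close> the arcs on cycles, \<open>41\<close> the number of the cycle.\<close>

definition scan :: loop where
  "scan = LSet 33 [] (Const 0) ;; nest [24, 25] (LIf (Cell 30 [Var 24, Var 25])
     (LSet 31 [Var 24] (Var 25) ;; LSet 32 [] (Var 24) ;; LSet 33 [] (Const 1)) LSkip)"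

text \<open>After \<open>n\<close> steps of the successor function the walk is on a cycle of it.\<close>

definition walk :: loop where
  "walk = LFor 24 0 (LSet 32 [] (Cell 31 [Var 32]))"

text \<open>Scalar 35 receives the first return time, 0 meaning that there was no return yet.
  Positions \<open>0\<close> to \<open>n\<close> are stored, so the repetition of the start at the
  return time is available too.\<close>

definition trace :: loop where
  "trace = LSet 34 [Const 0] (Var 32) ;; LSet 35 [] (Const 0) ;;
     LFor 24 0 (LSet 34 [Plus (Var 24) (Const 1)] (Cell 31 [Cell 34 [Var 24]]) ;;
       LIf (EAnd (EEq (Var 35) (Const 0)) (EEq (Cell 34 [Plus (Var 24) (Const 1)]) (Var 32)))
         (LSet 35 [] (Plus (Var 24) (Const 1))) LSkip)"

text \<open>On a cycle of length \<open>m\<close>, position \<open>m - k\<close> stands for the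
  index \<open>- k\<close>, for \<open>k = 0\<close> by the stored repetition of the start; this
  gives the antidiagonal. Arrays 37 and 38 are overwritten together, so a vertex ends up with the
  last cycle through it and its successor on that cycle.\<close>

definition record_arc :: loop where
  "record_arc =
     (let p = Cell 34 [Var 24]; q = Cell 34 [Plus (Var 24) (Const 1)] in
      LSet 30 [p, q] (Const 0) ;; LSet 40 [p, q] (Const 1) ;;
      LSet 36 [p, q, Cell 34 [Minus (Var 35) (Var 24)]] (Const 1) ;;
      LSet 37 [p] (Var 41) ;; LSet 38 [p] q ;; LSet 39 [Var 41, p] (Const 1))"

definition record_cycle :: loop where
  "record_cycle = LFor 24 0 (LIf (ELess (Var 24) (Var 35)) record_arc LSkip)"

definition extraction_round :: loop where
  "extraction_round = scan ;; LIf (Var 33) (walk ;; trace ;; record_cycle) LSkip ;;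
     LSet 41 [] (Plus (Var 41) (Const 1))"

definition extraction :: loop where
  "extraction = LFor 28 3 extraction_round"

lemma writes_extract_parts [simp]:
  "writes scan = {24, 25, 31, 32, 33}" "writes walk = {24, 32}" "writes trace = {24, 34, 35}"
  "writes record_arc = {30, 36, 37, 38, 39, 40}" "writes record_cycle = {24, 30, 36, 37, 38, 39, 40}"
  "writes extraction_round = {24, 25, 30, 31, 32, 33, 34, 35, 36, 37, 38, 39, 40, 41}"
  by (auto simp: scan_def walk_def trace_def record_arc_def record_cycle_def extraction_round_def Let_def)

lemma scan:
  assumes n: "s 0 [] = n" and F: "\<And>a b. s 30 [a, b] \<noteq> 0 \<longleftrightarrow> (a, b) \<in> F" and sub: "F \<subseteq> {..<n} \<times> {..<n}"
  defines "t \<equiv> sem scan s"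
  shows "t 33 [] \<noteq> 0 \<longleftrightarrow> F \<noteq> {}" "F \<noteq> {} \<Longrightarrow> t 32 [] \<in> Domain F" "a \<in> Domain F \<Longrightarrow> (a, t 31 [a]) \<in> F"
proof -
  let ?I = "\<lambda>D u. (u 33 [] \<noteq> 0 \<longleftrightarrow> (\<exists>a b. [a, b] \<in> D \<and> (a, b) \<in> F)) \<and> (u 33 [] \<noteq> 0 \<longrightarrow> u 32 [] \<in> Domain F) \<and>
     (\<forall>a b. [a, b] \<in> D \<and> (a, b) \<in> F \<longrightarrow> (a, u 31 [a]) \<in> F)"
  define D where "D = tuples (length [24, 25 :: nat]) n"
  have I: "?I D t"
    unfolding D_def t_def scan_def sem.simps(3)
  proof (rule sem_nest[where I = ?I], goal_cases)
    case 5
    show ?case using n by simp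
  next
    case (7 xs D u)
    have F': "u 30 [a, b] \<noteq> 0 \<longleftrightarrow> (a, b) \<in> F" for a b using 7(3)[of 30] F by simp
    show ?case
    proof (cases "(u 24 [], u 25 []) \<in> F")
      case True
      then have "u 30 [u 24 [], u 25 []] \<noteq> 0" by (simp only: F')
      then show ?thesis using 7(2,4) True by auto
    next
      case False
      then have "u 30 [u 24 [], u 25 []] = 0" using F' by blast
      then show ?thesis using 7(2,4) False by auto
    qed
  qed auto
  have D: "[a, b] \<in> D" if "(a, b) \<in> F" for a b
    using sub that by (auto simp: D_def)
  have "(\<exists>a b. [a, b] \<in> D \<and> (a, b) \<in> F) \<longleftrightarrow> F \<noteq> {}" using D by fast
  with I D show "t 33 [] \<noteq> 0 \<longleftrightarrow> F \<noteq> {}" "F \<noteq> {} \<Longrightarrow> t 32 [] \<in> Domain F" "a \<in> Domain F \<Longrightarrow> (a, t 31 [a]) \<in> F"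
    by blast+
qed

lemma walk:
  assumes "s 0 [] = n"
  shows "sem walk s 32 [] = ((\<lambda>a. s 31 [a]) ^^ n) (s 32 [])"
  unfolding walk_def
proof (rule sem_LFor[where I = "\<lambda>i t. t 32 [] = ((\<lambda>a. s 31 [a]) ^^ i) (s 32 [])"], goal_cases)
  case (4 i t)
  then show ?case using 4(3)[of 31] by simp
qed (use assms in auto)

lemma trace:
  assumes n: "s 0 [] = n"
  defines "z \<equiv> s 32 []" and "f \<equiv> \<lambda>a. s 31 [a]" and "t \<equiv> sem trace s"
  assumes ret: "0 < l" "l \<le> n" "(f ^^ l) z = z"
  shows "i \<le> n \<Longrightarrow> t 34 [i] = (f ^^ i) z"
    and "0 < t 35 []" "t 35 [] \<le> n" "(f ^^ t 35 []) z = z" "0 < i \<Longrightarrow> i < t 35 [] \<Longrightarrow> (f ^^ i) z \<noteq> z"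
proof -
  let ?I = "\<lambda>i u. (\<forall>k\<le>i. u 34 [k] = (f ^^ k) z) \<and> (\<forall>k. 0 < k \<and> k \<le> i \<and> (u 35 [] = 0 \<or> k < u 35 []) \<longrightarrow> (f ^^ k) z \<noteq> z) \<and>
      (u 35 [] \<noteq> 0 \<longrightarrow> u 35 [] \<le> i \<and> (f ^^ u 35 []) z = z)"
  have I: "?I n t"
    unfolding t_def trace_def sem.simps(3)
  proof (rule sem_LFor[where I = ?I], goal_cases)
    case 2
    show ?case using n by simp
  next
    case 3
    show ?case by (auto simp: z_def)
  next
    case (4 i u)
    have fr: "u 31 = s 31" "u 32 [] = z" using 4(3)[of 31] 4(3)[of 32] by (auto simp: z_def)
    have new: "s 31 [(f ^^ i) z] = (f ^^ Suc i) z" by (simp add: f_def)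
    have old: "u 34 [i] = (f ^^ i) z" using 4(2) by blast
    show ?case
      using 4(2) 4(4) by (auto simp: fr old new le_Suc_eq simp del: funpow.simps)
  qed auto
  then show "i \<le> n \<Longrightarrow> t 34 [i] = (f ^^ i) z" by blast
  show pos: "0 < t 35 []" using I ret by (metis gr0I)
  show "t 35 [] \<le> n" "(f ^^ t 35 []) z = z" "0 < i \<Longrightarrow> i < t 35 [] \<Longrightarrow> (f ^^ i) z \<noteq> z"
    using I pos by auto
qed

lemma record_cycle:
  assumes n: "s 0 [] = n" and m: "s 35 [] = m" "m \<le> n"
  defines "p \<equiv> \<lambda>k. s 34 [k]" and "j \<equiv> s 41 []" and "t \<equiv> sem record_cycle s"
  shows "t 30 [u, v] \<noteq> 0 \<longleftrightarrow> s 30 [u, v] \<noteq> 0 \<and> \<not> (\<exists>k<m. u = p k \<and> v = p (Suc k))"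
    and "t 40 [u, v] \<noteq> 0 \<longleftrightarrow> s 40 [u, v] \<noteq> 0 \<or> (\<exists>k<m. u = p k \<and> v = p (Suc k))"
    and "t 36 [u, v, w] \<noteq> 0 \<longleftrightarrow> s 36 [u, v, w] \<noteq> 0 \<or> (\<exists>k<m. u = p k \<and> v = p (Suc k) \<and> w = p (m - k))"
    and "\<exists>k<m. u = p k \<Longrightarrow> t 37 [u] = j \<and> (\<exists>k<m. u = p k \<and> t 38 [u] = p (Suc k))"
    and "\<not> (\<exists>k<m. u = p k) \<Longrightarrow> t 37 [u] = s 37 [u] \<and> t 38 [u] = s 38 [u]"
    and "t 39 [i, v] \<noteq> 0 \<longleftrightarrow> s 39 [i, v] \<noteq> 0 \<or> i = j \<and> (\<exists>k<m. v = p k)"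
proof -
  let ?I = "\<lambda>l t.
    (\<forall>u v. t 30 [u, v] \<noteq> 0 \<longleftrightarrow> s 30 [u, v] \<noteq> 0 \<and> \<not> (\<exists>k<l. k < m \<and> u = p k \<and> v = p (Suc k))) \<and>
    (\<forall>u v. t 40 [u, v] \<noteq> 0 \<longleftrightarrow> s 40 [u, v] \<noteq> 0 \<or> (\<exists>k<l. k < m \<and> u = p k \<and> v = p (Suc k))) \<and>
    (\<forall>u v w. t 36 [u, v, w] \<noteq> 0 \<longleftrightarrow> s 36 [u, v, w] \<noteq> 0 \<or> (\<exists>k<l. k < m \<and> u = p k \<and> v = p (Suc k) \<and> w = p (m - k))) \<and>
    (\<forall>u. (\<exists>k<l. k < m \<and> u = p k) \<longrightarrow> t 37 [u] = j \<and> (\<exists>k<m. u = p k \<and> t 38 [u] = p (Suc k))) \<and>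
    (\<forall>u. \<not> (\<exists>k<l. k < m \<and> u = p k) \<longrightarrow> t 37 [u] = s 37 [u] \<and> t 38 [u] = s 38 [u]) \<and>
    (\<forall>i v. t 39 [i, v] \<noteq> 0 \<longleftrightarrow> s 39 [i, v] \<noteq> 0 \<or> i = j \<and> (\<exists>k<l. k < m \<and> v = p k))"
  have I: "?I n t"
    unfolding t_def record_cycle_def
  proof (rule sem_LFor[where I = ?I], goal_cases)
    case (4 l t)
    have fr: "t 34 [k] = p k" "t 35 [] = m" "t 41 [] = j" "t 24 [] = l" for k
      using 4(3)[of 34] 4(3)[of 35] 4(3)[of 41] m 4(4) by (auto simp: p_def j_def)
    show ?case
    proof (cases "l < m")
      case False
      then have "sem (LIf (ELess (Var 24) (Var 35)) record_arc LSkip) t = t" using fr by simp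
      then show ?thesis using 4(2) False by (auto simp: less_Suc_eq)
    next
      case True
      define t' where "t' = sem (LIf (ELess (Var 24) (Var 35)) record_arc LSkip) t"
      have t': "t' 30 = (t 30)([p l, p (Suc l)] := 0)" "t' 40 = (t 40)([p l, p (Suc l)] := 1)"
        "t' 36 = (t 36)([p l, p (Suc l), p (m - l)] := 1)" "t' 37 = (t 37)([p l] := j)"
        "t' 38 = (t 38)([p l] := p (Suc l))" "t' 39 = (t 39)([j, p l] := 1)"
        using True by (simp_all add: t'_def record_arc_def Let_def fr fun_upd_def)
      show ?thesis
        unfolding t'_def[symmetric] t'
        using 4(2) True by (auto simp: less_Suc_eq)
    qed
  qed (use n in auto)
  have eq: "(\<exists>k<n. k < m \<and> R k) \<longleftrightarrow> (\<exists>k<m. R k)" for R using m(2) by (meson less_le_trans)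
  note I = I[unfolded eq]
  show "t 30 [u, v] \<noteq> 0 \<longleftrightarrow> s 30 [u, v] \<noteq> 0 \<and> \<not> (\<exists>k<m. u = p k \<and> v = p (Suc k))"
    using I[THEN conjunct1] by blast
  show "t 40 [u, v] \<noteq> 0 \<longleftrightarrow> s 40 [u, v] \<noteq> 0 \<or> (\<exists>k<m. u = p k \<and> v = p (Suc k))"
    using I[THEN conjunct2, THEN conjunct1] by blast
  show "t 36 [u, v, w] \<noteq> 0 \<longleftrightarrow> s 36 [u, v, w] \<noteq> 0 \<or> (\<exists>k<m. u = p k \<and> v = p (Suc k) \<and> w = p (m - k))"
    using I[THEN conjunct2, THEN conjunct2, THEN conjunct1] by blast
  show "\<exists>k<m. u = p k \<Longrightarrow> t 37 [u] = j \<and> (\<exists>k<m. u = p k \<and> t 38 [u] = p (Suc k))"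
    using I[THEN conjunct2, THEN conjunct2, THEN conjunct2, THEN conjunct1] by blast
  show "\<not> (\<exists>k<m. u = p k) \<Longrightarrow> t 37 [u] = s 37 [u] \<and> t 38 [u] = s 38 [u]"
    using I[THEN conjunct2, THEN conjunct2, THEN conjunct2, THEN conjunct2, THEN conjunct1] by blast
  show "t 39 [i, v] \<noteq> 0 \<longleftrightarrow> s 39 [i, v] \<noteq> 0 \<or> i = j \<and> (\<exists>k<m. v = p k)"
    using I[THEN conjunct2, THEN conjunct2, THEN conjunct2, THEN conjunct2, THEN conjunct2] by blast
qed

text \<open>The first return time excludes repetitions: if two earlier iterates coincided, at
  \<open>i < j\<close>, then \<open>m - j\<close> further steps would lead from position
  \<open>i\<close> to \<open>z\<close> too soon.\<close>

lemma orbit: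
  fixes f :: "'a \<Rightarrow> 'a"
  assumes m: "0 < m" "(f ^^ m) z = z" "\<forall>i. 0 < i \<longrightarrow> i < m \<longrightarrow> (f ^^ i) z \<noteq> z"
  defines "P \<equiv> \<lambda>t. (f ^^ nat (t mod int m)) z"
  shows "P t = P r \<longleftrightarrow> t mod int m = r mod int m" and "P (t + 1) = f (P t)"
    and "i \<le> m \<Longrightarrow> P (int i) = (f ^^ i) z"
proof -
  have inj: False if "(f ^^ i) z = (f ^^ j) z" "i < j" "j < m" for i j
  proof -
    have "(f ^^ (m - j + i)) z = (f ^^ (m - j)) ((f ^^ j) z)"
      using that(1) by (simp add: funpow_add)
    also have "\<dots> = (f ^^ (m - j + j)) z" by (simp add: funpow_add)
    also have "\<dots> = z" using m(2) that by simp
    finally have "(f ^^ (m - j + i)) z = z" .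
    moreover have "0 < m - j + i" "m - j + i < m" using that by linarith+
    ultimately show False using m(3) by (metis (no_types))
  qed
  let ?i = "nat (t mod int m)" and ?j = "nat (r mod int m)"
  have lt: "?i < m" "?j < m" using m(1) by (auto simp: nat_less_iff)
  then have "P t = P r \<longleftrightarrow> ?i = ?j"
    unfolding P_def using inj[of ?i ?j] inj[of ?j ?i] by (metis linorder_neqE_nat)
  also have "\<dots> \<longleftrightarrow> t mod int m = r mod int m" using m(1) by (simp add: nat_eq_iff)
  finally show "P t = P r \<longleftrightarrow> t mod int m = r mod int m" .
  have P: "P (int i) = (f ^^ i) z" if "i \<le> m" for i
    using that m by (cases "i = m") (auto simp: P_def)
  then show "i \<le> m \<Longrightarrow> P (int i) = (f ^^ i) z" .
  have "(t + 1) mod int m = int (Suc ?i) mod int m"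
    using m(1) by (simp add: mod_simps add.commute)
  then have "P (t + 1) = P (int (Suc ?i))" by (simp add: P_def)
  also have "\<dots> = f (P t)" using P[of "Suc ?i"] lt by (simp add: P_def)
  finally show "P (t + 1) = f (P t)" .
qed

text \<open>By the pigeonhole principle two of the iterates \<open>0\<close> to \<open>n\<close>
  coincide. Their distance is a period from the earlier one on, hence also at iterate
  \<open>n\<close>.\<close>

lemma eventually_periodic:
  fixes f :: "nat \<Rightarrow> nat"
  assumes "\<And>i. (f ^^ i) z < n"
  shows "\<exists>l. 0 < l \<and> l \<le> n \<and> (f ^^ l) ((f ^^ n) z) = (f ^^ n) z"
proof -
  have "\<not> inj_on (\<lambda>i. (f ^^ i) z) {..n}"
  proof
    assume "inj_on (\<lambda>i. (f ^^ i) z) {..n}"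
    then have "card {..n} \<le> card {..<n}"
      using assms by (intro card_inj_on_le[of "\<lambda>i. (f ^^ i) z"]) auto
    then show False by simp
  qed
  then obtain i j where ij: "i < j" "j \<le> n" "(f ^^ i) z = (f ^^ j) z"
    unfolding inj_on_def by (metis atMost_iff linorder_neqE_nat)
  have add: "(f ^^ (a + b)) z = (f ^^ a) ((f ^^ b) z)" for a b by (simp add: funpow_add)
  have "(f ^^ (j - i)) ((f ^^ n) z) = (f ^^ (n - i + j)) z"
  proof -
    have "j - i + n = n - i + j" using ij by simp
    then show ?thesis by (simp only: add[symmetric])
  qed
  also have "\<dots> = (f ^^ (n - i)) ((f ^^ i) z)" using ij(3) by (simp only: add)
  also have "\<dots> = (f ^^ n) z"
  proof -
    have "n - i + i = n" using ij by simp
    then show ?thesis by (simp only: add[symmetric])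
  qed
  finally show ?thesis using ij by (intro exI[of _ "j - i"]) auto
qed

section \<open>Balanced digraphs and the removal of cycles\<close>

definition balanced :: "'a rel \<Rightarrow> bool" where
  "balanced F \<longleftrightarrow> (\<forall>a. card {b. (a, b) \<in> F} = card {b. (b, a) \<in> F})"

lemma balanced_diff:
  assumes "balanced F" "balanced D" "D \<subseteq> F" "finite F"
  shows "balanced (F - D)"
  unfolding balanced_def
proof
  fix a
  have fin: "finite {b. (a, b) \<in> D}" "finite {b. (b, a) \<in> D}"
    using finite_subset[of "{b. (a, b) \<in> D}" "snd ` D"] finite_subset[of "{b. (b, a) \<in> D}" "fst ` D"]
      finite_subset[OF assms(3,4)] by force+
  have "{b. (a, b) \<in> F - D} = {b. (a, b) \<in> F} - {b. (a, b) \<in> D}"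
    "{b. (b, a) \<in> F - D} = {b. (b, a) \<in> F} - {b. (b, a) \<in> D}" by auto
  then show "card {b. (a, b) \<in> F - D} = card {b. (b, a) \<in> F - D}"
    using assms(1-3) fin by (simp add: card_Diff_subset balanced_def subset_eq)
qed

text \<open>A vertex that is entered can be left again, so a walk along the remaining arcs never
  gets stuck.\<close>

lemma Domain_of_balanced:
  assumes "balanced F" "finite F" "(a, b) \<in> F"
  shows "b \<in> Domain F"
proof -
  have "finite {c. (c, b) \<in> F}"
    using finite_subset[of "{c. (c, b) \<in> F}" "fst ` F"] assms(2) by force
  then have "card {c. (b, c) \<in> F} \<noteq> 0" using assms by (auto simp: balanced_def)
  then have "{c. (b, c) \<in> F} \<noteq> {}" by (metis card.empty)
  then show ?thesis by auto
qed

lemma balanced_cycle: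
  assumes "\<And>t r. P t = P r \<longleftrightarrow> t mod int m = r mod int m"
  shows "balanced {(P t, P (t + 1)) | t. True}"
  unfolding balanced_def
proof
  fix a
  have succ: "P (t + k) = P (r + k)" if "P t = P r" for t r k
    using that unfolding assms by (rule mod_add_cong) simp
  show "card {b. (a, b) \<in> {(P t, P (t + 1)) | t. True}} = card {b. (b, a) \<in> {(P t, P (t + 1)) | t. True}}"
  proof (cases "\<exists>t. a = P t")
    case True
    then obtain t where t: "a = P t" by blast
    have "{b. (a, b) \<in> {(P t, P (t + 1)) | t. True}} = {P (t + 1)}"
    proof -
      have "P (r + 1) = P (t + 1)" if "P t = P r" for r using succ[OF that, of 1] by simp
      then show ?thesis unfolding t by blast
    qed
    moreover have "{b. (b, a) \<in> {(P t, P (t + 1)) | t. True}} = {P (t - 1)}"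
    proof -
      have "P r = P (t - 1)" if "P t = P (r + 1)" for r using succ[OF that, of "-1"] by simp
      moreover have "P t = P (t - 1 + 1)" by simp
      ultimately show ?thesis unfolding t by blast
    qed
    ultimately show ?thesis by simp
  next
    case False
    then have "{b. (a, b) \<in> {(P t, P (t + 1)) | t. True}} = {}"
      "{b. (b, a) \<in> {(P t, P (t + 1)) | t. True}} = {}" by auto
    then show ?thesis by (simp only: card.empty)
  qed
qed

lemma cycles_insert:
  assumes "cycles A J m P" "j \<notin> J" "0 < l"
    and Z: "\<And>t r. Z t = Z r \<longleftrightarrow> t mod int l = r mod int l"
    and A: "\<And>t. (Z t, Z (t + 1)) \<in> A - cycles.cyc_arcs J P"
  shows "cycles A (insert j J) (m(j := l)) (P(j := Z))"
    and "cycles.cyc_arcs (insert j J) (P(j := Z)) = cycles.cyc_arcs J P \<union> {(Z t, Z (t + 1)) | t. True}"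
proof -
  interpret cycles A J m P by fact
  have ne: "i \<noteq> j" if "i \<in> J" for i using that assms(2) by blast
  have not: "\<not> (P i r = Z t \<and> P i (r + 1) = Z (t + 1))" if "i \<in> J" for i r t
    using A[of t] that unfolding cyc_arcs_def by (metis (mono_tags, lifting) DiffD2 mem_Collect_eq)
  show *: "cycles A (insert j J) (m(j := l)) (P(j := Z))"
  proof
    fix i k t r assume "i \<in> insert j J" "k \<in> insert j J" "(P(j := Z)) i t = (P(j := Z)) k r"
      "(P(j := Z)) i (t + 1) = (P(j := Z)) k (r + 1)"
    then show "i = k"
      using not[of i t r] not[of k r t] P_disjoint[of i k t r] by (auto split: if_splits)
  qed (use assms P_arc m_pos P_eq_iff ne in \<open>auto split: if_splits\<close>)
  interpret I: cycles A "insert j J" "m(j := l)" "P(j := Z)" by fact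
  show "I.cyc_arcs = cyc_arcs \<union> {(Z t, Z (t + 1)) | t. True}"
    unfolding I.cyc_arcs_def cyc_arcs_def using ne by auto
qed

text \<open>\<open>F\<close> is the balanced digraph to be decomposed, and \<open>J\<close> holds
  the numbers of the rounds in which a cycle was found. Arrays 37 and 38 are constrained only at
  vertices that are covered already.\<close>

definition extracted ::
    "nat rel \<Rightarrow> store \<Rightarrow> nat set \<Rightarrow> (nat \<Rightarrow> nat) \<Rightarrow> (nat \<Rightarrow> int \<Rightarrow> nat) \<Rightarrow> bool" where
  "extracted F t J m P \<longleftrightarrow> cycles F J m P \<and>
     (\<forall>u v. t 30 [u, v] \<noteq> 0 \<longleftrightarrow> (u, v) \<in> F - cycles.cyc_arcs J P) \<and>
     (\<forall>u v. t 40 [u, v] \<noteq> 0 \<longleftrightarrow> (u, v) \<in> cycles.cyc_arcs J P) \<and>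
     (\<forall>u v w. t 36 [u, v, w] \<noteq> 0 \<longleftrightarrow> (\<exists>j\<in>J. \<exists>r. u = P j r \<and> v = P j (r + 1) \<and> w = P j (- r))) \<and>
     (\<forall>u\<in>(\<Union>j\<in>J. range (P j)). t 37 [u] \<in> J \<and> (\<exists>r. u = P (t 37 [u]) r \<and> t 38 [u] = P (t 37 [u]) (r + 1))) \<and>
     (\<forall>j v. t 39 [j, v] \<noteq> 0 \<longleftrightarrow> j \<in> J \<and> v \<in> range (P j))"

lemma extracted_cong:
  "(\<And>a. a \<in> {30, 36, 37, 38, 39, 40} \<Longrightarrow> t a = s a) \<Longrightarrow> extracted F t J m P = extracted F s J m P"
  by (simp add: extracted_def)

text \<open>The remaining arcs \<open>R\<close> are balanced, so the successor function maps tails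
  of \<open>R\<close> to tails of \<open>R\<close>. After \<open>n\<close> steps the walk is on a
  cycle inside \<open>R\<close>, whose removal preserves the balance.\<close>

lemma extraction_step:
  assumes n: "s 0 [] = n" and F: "F \<subseteq> {..<n} \<times> {..<n}" "balanced (F - cycles.cyc_arcs J P)"
    and ex: "extracted F s J m P" and j: "s 41 [] \<notin> J"
    and ne: "F - cycles.cyc_arcs J P \<noteq> {}"
  defines "t \<equiv> sem extraction_round s"
  shows "\<exists>m' P'. extracted F t (insert (s 41 []) J) m' P' \<and>
    cycles.cyc_arcs J P \<subset> cycles.cyc_arcs (insert (s 41 []) J) P' \<and>
    balanced (F - cycles.cyc_arcs (insert (s 41 []) J) P')"
proof -
  interpret cycles F J m P using ex by (simp add: extracted_def)
  define R where "R = F - cyc_arcs"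
  define s1 where "s1 = sem scan s"
  define s2 where "s2 = sem walk s1"
  define s3 where "s3 = sem trace s2"
  define s4 where "s4 = sem record_cycle s3"
  define f where "f = (\<lambda>a. s1 31 [a])"
  define z where "z = (f ^^ n) (s1 32 [])"
  define j where "j = s 41 []"
  have R: "R \<subseteq> {..<n} \<times> {..<n}" "balanced R" "R \<noteq> {}" using F ne by (auto simp: R_def)
  then have finR: "finite R" by (auto intro: finite_subset)
  have "\<And>a b. s 30 [a, b] \<noteq> 0 \<longleftrightarrow> (a, b) \<in> R" using ex by (simp add: extracted_def R_def)
  note scan = scan[of s n R, OF n this R(1), folded s1_def]
  have arc: "(a, f a) \<in> R" if "a \<in> Domain R" for a using scan(3)[OF that] by (simp add: f_def)
  have dom: "(f ^^ i) (s1 32 []) \<in> Domain R" for i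
  proof (induction i)
    case (Suc i)
    show ?case using Domain_of_balanced[OF R(2) finR arc[OF Suc]] by simp
  qed (use scan R in simp)
  have domz: "(f ^^ i) z \<in> Domain R" for i
    using dom[of "i + n"] by (simp add: z_def funpow_add)
  have "(f ^^ i) (s1 32 []) < n" for i using dom[of i] R by auto
  then obtain l where l: "0 < l" "l \<le> n" "(f ^^ l) z = z"
    using eventually_periodic[of f "s1 32 []" n] by (auto simp: z_def)
  have fr1: "s1 a = s a" if "a \<notin> {24, 25, 31, 32, 33}" for a
    using that by (simp add: s1_def sem_frame)
  have fr2: "s2 a = s1 a" if "a \<notin> {24, 32}" for a
    using that by (simp add: s2_def sem_frame)
  have fr3: "s3 a = s2 a" if "a \<notin> {24, 34, 35}" for a
    using that by (simp add: s3_def sem_frame)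
  have z: "s2 32 [] = z" using walk[of s1 n] n by (simp add: s2_def z_def f_def fr1)
  have f2: "(\<lambda>a. s2 31 [a]) = f" by (simp add: f_def fr2)
  have n2: "s2 0 [] = n" using n by (simp add: fr1 fr2)
  note trace = trace[of s2 n l, OF n2, unfolded z f2, OF l, folded s3_def]
  define m' where "m' = s3 35 []"
  have m': "0 < m'" "m' \<le> n" "(f ^^ m') z = z" "\<forall>i. 0 < i \<longrightarrow> i < m' \<longrightarrow> (f ^^ i) z \<noteq> z"
    using trace by (auto simp: m'_def)
  define Z where "Z t = (f ^^ nat (t mod int m')) z" for t
  note orbit = orbit[OF m'(1,3,4), folded Z_def]
  have p: "s3 34 [k] = Z (int k)" if "k \<le> m'" for k
    using trace(1)[of k] orbit(3)[OF that] that m' by simp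
  have ZA: "(Z t, Z (t + 1)) \<in> R" for t
    unfolding orbit(2) using arc[of "Z t"] domz by (simp add: Z_def)
  \<comment> \<open>The program describes the cycle by positions below \<open>m'\<close>, the family
    by all integers; this is the translation. It uses \<open>m' - k\<close> for \<open>- t\<close>
    because that is the position the program reads, although it equals \<open>m'\<close> for
    \<open>k = 0\<close>.\<close>
  have ix: "\<exists>k<m'. Z t = Z (int k) \<and> Z (t + 1) = Z (int (Suc k)) \<and> Z (- t) = Z (int (m' - k))" for t
  proof -
    define k where "k = nat (t mod int m')"
    have k: "k < m'" "int k = t mod int m'" using m'(1) by (auto simp: k_def nat_less_iff)
    have 1: "Z t = Z (int k)" unfolding orbit(1) k(2) by simp
    have "Z (t + 1) = Z (int k + 1)" unfolding orbit(2) 1 ..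
    then have 2: "Z (t + 1) = Z (int (Suc k))" by (simp add: add.commute)
    have "int (m' - k) = int m' - t mod int m'" using k by (simp add: of_nat_diff)
    then have "Z (- t) = Z (int (m' - k))" unfolding orbit(1) by (simp add: mod_simps)
    with k(1) 1 2 show ?thesis by blast
  qed
  have n3: "s3 0 [] = n" using n2 by (simp add: fr3)
  have j3: "s3 41 [] = j" by (simp add: j_def fr1 fr2 fr3)
  note rec = record_cycle[of s3 n m', OF n3 m'_def[symmetric] m'(2), folded s4_def, unfolded j3]
  have arcs_iff: "(\<exists>k<m'. u = s3 34 [k] \<and> v = s3 34 [Suc k]) \<longleftrightarrow> (\<exists>t. u = Z t \<and> v = Z (t + 1))" for u v
  proof
    assume "\<exists>k<m'. u = s3 34 [k] \<and> v = s3 34 [Suc k]"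
    then obtain k where "k < m'" "u = Z (int k)" "v = Z (int (Suc k))" using p by auto
    then show "\<exists>t. u = Z t \<and> v = Z (t + 1)" by (intro exI[of _ "int k"]) (simp add: add.commute)
  next
    assume "\<exists>t. u = Z t \<and> v = Z (t + 1)"
    then show "\<exists>k<m'. u = s3 34 [k] \<and> v = s3 34 [Suc k]" using ix p by (metis Suc_leI less_imp_le_nat)
  qed
  have blocks_iff: "(\<exists>k<m'. u = s3 34 [k] \<and> v = s3 34 [Suc k] \<and> w = s3 34 [m' - k]) \<longleftrightarrow>
      (\<exists>t. u = Z t \<and> v = Z (t + 1) \<and> w = Z (- t))" for u v w
  proof
    assume "\<exists>k<m'. u = s3 34 [k] \<and> v = s3 34 [Suc k] \<and> w = s3 34 [m' - k]"
    then obtain k where k: "k < m'" "u = Z (int k)" "v = Z (int (Suc k))" "w = Z (int (m' - k))" using p by auto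
    then have "w = Z (- int k)" by (simp add: orbit(1) of_nat_diff)
    then show "\<exists>t. u = Z t \<and> v = Z (t + 1) \<and> w = Z (- t)"
      using k by (intro exI[of _ "int k"]) (simp add: add.commute)
  next
    assume "\<exists>t. u = Z t \<and> v = Z (t + 1) \<and> w = Z (- t)"
    then obtain t where t: "u = Z t" "v = Z (t + 1)" "w = Z (- t)" by blast
    obtain k where k: "k < m'" "Z t = Z (int k)" "Z (t + 1) = Z (int (Suc k))" "Z (- t) = Z (int (m' - k))"
      using ix by blast
    then show "\<exists>k<m'. u = s3 34 [k] \<and> v = s3 34 [Suc k] \<and> w = s3 34 [m' - k]"
      unfolding t k(2-4) by (intro exI[of _ k]) (simp add: p)
  qed
  have verts_iff: "(\<exists>k<m'. u = s3 34 [k]) \<longleftrightarrow> u \<in> range Z" for u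
  proof
    assume "\<exists>k<m'. u = s3 34 [k]"
    then show "u \<in> range Z" using p by auto
  next
    assume "u \<in> range Z"
    then obtain t where "u = Z t" by blast
    moreover obtain k where "k < m'" "Z t = Z (int k)" using ix by blast
    ultimately show "\<exists>k<m'. u = s3 34 [k]" using p[of k] by auto
  qed
  have succ_iff: "(\<exists>k<m'. u = s3 34 [k] \<and> s4 38 [u] = s3 34 [Suc k]) \<longleftrightarrow> (\<exists>t. u = Z t \<and> s4 38 [u] = Z (t + 1))" for u
    using arcs_iff[of u "s4 38 [u]"] .
  note rec = rec[unfolded arcs_iff blocks_iff verts_iff succ_iff]
  have fr4: "s3 a = s a" if "a \<in> {30, 36, 37, 38, 39, 40}" for a
    using that by (auto simp: fr1 fr2 fr3)
  have jJ: "j \<notin> J" using assms(5) by (simp add: j_def)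
  note ins = cycles_insert[OF _ jJ m'(1) orbit(1) ZA[unfolded R_def], OF cycles_axioms]
  note ex' = ex[unfolded extracted_def]
  have old: "\<And>u v. s 30 [u, v] \<noteq> 0 \<longleftrightarrow> (u, v) \<in> F - cyc_arcs"
    "\<And>u v. s 40 [u, v] \<noteq> 0 \<longleftrightarrow> (u, v) \<in> cyc_arcs"
    "\<And>u v w. s 36 [u, v, w] \<noteq> 0 \<longleftrightarrow> (\<exists>j\<in>J. \<exists>r. u = P j r \<and> v = P j (r + 1) \<and> w = P j (- r))"
    "\<And>i v. s 39 [i, v] \<noteq> 0 \<longleftrightarrow> i \<in> J \<and> v \<in> range (P i)"
    using ex' by (simp_all only: simp_thms)
  have old4: "s 37 [u] \<in> J \<and> (\<exists>r. u = P (s 37 [u]) r \<and> s 38 [u] = P (s 37 [u]) (r + 1))"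
    if "u \<in> (\<Union>j\<in>J. range (P j))" for u
    using ex'[THEN conjunct2, THEN conjunct2, THEN conjunct2, THEN conjunct2, THEN conjunct1] that by (rule bspec)
  have ins_ex: "(\<exists>i\<in>insert j J. R ((P(j := Z)) i)) \<longleftrightarrow> R Z \<or> (\<exists>i\<in>J. R (P i))" for R
  proof -
    have "(P(j := Z)) i = P i" if "i \<in> J" for i using that jJ by auto
    then show ?thesis by auto
  qed
  have "extracted F s4 (insert j J) (m(j := m')) (P(j := Z))"
    unfolding extracted_def ins(2)
  proof (intro conjI allI ballI)
    show "cycles F (insert j J) (m(j := m')) (P(j := Z))" by (rule ins(1))
  next
    fix u v
    show "s4 30 [u, v] \<noteq> 0 \<longleftrightarrow> (u, v) \<in> F - (cyc_arcs \<union> {(Z t, Z (t + 1)) | t. True})"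
      unfolding rec(1) using old(1) by (auto simp: fr4)
    show "s4 40 [u, v] \<noteq> 0 \<longleftrightarrow> (u, v) \<in> cyc_arcs \<union> {(Z t, Z (t + 1)) | t. True}"
      unfolding rec(2) using old(2) by (auto simp: fr4)
  next
    fix u v w
    show "s4 36 [u, v, w] \<noteq> 0 \<longleftrightarrow> (\<exists>i\<in>insert j J. \<exists>r. u = (P(j := Z)) i r \<and> v = (P(j := Z)) i (r + 1) \<and>
        w = (P(j := Z)) i (- r))"
      using old(3)[of u v w] ins_ex[of "\<lambda>p. \<exists>r. u = p r \<and> v = p (r + 1) \<and> w = p (- r)"]
      unfolding rec(3) by (simp only: fr4 insert_iff simp_thms disj_commute)
  next
    fix u assume u: "u \<in> (\<Union>i\<in>insert j J. range ((P(j := Z)) i))"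
    have "s4 37 [u] \<in> insert j J \<and>
      (\<exists>r. u = (P(j := Z)) (s4 37 [u]) r \<and> s4 38 [u] = (P(j := Z)) (s4 37 [u]) (r + 1))"
    proof (cases "u \<in> range Z")
      case True
      then show ?thesis using rec(4)[OF True] by auto
    next
      case False
      then have "s4 37 [u] = s 37 [u]" "s4 38 [u] = s 38 [u]" using rec(5)[OF False] by (simp_all add: fr4)
      moreover have "u \<in> (\<Union>j\<in>J. range (P j))" using u False by (auto split: if_splits)
      ultimately show ?thesis using old4[of u] jJ by auto
    qed
    then show "s4 37 [u] \<in> insert j J"
      and "\<exists>r. u = (P(j := Z)) (s4 37 [u]) r \<and> s4 38 [u] = (P(j := Z)) (s4 37 [u]) (r + 1)" by auto
  next
    fix i v
    show "s4 39 [i, v] \<noteq> 0 \<longleftrightarrow> i \<in> insert j J \<and> v \<in> range ((P(j := Z)) i)"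
      unfolding rec(6) using old(4)[of i v] jJ by (auto simp: fr4)
  qed
  moreover have "extracted F t J' m' P' = extracted F s4 J' m' P'" for J' m' P'
  proof (rule extracted_cong)
    have "s1 33 [] \<noteq> 0" using scan(1) R(3) by blast
    then have "t = update s4 41 [] (s4 41 [] + 1)"
      by (simp add: t_def extraction_round_def s1_def[symmetric] s2_def[symmetric] s3_def[symmetric] s4_def[symmetric])
    then show "t a = s4 a" if "a \<in> {30, 36, 37, 38, 39, 40}" for a using that by auto
  qed
  moreover have "cyc_arcs \<subset> cycles.cyc_arcs (insert j J) (P(j := Z))"
  proof -
    have "(Z 0, Z (0 + 1)) \<in> {(Z t, Z (t + 1)) | t. True}" by blast
    moreover have "(Z 0, Z (0 + 1)) \<notin> cyc_arcs" using ZA[of 0] unfolding R_def by blast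
    ultimately show ?thesis unfolding ins(2) by blast
  qed
  moreover have "balanced (F - cycles.cyc_arcs (insert j J) (P(j := Z)))"
  proof -
    have "balanced (R - {(Z t, Z (t + 1)) | t. True})"
      using R(2) balanced_cycle[OF orbit(1)] finR ZA by (intro balanced_diff) auto
    moreover have "R - {(Z t, Z (t + 1)) | t. True} = F - cycles.cyc_arcs (insert j J) (P(j := Z))"
      unfolding ins(2) R_def by blast
    ultimately show ?thesis by simp
  qed
  ultimately show ?thesis unfolding j_def by blast
qed

text \<open>Each round that still finds an arc uses up at least one, and \<open>F\<close> has at
  most \<open>n * n\<close> arcs. Hence the invariant: after \<open>i\<close> rounds
  \<open>F\<close> is exhausted or at least \<open>i\<close> arcs lie on cycles. Scalar 41 also
  counts idle rounds, so the round number is a fresh index.\<close>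

lemma extraction:
  assumes n: "s 0 [] = n" and N: "s 3 [] = n * n" and F: "F \<subseteq> {..<n} \<times> {..<n}" "balanced F"
    and F30: "\<And>u v. s 30 [u, v] \<noteq> 0 \<longleftrightarrow> (u, v) \<in> F"
    and init: "s 36 = (\<lambda>_. 0)" "s 39 = (\<lambda>_. 0)" "s 40 = (\<lambda>_. 0)" "s 41 [] = 0"
  defines "t \<equiv> sem extraction s"
  shows "\<exists>J m P. extracted F t J m P \<and> cycles.cyc_arcs J P = F"
proof -
  have finF: "finite F" using F by (auto intro: finite_subset)
  have cardF: "card F \<le> n * n" using card_mono[OF _ F(1)] by simp
  have sub: "cycles.cyc_arcs J P \<subseteq> F" if "extracted F u J m P" for u J m P
  proof -
    interpret cycles F J m P using that by (simp add: extracted_def)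
    show ?thesis using P_arc by (auto simp: cyc_arcs_def)
  qed
  let ?I = "\<lambda>i u. u 0 = s 0 \<and> u 3 = s 3 \<and> u 41 [] = i \<and> (\<exists>J m P. extracted F u J m P \<and> J \<subseteq> {..<i} \<and>
      balanced (F - cycles.cyc_arcs J P) \<and> (F \<subseteq> cycles.cyc_arcs J P \<or> i \<le> card (cycles.cyc_arcs J P)))"
  have "?I (n * n) t"
    unfolding t_def extraction_def
  proof (rule sem_LFor[where I = ?I], goal_cases)
    case 3
    have c: "cycles F {} m P" for m :: "nat \<Rightarrow> nat" and P by unfold_locales auto
    have e: "cycles.cyc_arcs {} P = {}" for P :: "nat \<Rightarrow> int \<Rightarrow> nat"
      by (simp add: cycles.cyc_arcs_def[OF c])
    have "extracted F s {} m P" for m P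
      unfolding extracted_def e using c F30 init by simp
    then show ?case using init F(2) e by (intro conjI exI) auto
  next
    case (4 i u)
    then obtain J m P where ex: "extracted F u J m P" "J \<subseteq> {..<i}" "balanced (F - cycles.cyc_arcs J P)"
        "F \<subseteq> cycles.cyc_arcs J P \<or> i \<le> card (cycles.cyc_arcs J P)"
      and u: "u 0 [] = n" "u 0 = s 0" "u 3 = s 3" "u 41 [] = i"
      using n by auto
    let ?u = "sem extraction_round u"
    have fr: "?u 0 = s 0" "?u 3 = s 3" using u by (simp_all add: sem_frame)
    have "?u 41 [] = Suc i" using u by (auto simp: extraction_round_def sem_frame)
    moreover have "\<exists>J m P. extracted F ?u J m P \<and> J \<subseteq> {..<Suc i} \<and> balanced (F - cycles.cyc_arcs J P) \<and>
        (F \<subseteq> cycles.cyc_arcs J P \<or> Suc i \<le> card (cycles.cyc_arcs J P))"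
    proof (cases "F - cycles.cyc_arcs J P = {}")
      case True
      have R: "\<And>a b. u 30 [a, b] \<noteq> 0 \<longleftrightarrow> (a, b) \<in> F - cycles.cyc_arcs J P"
        using ex(1) by (simp add: extracted_def)
      have "sem scan u 33 [] = 0"
        using scan(1)[of u n, OF u(1) R] F(1) True by blast
      then have "extracted F ?u J m P = extracted F u J m P"
        by (intro extracted_cong) (auto simp: extraction_round_def sem_frame)
      then have "extracted F ?u J m P" using ex(1) by simp
      moreover have "J \<subseteq> {..<Suc i}" "F \<subseteq> cycles.cyc_arcs J P" using ex(2) True by auto
      ultimately show ?thesis using ex(3) by blast
    next
      case False
      obtain m' P' where *: "extracted F ?u (insert i J) m' P'"
        "cycles.cyc_arcs J P \<subset> cycles.cyc_arcs (insert i J) P'"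
        "balanced (F - cycles.cyc_arcs (insert i J) P')"
        using extraction_step[of u n, OF u(1) F(1) ex(3,1) _ False] ex(2) u(4) by auto
      have "card (cycles.cyc_arcs J P) < card (cycles.cyc_arcs (insert i J) P')"
        using *(2) finite_subset[OF sub[OF *(1)] finF] by (rule psubset_card_mono[rotated])
      then show ?thesis using * ex(2,4) False
        by (intro exI[of _ "insert i J"] exI[of _ m'] exI[of _ P']) auto
    qed
    ultimately show ?case using fr by simp
  next
    case (5 i x u)
    have "extracted F (update u 28 [] x) J m P = extracted F u J m P" for J m P
      by (intro extracted_cong) auto
    then show ?case using 5 by simp
  qed (use N in auto)
  then obtain J m P where ex: "extracted F t J m P" "F \<subseteq> cycles.cyc_arcs J P \<or> n * n \<le> card (cycles.cyc_arcs J P)"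
    by blast
  have "cycles.cyc_arcs J P = F"
    using ex(2)
  proof
    assume "n * n \<le> card (cycles.cyc_arcs J P)"
    then show ?thesis using cardF by (intro card_subset_eq finF sub[OF ex(1)]) (use card_mono[OF finF sub[OF ex(1)]] in simp)
  qed (use sub[OF ex(1)] in blast)
  with ex(1) show ?thesis by blast
qed

section \<open>The program\<close>

text \<open>Array \<open>4\<close> numbers the pairs of vertices, which are the elements to be matched.\<close>

definition code :: "nat \<Rightarrow> nat \<times> nat \<Rightarrow> nat" where
  "code n e = fst e * n + snd e"

lemma bij_code: "bij_betw (code n) ({..<n} \<times> {..<n}) {..<n * n}"
proof (rule bij_betw_byWitness[where f' = "\<lambda>x. (x div n, x mod n)"])
  have "a * n + b < n * n" if "a < n" "b < n" for a b
  proof -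
    have "a * n + b < Suc a * n" using that by simp
    also have "\<dots> \<le> n * n" using that by (intro mult_le_mono1) simp
    finally show ?thesis .
  qed
  then show "code n ` ({..<n} \<times> {..<n}) \<subseteq> {..<n * n}" by (auto simp: code_def)
  show "(\<lambda>x. (x div n, x mod n)) ` {..<n * n} \<subseteq> {..<n} \<times> {..<n}"
    by (auto simp: less_mult_imp_div_less intro!: mod_less_divisor intro: gr0I)
qed (auto simp: code_def)

text \<open>The machine cannot multiply, so the codes and \<open>n * n\<close> are obtained by
  counting. This stays outside \<open>main\<close> because it writes scalar 3, which limits loops
  there.\<close>

definition numbering :: loop where
  "numbering = LFor 24 0 (LFor 25 0
     (LSet 4 [Var 24, Var 25] (Var 3) ;; LSet 3 [] (Plus (Var 3) (Const 1))))"

lemma numbering: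
  assumes n: "s 0 [] = n" and "s 3 [] = 0"
  defines "t \<equiv> sem numbering s"
  shows "t 3 [] = n * n" "e \<in> {..<n} \<times> {..<n} \<Longrightarrow> t 4 [fst e, snd e] = code n e"
proof -
  let ?I = "\<lambda>i t. t 3 [] = i * n \<and> (\<forall>a<i. \<forall>b<n. t 4 [a, b] = a * n + b)"
  have I: "?I n t"
    unfolding t_def numbering_def
  proof (rule sem_LFor[where I = ?I], goal_cases)
    case (4 i u)
    let ?J = "\<lambda>j t. t 3 [] = i * n + j \<and> (\<forall>a<i. \<forall>b<n. t 4 [a, b] = a * n + b) \<and>
        (\<forall>b<j. t 4 [i, b] = i * n + b)"
    have "?J n (sem (LFor 25 0 (LSet 4 [Var 24, Var 25] (Var 3) ;; LSet 3 [] (Plus (Var 3) (Const 1)))) u)"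
    proof (rule sem_LFor[where I = ?J], goal_cases)
      case 2
      show ?case using 4(3)[of 0] n by simp
    next
      case 3
      show ?case using 4(2) by simp
    next
      case (4 j w)
      have "w 24 [] = i" using 4(3)[of 24] \<open>u 24 [] = i\<close> by simp
      then show ?case using 4(2,4) by (auto simp: less_Suc_eq)
    qed auto
    then show ?case by (auto simp: less_Suc_eq)
  qed (use assms in auto)
  then show "t 3 [] = n * n" by simp
  show "e \<in> {..<n} \<times> {..<n} \<Longrightarrow> t 4 [fst e, snd e] = code n e" using I by (auto simp: code_def)
qed

definition continues_expr :: expr where
  "continues_expr = (let a = Var 24; b = Var 25; c = Var 26; d = Var 27 in
     EOr (EAnd (EAnd (EEq a c) (EEq b d)) (ENot (EEq a b)))
       (EAnd (EEq b c) (EAnd (EOr (EEq a b) (Cell 1 [a, b])) (EAnd (EOr (EEq c d) (Cell 1 [c, d]))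
         (ENot (EAnd (EEq a b) (EAnd (EEq a c) (EEq b d))))))))"

lemma eval_continues_expr: "eval_expr continues_expr t \<noteq> 0 \<longleftrightarrow>
    continues {(a, b). t 1 [a, b] \<noteq> 0} (t 24 [], t 25 []) (t 26 [], t 27 [])"
  unfolding continues_expr_def continues_def Let_def eval_connectives eval_expr.simps list.map by auto

definition bipartite :: loop where
  "bipartite = mark [24, 25, 26, 27] continues_expr 5 [Cell 4 [Var 24, Var 25], Cell 4 [Var 26, Var 27]]"

definition used_arcs :: loop where
  "used_arcs = mark [24, 25]
     (EAnd (Cell 1 [Var 24, Var 25]) (ENot (EEq (Cell 6 [Cell 4 [Var 24, Var 25]]) (Cell 4 [Var 24, Var 25]))))
     30 [Var 24, Var 25]"

text \<open>The guard does not read array 36, so the exchanges written by the first pass do not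
  influence the second.\<close>

definition crossing :: loop where
  "crossing = (let u = Var 24; w = Var 25;
      g = EAnd (Cell 1 [u, w]) (EAnd (ENot (Cell 40 [u, w])) (ENot (Cell 39 [Cell 37 [u], w]))) in
     mark [24, 25] g 36 [u, Cell 38 [u], w] ;; mark [24, 25] g 36 [u, w, Cell 38 [u]])"

lemma writes_parts [simp]:
  "writes numbering = {24, 25, 4, 3}" "writes bipartite = {5, 24, 25, 26, 27}"
  "writes used_arcs = {30, 24, 25}" "writes crossing = {36, 24, 25}"
  by (auto simp: numbering_def bipartite_def used_arcs_def crossing_def Let_def)

lemma tuples2: "xs \<in> tuples 2 n \<longleftrightarrow> (\<exists>a<n. \<exists>b<n. xs = [a, b])"
  by (auto simp: numeral_2_eq_2 length_Suc_conv)

lemma bex_tuples2: "(\<exists>xs \<in> tuples 2 n. R xs) \<longleftrightarrow> (\<exists>a<n. \<exists>b<n. R [a, b])"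
  unfolding Bex_def tuples2 by blast

lemma tuples4: "xs \<in> tuples 4 n \<longleftrightarrow> (\<exists>a<n. \<exists>b<n. \<exists>c<n. \<exists>d<n. xs = [a, b, c, d])"
  by (auto simp: eval_nat_numeral length_Suc_conv)

lemma bipartite:
  assumes n: "s 0 [] = n" and A: "\<And>u v. s 1 [u, v] \<noteq> 0 \<longleftrightarrow> (u, v) \<in> A" and "s 5 = (\<lambda>_. 0)"
    and code: "\<And>e. e \<in> {..<n} \<times> {..<n} \<Longrightarrow> s 4 [fst e, snd e] = code n e"
    and e: "e \<in> {..<n} \<times> {..<n}" "f \<in> {..<n} \<times> {..<n}"
  shows "sem bipartite s 5 [code n e, code n f] \<noteq> 0 \<longleftrightarrow> continues A e f"
proof -
  define G where "G xs \<longleftrightarrow> continues A (xs ! 0, xs ! 1) (xs ! 2, xs ! 3)" for xs :: "nat list"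
  define h where "h xs = [code n (xs ! 0, xs ! 1), code n (xs ! 2, xs ! 3)]" for xs :: "nat list"
  have "sem bipartite s 5 is \<noteq> 0 \<longleftrightarrow> s 5 is \<noteq> 0 \<or> (\<exists>xs \<in> tuples (length [24, 25, 26, 27::nat]) n. G xs \<and> h xs = is)" for "is"
    unfolding bipartite_def Let_def
  proof (rule sem_mark, goal_cases)
    case (6 xs t)
    have fr: "t 1 = s 1" "t 4 = s 4" using 6(2) by auto
    have xs: "xs = [t 24 [], t 25 [], t 26 [], t 27 []]" using 6(3) by simp
    have "t 24 [] < n" "t 25 [] < n" "t 26 [] < n" "t 27 [] < n" using 6(1) xs by auto
    then have "t 4 [t 24 [], t 25 []] = code n (t 24 [], t 25 [])" "t 4 [t 26 [], t 27 []] = code n (t 26 [], t 27 [])"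
      using code[of "(t 24 [], t 25 [])"] code[of "(t 26 [], t 27 [])"] fr by auto
    moreover have "{(a, b). t 1 [a, b] \<noteq> 0} = A" using A fr by auto
    ultimately show ?case unfolding eval_continues_expr by (simp add: G_def h_def xs)
  qed (use n in auto)
  then have iff: "sem bipartite s 5 [code n e, code n f] \<noteq> 0 \<longleftrightarrow>
      (\<exists>xs \<in> tuples 4 n. G xs \<and> h xs = [code n e, code n f])"
    using assms(3) by (simp add: numeral_eq_Suc)
  have inj: "code n e = code n e' \<longleftrightarrow> e = e'" if "e \<in> {..<n} \<times> {..<n}" "e' \<in> {..<n} \<times> {..<n}" for e e'
    using bij_code[of n] that by (auto simp: bij_betw_def dest: inj_onD)
  show ?thesis
    unfolding iff
  proof
    assume "\<exists>xs \<in> tuples 4 n. G xs \<and> h xs = [code n e, code n f]"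
    then obtain a b c d where "a < n" "b < n" "c < n" "d < n" "continues A (a, b) (c, d)"
      "code n (a, b) = code n e" "code n (c, d) = code n f"
      unfolding Bex_def tuples4 by (auto simp: G_def h_def eval_nat_numeral)
    then show "continues A e f" using inj[of "(a, b)" e] inj[of "(c, d)" f] e by simp
  next
    assume "continues A e f"
    then have "G [fst e, snd e, fst f, snd f]" "h [fst e, snd e, fst f, snd f] = [code n e, code n f]"
      by (simp_all add: G_def h_def eval_nat_numeral)
    moreover have "[fst e, snd e, fst f, snd f] \<in> tuples 4 n" unfolding tuples4 using e by auto
    ultimately show "\<exists>xs \<in> tuples 4 n. G xs \<and> h xs = [code n e, code n f]" by blast
  qed
qed

lemma used_arcs:
  assumes n: "s 0 [] = n" and A: "\<And>u v. s 1 [u, v] \<noteq> 0 \<longleftrightarrow> (u, v) \<in> A" "A \<subseteq> {..<n} \<times> {..<n}"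
    and "s 30 = (\<lambda>_. 0)" and code: "\<And>e. e \<in> {..<n} \<times> {..<n} \<Longrightarrow> s 4 [fst e, snd e] = code n e"
  shows "sem used_arcs s 30 [a, b] \<noteq> 0 \<longleftrightarrow> (a, b) \<in> A \<and> s 6 [code n (a, b)] \<noteq> code n (a, b)"
proof -
  define G where "G xs \<longleftrightarrow> (xs ! 0, xs ! 1) \<in> A \<and> s 6 [code n (xs ! 0, xs ! 1)] \<noteq> code n (xs ! 0, xs ! 1)"
    for xs :: "nat list"
  have "sem used_arcs s 30 is \<noteq> 0 \<longleftrightarrow> s 30 is \<noteq> 0 \<or> (\<exists>xs \<in> tuples (length [24, 25::nat]) n. G xs \<and> xs = is)" for "is"
    unfolding used_arcs_def
  proof (rule sem_mark, goal_cases)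
    case (6 xs t)
    have fr: "t 1 = s 1" "t 4 = s 4" "t 6 = s 6" using 6(2) by auto
    have xs: "xs = [t 24 [], t 25 []]" using 6(3) by simp
    have "t 24 [] < n" "t 25 [] < n" using 6(1) xs by auto
    then have "t 4 [t 24 [], t 25 []] = code n (t 24 [], t 25 [])"
      using code[of "(t 24 [], t 25 [])"] fr by auto
    moreover have "s 1 [a, b] = 0 \<longleftrightarrow> (a, b) \<notin> A" for a b using A(1)[of a b] by blast
    ultimately show ?case using fr by (simp add: G_def xs del: neq0_conv One_nat_def)
  qed (use n in auto)
  then have "sem used_arcs s 30 [a, b] \<noteq> 0 \<longleftrightarrow> (\<exists>xs \<in> tuples 2 n. G xs \<and> xs = [a, b])"
    using assms(4) by (simp add: numeral_2_eq_2)
  also have "\<dots> \<longleftrightarrow> a < n \<and> b < n \<and> G [a, b]" unfolding bex_tuples2 by auto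
  also have "\<dots> \<longleftrightarrow> (a, b) \<in> A \<and> s 6 [code n (a, b)] \<noteq> code n (a, b)" using A(2) by (auto simp: G_def)
  finally show ?thesis .
qed

lemma crossing:
  assumes n: "s 0 [] = n" and A: "\<And>u v. s 1 [u, v] \<noteq> 0 \<longleftrightarrow> (u, v) \<in> A" "A \<subseteq> {..<n} \<times> {..<n}"
  defines "X \<equiv> \<lambda>u w. (u, w) \<in> A \<and> s 40 [u, w] = 0 \<and> s 39 [s 37 [u], w] = 0"
  shows "sem crossing s 36 [u, v, w] \<noteq> 0 \<longleftrightarrow>
    s 36 [u, v, w] \<noteq> 0 \<or> X u w \<and> v = s 38 [u] \<or> X u v \<and> w = s 38 [u]"
proof -
  let ?g = "EAnd (Cell 1 [Var 24, Var 25]) (EAnd (ENot (Cell 40 [Var 24, Var 25])) (ENot (Cell 39 [Cell 37 [Var 24], Var 25])))"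
  define G where "G xs \<longleftrightarrow> X (xs ! 0) (xs ! 1)" for xs :: "nat list"
  define s' where "s' = sem (mark [24, 25] ?g 36 [Var 24, Cell 38 [Var 24], Var 25]) s"
  have G: "eval_expr ?g t \<noteq> 0 \<longleftrightarrow> G xs"
    if "\<And>b. b \<notin> set [24, 25] \<Longrightarrow> b \<noteq> 36 \<Longrightarrow> t b = s b" "map (\<lambda>v. t v []) [24, 25] = xs" for xs t
  proof -
    have "t 1 = s 1" "t 40 = s 40" "t 39 = s 39" "t 37 = s 37" using that(1) by auto
    moreover have "xs = [t 24 [], t 25 []]" using that(2) by simp
    moreover have "s 1 [a, b] = 0 \<longleftrightarrow> (a, b) \<notin> A" for a b using A(1)[of a b] by blast
    ultimately show ?thesis by (simp add: G_def X_def)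
  qed
  have fr: "s' b = s b" if "b \<notin> {36, 24, 25}" for b using that by (simp add: s'_def sem_frame)
  have 1: "s' 36 is \<noteq> 0 \<longleftrightarrow> s 36 is \<noteq> 0 \<or>
      (\<exists>xs \<in> tuples (length [24, 25::nat]) n. G xs \<and> [xs ! 0, s 38 [xs ! 0], xs ! 1] = is)" for "is"
    unfolding s'_def
  proof (rule sem_mark, goal_cases)
    case (6 xs t)
    have "t 38 = s 38" "xs = [t 24 [], t 25 []]" using 6(2,3) by auto
    then show ?case using G[OF 6(2,3)] by simp
  qed (use n in auto)
  have 2: "sem (mark [24, 25] ?g 36 [Var 24, Var 25, Cell 38 [Var 24]]) s' 36 is \<noteq> 0 \<longleftrightarrow> s' 36 is \<noteq> 0 \<or>
      (\<exists>xs \<in> tuples (length [24, 25::nat]) n. G xs \<and> [xs ! 0, xs ! 1, s 38 [xs ! 0]] = is)" for "is"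
  proof (rule sem_mark, goal_cases)
    case (6 xs t)
    have *: "t b = s b" if "b \<notin> set [24, 25]" "b \<noteq> 36" for b using 6(2)[OF that] fr[of b] that by simp
    then have "t 38 = s 38" "xs = [t 24 [], t 25 []]" using 6(3) by auto
    then show ?case using G[OF * 6(3)] by simp
  qed (use n fr in auto)
  have len: "length [24, 25::nat] = 2" by simp
  have X: "X a b \<Longrightarrow> a < n \<and> b < n" for a b using A(2) by (auto simp: X_def)
  have e1: "(\<exists>xs \<in> tuples 2 n. G xs \<and> [xs ! 0, s 38 [xs ! 0], xs ! 1] = [u, v, w]) \<longleftrightarrow> X u w \<and> v = s 38 [u]"
    unfolding bex_tuples2 using X by (auto simp: G_def)
  have e2: "(\<exists>xs \<in> tuples 2 n. G xs \<and> [xs ! 0, xs ! 1, s 38 [xs ! 0]] = [u, v, w]) \<longleftrightarrow> X u v \<and> w = s 38 [u]"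
    unfolding bex_tuples2 using X by (auto simp: G_def)
  have "sem crossing s = sem (mark [24, 25] ?g 36 [Var 24, Var 25, Cell 38 [Var 24]]) s'"
    by (simp add: crossing_def Let_def s'_def)
  then show ?thesis using 1[of "[u, v, w]"] 2[of "[u, v, w]"] unfolding len e1 e2 by auto
qed

section \<open>The output\<close>

text \<open>Array numbers are constants of the program text, so the scalars that hold the
  coordinates cannot be addressed by a computed index. The loop over the \<open>k\<close>
  coordinates is therefore unrolled.\<close>

primrec steps :: "(nat \<Rightarrow> loop) \<Rightarrow> nat \<Rightarrow> loop" where
  "steps f 0 = LSkip"
| "steps f (Suc j) = steps f j ;; f j"

lemma writes_steps: "writes (steps f k) = (\<Union>j<k. writes (f j))"
  by (induction k) (auto simp: less_Suc_eq)

lemma bounds_steps: "bounds (steps f k) = (\<Union>j<k. bounds (f j))"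
  by (induction k) (auto simp: less_Suc_eq)

lemma counters_ok_steps: "counters_ok (steps f k) \<longleftrightarrow> (\<forall>j<k. counters_ok (f j))"
  by (induction k) (auto simp: less_Suc_eq)

text \<open>Scalars from 50 on hold the coordinates of the tail, and scalar 49 the new value of one
  of them; the other arrays have smaller numbers.\<close>

definition coords :: "nat \<Rightarrow> nat list" where
  "coords k = map ((+) 50) [0..<k]"

definition first_expr :: "nat \<Rightarrow> expr" where
  "first_expr j = (if j = 0 then ENot (Cell 36 [Var 50, Var 49, Var 51])
     else if j = 1 then Cell 36 [Var 51, Var 49, Var 50] else EEq (Var 50) (Var 51))"

lemma eval_first_expr: "eval_expr (first_expr j) t = 0 \<longleftrightarrow>
    (if j = 0 then t 36 [t 50 [], t 49 [], t 51 []] \<noteq> 0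
     else if j = 1 then t 36 [t 51 [], t 49 [], t 50 []] = 0 else t 50 [] \<noteq> t 51 [])"
  by (simp add: first_expr_def)

definition write_arc :: "nat \<Rightarrow> nat \<Rightarrow> loop" where
  "write_arc k j = (let es = map Var (coords k) @ (map Var (coords k))[j := Var 49] in
     LIf (Cell 1 [Var (50 + j), Var 49])
       (LIf (first_expr j) (LSet 2 es (Const 1)) (LSet 2 es (Const 2))) LSkip)"

text \<open>The nest visits \<open>n ^ (k + 1)\<close> tuples, which is polynomial because
  \<open>k\<close> is fixed.\<close>

definition write_parts :: "nat \<Rightarrow> loop" where
  "write_parts k = nest (49 # coords k) (steps (write_arc k) k)"

lemma arc_cart_power_iff:
  assumes "parcs G \<subseteq> pverts G \<times> pverts G"
  shows "(xs, ys) \<in> parcs (cart_power G k) \<longleftrightarrow>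
    xs \<in> pverts (cart_power G k) \<and> (\<exists>j<k. \<exists>v. (xs ! j, v) \<in> parcs G \<and> ys = xs[j := v])"
proof (induction k arbitrary: xs ys)
  case (Suc k)
  show ?case
  proof (cases "length xs = Suc k \<and> length ys = Suc k")
    case False
    have "length xs = Suc k \<and> length ys = Suc k" if "(xs, ys) \<in> parcs (cart_power G (Suc k))"
      using parcs_cart_power[OF assms] that unfolding pverts_cart_power by blast
    with False show ?thesis
      by (auto simp: pverts_cart_power simp del: cart_power.simps)
  next
    case True
    then obtain x xs' y ys' where eq: "xs = x # xs'" "ys = y # ys'" "length xs' = k" "length ys' = k"
      by (auto simp: length_Suc_conv)
    have V: "xs \<in> pverts (cart_power G (Suc k)) \<longleftrightarrow> x \<in> pverts G \<and> xs' \<in> pverts (cart_power G k)"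
      unfolding eq pverts_cart_power by auto
    have "(\<exists>j<Suc k. \<exists>v. (xs ! j, v) \<in> parcs G \<and> ys = xs[j := v]) \<longleftrightarrow>
        (x, y) \<in> parcs G \<and> ys' = xs' \<or> y = x \<and> (\<exists>j<k. \<exists>v. (xs' ! j, v) \<in> parcs G \<and> ys' = xs'[j := v])"
      unfolding eq Ex_less_Suc2 by auto
    then show ?thesis
      unfolding V unfolding eq Cons_arc_cart_power_iff Suc.IH using assms by auto
  qed
qed simp

text \<open>The program knows which coordinate changes, whereas \<open>first_part\<close> compares
  lists; as \<open>v\<close> differs from the old entry, both case distinctions agree.\<close>

lemma first_part_update:
  assumes "length xs = k" "2 \<le> k" "j < k" "v \<noteq> xs ! j"
  shows "first_part Q xs (xs[j := v]) \<longleftrightarrow>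
    (if j = 0 then \<not> Q (xs ! 0) v (xs ! 1) else if j = 1 then Q (xs ! 1) v (xs ! 0) else xs ! 0 = xs ! 1)"
proof -
  obtain x y zs where xs: "xs = x # y # zs"
    using assms by (metis Suc_le_length_iff numeral_2_eq_2)
  have "zs \<noteq> zs[j - 2 := v]" if "2 \<le> j"
  proof
    assume eq: "zs = zs[j - 2 := v]"
    have "zs ! (j - 2) = v"
      by (subst eq) (use that assms xs in \<open>auto intro!: nth_list_update_eq\<close>)
    then show False using assms(4) that unfolding xs by (auto simp: nth_Cons split: nat.splits simp: numeral_2_eq_2)
  qed
  then show ?thesis
    using assms(4) unfolding xs
    by (cases j; cases "j - 1") (auto simp: numeral_2_eq_2)
qed

lemma write_parts:
  assumes n: "s 0 [] = n" and A: "\<And>u v. s 1 [u, v] \<noteq> 0 \<longleftrightarrow> (u, v) \<in> A" "\<And>u. (u, u) \<notin> A" "A \<subseteq> {..<n} \<times> {..<n}"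
    and Q: "\<And>u v w. s 36 [u, v, w] \<noteq> 0 \<longleftrightarrow> Q u v w" and "s 2 = (\<lambda>_. 0)" and k: "2 \<le> k"
    and xs: "xs \<in> tuples k n" "length ys = k"
  shows "sem (write_parts k) s 2 (xs @ ys) =
    (if \<exists>j<k. \<exists>v. (xs ! j, v) \<in> A \<and> ys = xs[j := v] then if first_part Q xs ys then 1 else 2 else 0)"
proof -
  define val where "val xs ys = (if first_part Q xs ys then 1 else 2 :: nat)" for xs ys
  define arc where "arc j v xs ys \<longleftrightarrow> (xs ! j, v) \<in> A \<and> ys = xs[j := v]" for j v and xs ys :: "nat list"
  \<comment> \<open>\<open>val\<close> depends on the two lists only, so repeated writes to a cell
    agree, and the set \<open>D\<close> of visited tuples determines the contents.\<close>
  define I where "I D t \<longleftrightarrow> (\<forall>xs ys. length xs = k \<longrightarrow> length ys = k \<longrightarrow>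
      t 2 (xs @ ys) = (if \<exists>j<k. \<exists>v. v # xs \<in> D \<and> arc j v xs ys then val xs ys else 0))"
    for D :: "nat list set" and t :: store
  have [simp]: "length (coords k) = k" "set (coords k) = {50..<50 + k}" "distinct (coords k)"
    by (auto simp: coords_def distinct_map)
  have w: "writes (steps (write_arc k) l) \<subseteq> {2}" for l
    by (auto simp: writes_steps write_arc_def Let_def split: if_splits)
  have nw: "a \<notin> writes (steps (write_arc k) l)" if "a \<noteq> 2" for a l using w[of l] that by blast
  have body: "sem (steps (write_arc k) l) t 2 (xs @ ys) =
        (if map (\<lambda>v. t v []) (coords k) = xs \<and> (\<exists>j<l. arc j (t 49 []) xs ys) then val xs ys else t 2 (xs @ ys))"
    if "l \<le> k" "length xs = k" "length ys = k" "t 1 = s 1" "t 36 = s 36" for l t xs ys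
    using that(1)
  proof (induction l)
    case (Suc l)
    let ?t = "sem (steps (write_arc k) l) t"
    let ?xs = "map (\<lambda>v. t v []) (coords k)" and ?v = "t 49 []"
    have fr: "?t a = t a" if "a \<noteq> 2" for a using nw[OF that] by (rule sem_frame)
    have coord: "?xs ! j = t (50 + j) []" if "j < k" for j using that by (simp add: coords_def)
    have es: "map (\<lambda>e. eval_expr e ?t) (map Var (coords k) @ (map Var (coords k))[l := Var 49]) = ?xs @ ?xs[l := ?v]"
    proof -
      have "map (\<lambda>e. eval_expr e ?t) (map Var (coords k)) = ?xs" using fr by auto
      moreover have "eval_expr (Var 49) ?t = ?v" using fr by simp
      ultimately show ?thesis by (simp only: map_append map_update)
    qed
    have xsl: "t (50 + l) [] = ?xs ! l" "t 50 [] = ?xs ! 0" "t 51 [] = ?xs ! 1"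
      using coord[of l] coord[of 0] coord[of 1] Suc.prems k by simp_all
    have first: "eval_expr (first_expr l) ?t \<noteq> 0 \<longleftrightarrow> first_part Q ?xs (?xs[l := ?v])"
      if "(?xs ! l, ?v) \<in> A"
    proof -
      have "?v \<noteq> ?xs ! l" using that A(2) by metis
      then have "first_part Q ?xs (?xs[l := ?v]) \<longleftrightarrow>
          (if l = 0 then \<not> Q (?xs ! 0) ?v (?xs ! 1) else if l = 1 then Q (?xs ! 1) ?v (?xs ! 0) else ?xs ! 0 = ?xs ! 1)"
        using first_part_update[of ?xs k l ?v Q] k Suc.prems by simp
      moreover have "eval_expr (first_expr l) ?t = 0 \<longleftrightarrow>
          (if l = 0 then Q (?xs ! 0) ?v (?xs ! 1) else if l = 1 then \<not> Q (?xs ! 1) ?v (?xs ! 0) else ?xs ! 0 \<noteq> ?xs ! 1)"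
      proof -
        have "?t 36 = s 36" "?t 49 = t 49" "?t 50 = t 50" "?t 51 = t 51"
          using fr[of 36] fr[of 49] fr[of 50] fr[of 51] \<open>t 36 = s 36\<close> by simp_all
        moreover have "s 36 [u, v, w] = 0 \<longleftrightarrow> \<not> Q u v w" for u v w using Q[of u v w] by blast
        ultimately show ?thesis
          unfolding eval_first_expr xsl[symmetric] by (simp only: not_not)
      qed
      ultimately show ?thesis by presburger
    qed
    have step: "sem (write_arc k l) ?t 2 (xs @ ys) =
      (if (?xs ! l, ?v) \<in> A \<and> xs @ ys = ?xs @ ?xs[l := ?v] then val ?xs (?xs[l := ?v]) else ?t 2 (xs @ ys))"
    proof (cases "(?xs ! l, ?v) \<in> A")
      case True
      then have "eval_expr (Cell 1 [Var (50 + l), Var 49]) ?t \<noteq> 0"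
        using A(1) fr \<open>t 1 = s 1\<close> xsl by simp
      then show ?thesis
        using True first[OF True] es
        unfolding write_arc_def Let_def sem.simps(4) val_def by (simp del: map_append)
    next
      case False
      then have "eval_expr (Cell 1 [Var (50 + l), Var 49]) ?t = 0"
        using A(1)[of "?xs ! l" ?v] fr[of 1] fr[of 49] fr[of "50 + l"] \<open>t 1 = s 1\<close> xsl(1) by simp
      then show ?thesis using False unfolding write_arc_def Let_def sem.simps(4) by simp
    qed
    have new: "sem (write_arc k l) ?t 2 (xs @ ys) =
        (if ?xs = xs \<and> arc l ?v xs ys then val xs ys else ?t 2 (xs @ ys))"
    proof (cases "?xs = xs")
      case True
      then show ?thesis unfolding step unfolding True arc_def by auto
    next
      case False
      then have "xs @ ys \<noteq> ?xs @ ?xs[l := ?v]" using \<open>length xs = k\<close> by auto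
      then show ?thesis unfolding step using False by argo
    qed
    have split: "(\<exists>j<Suc l. arc j ?v xs ys) \<longleftrightarrow> (\<exists>j<l. arc j ?v xs ys) \<or> arc l ?v xs ys"
      unfolding less_Suc_eq by blast
    have old: "?t 2 (xs @ ys) =
        (if ?xs = xs \<and> (\<exists>j<l. arc j ?v xs ys) then val xs ys else t 2 (xs @ ys))"
      using Suc by simp
    have combine: "a = (if p \<and> q' then x else c)"
      if "a = (if p \<and> r then x else b)" "q' = (q \<or> r)" "b = (if p \<and> q then x else c)"
      for a b c x :: nat and p q r q' using that by auto
    show ?case unfolding steps.simps sem.simps(3) by (rule combine[OF new split old])
  qed simp
  have "I (tuples (length (49 # coords k)) n) (sem (write_parts k) s)"
    unfolding write_parts_def
  proof (rule sem_nest[where I = I], goal_cases)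
    case (7 D vxs t)
    have fr: "t 1 = s 1" "t 36 = s 36" using 7(3)[of 1] 7(3)[of 36] nw by auto
    define v where "v = t 49 []"
    have vxs: "vxs = v # map (\<lambda>v. t v []) (coords k)" using 7(4) by (simp add: v_def)
    show ?case
      unfolding I_def
    proof (intro allI impI)
      fix xs ys :: "nat list" assume len: "length xs = k" "length ys = k"
      have old: "t 2 (xs @ ys) = (if \<exists>j<k. \<exists>v. v # xs \<in> D \<and> arc j v xs ys then val xs ys else 0)"
        using 7(2) len unfolding I_def by blast
      show "sem (steps (write_arc k) k) t 2 (xs @ ys) =
          (if \<exists>j<k. \<exists>v. v # xs \<in> insert vxs D \<and> arc j v xs ys then val xs ys else 0)"
        unfolding body[OF order_refl len fr] old vxs v_def[symmetric] by auto
    qed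
  next
    case (8 D t v x)
    then have "v \<noteq> 2" by auto
    then show ?case using 8 by (simp add: I_def)
  qed (use w[of k] n assms(6) in \<open>auto simp: I_def\<close>)
  then have *: "sem (write_parts k) s 2 (xs @ ys) =
      (if \<exists>j<k. \<exists>v. v # xs \<in> tuples (Suc k) n \<and> arc j v xs ys then val xs ys else 0)"
    using xs unfolding I_def by simp
  have "v # xs \<in> tuples (Suc k) n" if "arc j v xs ys" for j v
  proof -
    have "v < n" using that A(3) unfolding arc_def by blast
    then show ?thesis using xs by simp
  qed
  then have "(\<exists>j<k. \<exists>v. v # xs \<in> tuples (Suc k) n \<and> arc j v xs ys) \<longleftrightarrow> (\<exists>j<k. \<exists>v. arc j v xs ys)"
    by metis
  with * show ?thesis by (simp only: arc_def val_def)
qed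

section \<open>The theorem\<close>

lemma partition_of_cycle_family:
  assumes G: "pair_digraph G" "card (pverts G) \<ge> 2" and k: "k \<ge> 2"
    and cf: "cycle_family (parcs G) J m P (pverts G) lab s"
  defines "Q \<equiv> cycle_family.swapped (parcs G) J P lab s"
  shows "strong_arc_partition (cart_power G k)
    {(xs, ys) \<in> parcs (cart_power G k). first_part Q xs ys}
    {(xs, ys) \<in> parcs (cart_power G k). \<not> first_part Q xs ys}"
proof -
  interpret cycle_family "parcs G" J m P "pverts G" lab s by fact
  obtain a b where "a \<in> pverts G" "b \<in> pverts G" "a \<noteq> b"
    using G(2) by (metis One_nat_def Suc_1 card_le_Suc0_iff_eq card.infinite not_less_eq_eq zero_le)
  then show ?thesis
    unfolding Q_def using arcs_in loopless strong Red_strong k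
    by (intro strong_arc_partition_first_part[of G a b]) auto
qed

lemma pair_digraphD:
  assumes "pair_digraph G"
  shows "parcs G \<subseteq> pverts G \<times> pverts G" "(u, u) \<notin> parcs G" "finite (pverts G)"
proof -
  interpret pair_digraph G by fact
  show "parcs G \<subseteq> pverts G \<times> pverts G" using in_arcsD1 in_arcsD2 by auto
  show "(u, u) \<notin> parcs G" using pair_no_loops by force
  show "finite (pverts G)" by (rule pair_finite_verts)
qed

lemma strongly_connectedD:
  assumes "pair_digraph G" "strongly_connected (with_proj G)" "u \<in> pverts G" "v \<in> pverts G"
  shows "(u, v) \<in> (parcs G)\<^sup>*"
proof -
  have eq: "\<lparr>pverts = pverts G, parcs = parcs G\<rparr> = G" by simp
  have "strongly_connected (with_proj \<lparr>pverts = pverts G, parcs = parcs G\<rparr>)"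
    unfolding eq by (rule assms(2))
  then show ?thesis using strongly_connected_iff[OF pair_digraphD(1)[OF assms(1)]] assms(3,4) by blast
qed

lemma cycle_familyI:
  assumes "cycles (parcs G) J m P" and G: "pair_digraph G" "strongly_connected (with_proj G)"
    and "\<And>u. u \<in> pverts G \<Longrightarrow> lab u \<in> J"
    and "\<And>u. u \<in> pverts G \<Longrightarrow> \<exists>t. u = P (lab u) t \<and> s u = P (lab u) (t + 1)"
  shows "cycle_family (parcs G) J m P (pverts G) lab s"
proof -
  interpret cycles "parcs G" J m P by fact
  show ?thesis
    by unfold_locales
      (use assms(4,5) pair_digraphD[OF G(1)] strongly_connectedD[OF G] in blast)+
qed

theorem ex_partition:
  assumes G: "pair_digraph G" "strongly_connected (with_proj G)" "card (pverts G) \<ge> 2"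
    and C: "arc_disjoint_cycle_cover G C" and k: "k \<ge> 2"
  shows "\<exists>A1 A2. strong_arc_partition (cart_power G k) A1 A2"
proof -
  define P where "P p t = fst (p ! nat (t mod int (length p)))" for p :: "('a \<times> 'a) list" and t
  have cyc: "cycles (parcs G) C length P" and cover: "pverts G = (\<Union>p\<in>C. range (P p))"
    using cycles_of_cover[OF G(1) C] unfolding P_def by simp_all
  define lab where "lab u = (SOME p. p \<in> C \<and> u \<in> range (P p))" for u
  have lab: "lab u \<in> C \<and> u \<in> range (P (lab u))" if "u \<in> pverts G" for u
    unfolding lab_def by (rule someI_ex) (use that cover in blast)
  define s where "s u = P (lab u) ((SOME t. u = P (lab u) t) + 1)" for u
  have s: "\<exists>t. u = P (lab u) t \<and> s u = P (lab u) (t + 1)" if "u \<in> pverts G" for u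
  proof -
    have "u = P (lab u) (SOME t. u = P (lab u) t)"
      by (rule someI_ex) (use lab[OF that] in blast)
    then show ?thesis unfolding s_def by blast
  qed
  have "cycle_family (parcs G) C length P (pverts G) lab s"
    using cycle_familyI[OF cyc G(1,2), of lab s] lab s by blast
  from partition_of_cycle_family[OF G(1,3) k this] show ?thesis by blast
qed

definition main :: "nat \<Rightarrow> loop" where
  "main k = bipartite ;; matching ;; used_arcs ;; extraction ;; crossing ;; write_parts k"

lemma decode_main:
  fixes G :: "nat pair_pre_digraph"
  assumes G: "pair_digraph G" "strongly_connected (with_proj G)" "card (pverts G) \<ge> 2"
    and C: "arc_disjoint_cycle_cover G C" and k: "k \<ge> 2" and V: "pverts G = {..<card (pverts G)}"
  defines "t \<equiv> sem (main k) (sem numbering (encode_digraph G))"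
  shows "strong_arc_partition (cart_power G k) (decode_part G k t 1) (decode_part G k t 2)"
proof -
  define n where "n = card (pverts G)"
  define A where "A = parcs G"
  define s0 where "s0 = sem numbering (encode_digraph G)"
  define s1 where "s1 = sem bipartite s0"
  define s2 where "s2 = sem matching s1"
  define s3 where "s3 = sem used_arcs s2"
  define s4 where "s4 = sem extraction s3"
  define s5 where "s5 = sem crossing s4"
  have t: "t = sem (write_parts k) s5"
    by (simp add: t_def main_def s0_def s1_def s2_def s3_def s4_def s5_def)
  have V': "pverts G = {..<n}" using V by (simp add: n_def)
  have A: "A \<subseteq> {..<n} \<times> {..<n}" "\<And>u. (u, u) \<notin> A"
    using pair_digraphD[OF G(1)] V' by (simp_all add: A_def)
  have f0: "s0 a = encode_digraph G a" if "a \<notin> {24, 25, 4, 3}" for a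
    using that by (simp add: s0_def sem_frame)
  have f1: "s1 a = s0 a" if "a \<notin> {5, 24, 25, 26, 27}" for a
    using that by (simp add: s1_def sem_frame)
  have f2: "s2 a = s1 a" if "a \<notin> {20, 21, 22, 23, 9, 8, 11, 7, 12, 13, 14, 6}" for a
    using that by (simp add: s2_def sem_frame matching_def)
  have f3: "s3 a = s2 a" if "a \<notin> {30, 24, 25}" for a
    using that by (simp add: s3_def sem_frame)
  have f4: "s4 a = s3 a" if "a \<notin> {28, 24, 25, 30, 31, 32, 33, 34, 35, 36, 37, 38, 39, 40, 41}" for a
    using that by (simp add: s4_def sem_frame extraction_def)
  have f5: "s5 a = s4 a" if "a \<notin> {36, 24, 25}" for a
    using that by (simp add: s5_def sem_frame)
  have e: "encode_digraph G 0 [] = n" "encode_digraph G 1 [u, v] \<noteq> 0 \<longleftrightarrow> (u, v) \<in> A"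
    "a \<noteq> 0 \<Longrightarrow> a \<noteq> 1 \<Longrightarrow> encode_digraph G a = (\<lambda>_. 0)" for u v a
    by (auto simp: encode_digraph_def n_def A_def)
  have n0: "s0 0 [] = n" "s1 0 [] = n" "s2 0 [] = n" "s3 0 [] = n" "s4 0 [] = n" "s5 0 [] = n"
    using e(1) by (simp_all add: f0 f1 f2 f3 f4 f5)
  have A0: "s0 1 [u, v] \<noteq> 0 \<longleftrightarrow> (u, v) \<in> A" "s2 1 [u, v] \<noteq> 0 \<longleftrightarrow> (u, v) \<in> A"
    "s4 1 [u, v] \<noteq> 0 \<longleftrightarrow> (u, v) \<in> A" "s5 1 [u, v] \<noteq> 0 \<longleftrightarrow> (u, v) \<in> A" for u v
  proof -
    have "s0 1 = encode_digraph G 1" "s2 1 = encode_digraph G 1" "s4 1 = encode_digraph G 1" "s5 1 = encode_digraph G 1"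
      by (simp_all add: f0 f1 f2 f3 f4 f5)
    then show "s0 1 [u, v] \<noteq> 0 \<longleftrightarrow> (u, v) \<in> A" "s2 1 [u, v] \<noteq> 0 \<longleftrightarrow> (u, v) \<in> A"
      "s4 1 [u, v] \<noteq> 0 \<longleftrightarrow> (u, v) \<in> A" "s5 1 [u, v] \<noteq> 0 \<longleftrightarrow> (u, v) \<in> A"
      using e(2) by simp_all
  qed
  have "encode_digraph G 3 [] = 0" using e(3)[of 3] by simp
  note num = numbering[of "encode_digraph G" n, OF e(1) this, folded s0_def]
  let ?S = "{..<n} \<times> {..<n}"
  have N: "s1 3 [] = n * n" "s3 3 [] = n * n" using num(1) by (simp_all add: f1 f2 f3)
  have E: "s1 5 [code n e, code n f] \<noteq> 0 \<longleftrightarrow> continues A e f" if "e \<in> ?S" "f \<in> ?S" for e f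
    unfolding s1_def
    by (rule bipartite[OF n0(1) A0(1) _ num(2) that]) (simp_all add: f0 e(3))
  define dec where "dec = inv_into ?S (code n)"
  have cd: "code n (dec x) = x" "dec x \<in> ?S" if "x < n * n" for x
    using bij_code[of n] that unfolding dec_def bij_betw_def
    by (metis f_inv_into_f lessThan_iff, metis inv_into_into lessThan_iff)
  have dc: "dec (code n e) = e" "code n e < n * n" if "e \<in> ?S" for e
    using bij_code[of n] that unfolding dec_def bij_betw_def by (simp_all add: inv_into_f_f) blast
  have bij_dec: "bij_betw dec {..<n * n} ?S"
    unfolding dec_def by (rule bij_betw_inv_into[OF bij_code])
  \<comment> \<open>The given cover shows that a perfect matching exists. The partition is built
    from the cycles that the program extracts, which may be different ones.\<close>
  define P0 where "P0 p t = fst (p ! nat (t mod int (length p)))" for p :: "(nat \<times> nat) list" and t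
  have cyc0: "cycles A C length P0" and cover: "pverts G = (\<Union>p\<in>C. range (P0 p))"
    using cycles_of_cover[OF G(1) C] unfolding P0_def A_def by simp_all
  obtain \<pi> where \<pi>: "inj_on \<pi> ?S" "\<And>e. e \<in> ?S \<Longrightarrow> \<pi> e \<in> ?S \<and> continues A e (\<pi> e)"
    using cycles.ex_matching[OF cyc0 A(2) cover] A(1) V' by auto
  define \<rho> where "\<rho> = code n \<circ> \<pi> \<circ> dec"
  have "inj_on \<rho> {..<n * n}"
    unfolding \<rho>_def comp_assoc
  proof (rule comp_inj_on, rule comp_inj_on)
    show "inj_on dec {..<n * n}" using bij_dec by (rule bij_betw_imp_inj_on)
    show "inj_on \<pi> (dec ` {..<n * n})" using \<pi>(1) bij_dec by (simp add: bij_betw_def)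
    have "(\<pi> \<circ> dec) ` {..<n * n} \<subseteq> ?S" using \<pi>(2) cd(2) by fastforce
    then show "inj_on (code n) ((\<pi> \<circ> dec) ` {..<n * n})"
      using bij_code[of n] by (auto simp: bij_betw_def intro: inj_on_subset)
  qed
  moreover have "\<rho> x < n * n \<and> s1 5 [x, \<rho> x] \<noteq> 0" if "x < n * n" for x
    using E[of "dec x" "\<pi> (dec x)"] cd[OF that] \<pi>(2)[of "dec x"] dc(2)[of "\<pi> (dec x)"]
    by (simp add: \<rho>_def)
  moreover have "s1 7 [y] = 0" for y by (simp add: f1 f0 e(3))
  ultimately have M: "bij_betw (\<lambda>x. s2 6 [x]) {..<n * n} {..<n * n}"
    "\<And>x. x < n * n \<Longrightarrow> s1 5 [x, s2 6 [x]] \<noteq> 0"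
    using matching[of s1 "n * n" \<rho>, OF N(1)] unfolding s2_def by blast+
  define \<tau> where "\<tau> e = dec (s2 6 [code n e])" for e
  have bij\<tau>: "bij_betw \<tau> ?S ?S"
    using bij_betw_trans[OF bij_betw_trans[OF bij_code M(1)] bij_dec]
    by (simp add: \<tau>_def[abs_def] comp_def)
  have s2V: "s2 6 [x] < n * n" if "x < n * n" for x using M(1) that by (auto simp: bij_betw_def)
  have cont: "continues A e (\<tau> e)" if "e \<in> ?S" for e
    using M(2)[OF dc(2)[OF that]] E[OF that cd(2)[OF s2V[OF dc(2)[OF that]]]] cd(1)[OF s2V[OF dc(2)[OF that]]]
    unfolding \<tau>_def by metis
  define F where "F = {e \<in> A. \<tau> e \<noteq> e}"
  have balF: "balanced F" and domF: "\<And>a. a < n \<Longrightarrow> \<exists>b. (a, b) \<in> F"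
    using balanced_of_matching[OF bij\<tau> cont A(2,1)] unfolding balanced_def F_def by auto
  have FS: "F \<subseteq> ?S" using A(1) by (auto simp: F_def)
  have "s3 30 [a, b] \<noteq> 0 \<longleftrightarrow> (a, b) \<in> A \<and> s2 6 [code n (a, b)] \<noteq> code n (a, b)" for a b
    unfolding s3_def
  proof (rule used_arcs[OF n0(3) A0(2) A(1)])
    show "s2 30 = (\<lambda>_. 0)" by (simp add: f0 f1 f2 e(3))
    show "s2 4 [fst e, snd e] = code n e" if "e \<in> ?S" for e using num(2)[OF that] by (simp add: f1 f2)
  qed
  moreover have "s2 6 [code n e] \<noteq> code n e \<longleftrightarrow> \<tau> e \<noteq> e" if "e \<in> ?S" for e
    using cd(1)[OF s2V[OF dc(2)[OF that]]] dc(1)[OF that] unfolding \<tau>_def by metis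
  ultimately have F30: "s3 30 [a, b] \<noteq> 0 \<longleftrightarrow> (a, b) \<in> F" for a b
    using A(1) unfolding F_def by blast
  have "s3 36 = (\<lambda>_. 0)" "s3 39 = (\<lambda>_. 0)" "s3 40 = (\<lambda>_. 0)" "s3 41 [] = 0"
    by (simp_all add: f0 f1 f2 f3 e(3))
  then obtain J m P where ex: "extracted F s4 J m P" and cF: "cycles.cyc_arcs J P = F"
    using extraction[of s3 n, OF n0(4) N(2) FS balF F30] unfolding s4_def by blast
  interpret FC: cycles F J m P using ex by (simp add: extracted_def)
  have cyc: "cycles A J m P"
  proof
    show "(P j t, P j (t + 1)) \<in> A" if "j \<in> J" for j t using FC.P_arc[OF that] by (simp add: F_def)
  qed (use FC.m_pos FC.P_eq_iff FC.P_disjoint in blast)+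
  note ex' = ex[unfolded extracted_def]
  \<comment> \<open>Every vertex has an arc of \<open>F\<close> leaving it, and the extracted cycles
    use all of \<open>F\<close>; so they cover the vertices.\<close>
  have on: "u \<in> (\<Union>j\<in>J. range (P j))" if "u \<in> pverts G" for u
  proof -
    obtain b where "(u, b) \<in> F" using domF \<open>u \<in> pverts G\<close> V' by auto
    then show ?thesis unfolding cF[symmetric] FC.cyc_arcs_def by blast
  qed
  have lab: "s4 37 [u] \<in> J \<and> (\<exists>r. u = P (s4 37 [u]) r \<and> s4 38 [u] = P (s4 37 [u]) (r + 1))"
    if "u \<in> pverts G" for u
    using ex'[THEN conjunct2, THEN conjunct2, THEN conjunct2, THEN conjunct2, THEN conjunct1] on[OF that]
    by (rule bspec)
  define lab where "lab u = s4 37 [u]" for u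
  define s where "s u = s4 38 [u]" for u
  have cf: "cycle_family (parcs G) J m P (pverts G) lab s"
    using cycle_familyI[OF cyc[unfolded A_def] G(1,2), of lab s] lab unfolding lab_def s_def by blast
  interpret cycle_family "parcs G" J m P "pverts G" lab s by (rule cf)
  have arrays: "\<And>u v. s4 40 [u, v] \<noteq> 0 \<longleftrightarrow> (u, v) \<in> cyc_arcs"
    "\<And>u v w. s4 36 [u, v, w] \<noteq> 0 \<longleftrightarrow> (\<exists>j\<in>J. \<exists>r. u = P j r \<and> v = P j (r + 1) \<and> w = P j (- r))"
    "\<And>i v. s4 39 [i, v] \<noteq> 0 \<longleftrightarrow> i \<in> J \<and> v \<in> range (P i)"
    using ex' by (simp_all only: simp_thms)
  have cr: "(u, w) \<in> A \<and> s4 40 [u, w] = 0 \<and> s4 39 [s4 37 [u], w] = 0 \<longleftrightarrow> cross u w" for u w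
  proof (cases "(u, w) \<in> A")
    case True
    then have "u \<in> pverts G" using A(1) V' by auto
    then have "lab u \<in> J" by (rule lab_in)
    then show ?thesis
      using arrays(1)[of u w] arrays(3)[of "lab u" w] True unfolding cross_def unfolding A_def lab_def by blast
  next
    case False
    then show ?thesis unfolding cross_def unfolding A_def by blast
  qed
  have Q: "s5 36 [u, v, w] \<noteq> 0 \<longleftrightarrow> swapped u v w" for u v w
    unfolding s5_def crossing[of s4 n, OF n0(5) A0(3) A(1)] cr arrays(2) swapped_def s_def ..
  have out: "t 2 (xs @ ys) = (if (xs, ys) \<in> parcs (cart_power G k) then if first_part swapped xs ys then 1 else 2 else 0)"
    if "xs \<in> pverts (cart_power G k)" "ys \<in> pverts (cart_power G k)" for xs ys
  proof -
    have xs: "xs \<in> tuples k n" "length ys = k" using that V' by (auto simp: pverts_cart_power)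
    have "s5 2 = (\<lambda>_. 0)" by (simp add: f0 f1 f2 f3 f4 f5 e(3))
    from write_parts[of s5 n, OF n0(6) A0(4) A(2,1) Q this k xs] show ?thesis
      using arc_cart_power_iff[OF arcs_in, of xs ys k] that unfolding t A_def by simp
  qed
  have sub: "parcs (cart_power G k) \<subseteq> pverts (cart_power G k) \<times> pverts (cart_power G k)"
    by (rule parcs_cart_power[OF arcs_in])
  have "decode_part G k t 1 = {(xs, ys) \<in> parcs (cart_power G k). first_part swapped xs ys}"
    unfolding decode_part_def using out sub by (auto split: if_splits)
  moreover have "decode_part G k t 2 = {(xs, ys) \<in> parcs (cart_power G k). \<not> first_part swapped xs ys}"
    unfolding decode_part_def using out sub by (auto split: if_splits)
  ultimately show ?thesis
    using partition_of_cycle_family[OF G(1,3) k cf] by simp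
qed

lemma program_ok:
  assumes "k \<ge> 2"
  shows "counters_ok numbering" "bounds numbering = {0}" "counters_ok (main k)" "bounds (main k) \<subseteq> {0, 3}"
    "bounds (main k) \<inter> writes (main k) = {}" "0 \<notin> writes numbering"
proof -
  have w: "writes (write_arc k j) = {2}" "counters_ok (write_arc k j)" "bounds (write_arc k j) = {}" for j
    by (simp_all add: write_arc_def Let_def)
  have c: "distinct (coords k)" "set (coords k) = {50..<50 + k}" by (auto simp: coords_def distinct_map)
  have b: "bounds (write_parts k) \<subseteq> {0}"
    using bounds_nest[of "49 # coords k" "steps (write_arc k) k"] w
    by (simp add: write_parts_def bounds_steps)
  have wp: "writes (write_parts k) \<subseteq> {2} \<union> {49..<50 + k}"
    using w c by (auto simp: write_parts_def writes_steps)
  have m: "x = 0" if "x \<in> bounds (mark vs g a es)" for x vs g a es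
    using that bounds_nest[of vs] by (fastforce simp: mark_def)
  have bs: "x = 0" if "x \<in> bounds scan" for x
    using that bounds_nest[of "[24, 25]"] by (fastforce simp: scan_def)
  show "counters_ok numbering" "bounds numbering = {0}" "0 \<notin> writes numbering"
    by (simp_all add: numbering_def)
  show "counters_ok (main k)"
    using w c by (auto simp: main_def bipartite_def matching_def search_def search_round_def search_step_def
        find_free_def augment_def flip_step_def used_arcs_def extraction_def extraction_round_def scan_def
        walk_def trace_def record_cycle_def record_arc_def crossing_def write_parts_def mark_def Let_def
        counters_ok_steps writes_steps)
  show B: "bounds (main k) \<subseteq> {0, 3}"
    using b by (auto dest!: m bs simp: main_def bipartite_def matching_def search_def search_round_def search_step_def
        find_free_def augment_def flip_step_def used_arcs_def extraction_def extraction_round_def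
        walk_def trace_def record_cycle_def record_arc_def crossing_def Let_def)
  have "0 \<notin> writes (main k)" "3 \<notin> writes (main k)"
    using wp by (auto simp: main_def matching_def extraction_def)
  with B show "bounds (main k) \<inter> writes (main k) = {}" by blast
qed

theorem theorem3p4:
  fixes k :: nat
  assumes "k \<ge> 2"
  shows
    "(\<forall>G :: 'a pair_pre_digraph.
        pair_digraph G \<and> strongly_connected (with_proj G) \<and> card (pverts G) \<ge> 2 \<and>
        (\<exists>C. arc_disjoint_cycle_cover G C) \<longrightarrow>
        (\<exists>A1 A2. strong_arc_partition (cart_power G k) A1 A2)) \<and>
     (\<exists>(c :: prog) (p :: nat poly). \<forall>G :: nat pair_pre_digraph.
        pair_digraph G \<and> strongly_connected (with_proj G) \<and> card (pverts G) \<ge> 2 \<and>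
        (\<exists>C. arc_disjoint_cycle_cover G C) \<and> pverts G = {..<card (pverts G)} \<longrightarrow>
        (\<exists>t s. exec c (encode_digraph G) t s \<and> t \<le> poly p (card (pverts G)) \<and>
           strong_arc_partition (cart_power G k) (decode_part G k s 1) (decode_part G k s 2)))"
proof (intro conjI)
  show "\<forall>G :: 'a pair_pre_digraph.
        pair_digraph G \<and> strongly_connected (with_proj G) \<and> card (pverts G) \<ge> 2 \<and>
        (\<exists>C. arc_disjoint_cycle_cover G C) \<longrightarrow>
        (\<exists>A1 A2. strong_arc_partition (cart_power G k) A1 A2)"
    using ex_partition assms by blast
  define c where "c = Seq (compile numbering) (compile (main k))"
  \<comment> \<open>The loops of \<open>numbering\<close> are limited by \<open>n\<close>, those of
    \<open>main\<close> by \<open>n\<close> and \<open>n * n\<close>; hence its cost is evaluated at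
    the square.\<close>
  define p where "p = cost numbering + pcompose (cost (main k)) [:0, 0, 1:]"
  note ok = program_ok[OF assms]
  show "\<exists>(c :: prog) (p :: nat poly). \<forall>G :: nat pair_pre_digraph.
        pair_digraph G \<and> strongly_connected (with_proj G) \<and> card (pverts G) \<ge> 2 \<and>
        (\<exists>C. arc_disjoint_cycle_cover G C) \<and> pverts G = {..<card (pverts G)} \<longrightarrow>
        (\<exists>t s. exec c (encode_digraph G) t s \<and> t \<le> poly p (card (pverts G)) \<and>
           strong_arc_partition (cart_power G k) (decode_part G k s 1) (decode_part G k s 2))"
  proof (rule exI[of _ c], rule exI[of _ p], intro allI impI)
    fix G :: "nat pair_pre_digraph"
    assume "pair_digraph G \<and> strongly_connected (with_proj G) \<and> card (pverts G) \<ge> 2 \<and>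
      (\<exists>C. arc_disjoint_cycle_cover G C) \<and> pverts G = {..<card (pverts G)}"
    then obtain C where G: "pair_digraph G" "strongly_connected (with_proj G)" "card (pverts G) \<ge> 2"
      "arc_disjoint_cycle_cover G C" "pverts G = {..<card (pverts G)}" by blast
    define n where "n = card (pverts G)"
    define s where "s = sem numbering (encode_digraph G)"
    have e: "encode_digraph G 0 [] = n" "encode_digraph G 3 [] = 0" by (simp_all add: encode_digraph_def n_def)
    have b: "bounds numbering \<inter> writes numbering = {}" using ok(2,6) by simp
    have "encode_digraph G b [] \<le> n" if "b \<in> bounds numbering" for b
      using that e(1) ok(2) by simp
    from exec_compile[of numbering "encode_digraph G" n, OF ok(1) b this] obtain t1 where t1: "t1 \<le> poly (cost numbering) n" "exec (compile numbering) (encode_digraph G) t1 s"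
      unfolding s_def by blast
    have "s 0 [] = n" using e(1) ok(6) by (simp add: s_def sem_frame)
    moreover have "s 3 [] = n * n" by (rule numbering(1)[of "encode_digraph G" n, OF e, folded s_def])
    moreover have "n \<le> n * n" by simp
    ultimately have "s b [] \<le> n * n" if "b \<in> bounds (main k)" for b
      using subsetD[OF ok(4) that] by auto
    from exec_compile[of "main k" s "n * n", OF ok(3,5) this] obtain t2 where t2: "t2 \<le> poly (cost (main k)) (n * n)"
      "exec (compile (main k)) s t2 (sem (main k) s)"
      by blast
    have "t1 + t2 \<le> poly p n" using t1(1) t2(1) by (simp add: p_def poly_pcompose)
    then show "\<exists>t s. exec c (encode_digraph G) t s \<and> t \<le> poly p (card (pverts G)) \<and>
           strong_arc_partition (cart_power G k) (decode_part G k s 1) (decode_part G k s 2)"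
      using exec.Seq[OF t1(2) t2(2)] decode_main[OF G(1-4) assms G(5)] unfolding n_def c_def s_def by blast
  qed
qed

end
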